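(* Let $\mathbb{K}$ be a field of characteristic zero and let $\Delta$ be a $d$-dimensional simplicial sphere (a simplicial complex homeomorphic to a $d$-dimensional sphere) on vertex set $[n]$ with $d>0$. Then $\Delta$ has a $2$-unexpected system of parameters (of some total degree) if and only if $\Delta$ is balanced. In this case, the colored sop is an example of a $2$-unexpected system of parameters of $\Delta$.
   Context: $R=\mathbb{K}[x_1,\dots,x_n]$, $I_\Delta=(\prod_{i\in\sigma}x_i:\sigma\notin\Delta)\subset R$ is the Stanley-Reisner ideal; every element of $[n]$ is a vertex of $\Delta$. $\mathrm{HF}(i,A)=\dim_{\mathbb{K}}A_i$. $h_\Delta(x)$ is the $h$-polynomial: the Hilbert series of $R/I_\Delta$ is $h_\Delta(x)/(1-x)^{d+1}$. Let $L=x_1+\dots+x_n$. For an integer $t\ge\deg h_\Delta(x)$, a sequence $\theta_1,\dots,\theta_{d+1}\in R$ (not assumed linear) is a $2$-unexpected system of parameters of total degree $t$ of $\Delta$ if: (U1) the $\theta_i$ are homogeneous and $R/(I_\Delta+(\theta_1,\dots,\theta_{d+1}))$ is a finite dimensional $\mathbb{K}$-vector space; (U2) $\deg\theta_1+\dots+\deg\theta_{d+1}+\deg h_\Delta(x)-d-1=t$; (U3) $L\in I_\Delta+(\theta_1,\dots,\theta_{d+1})$; (U4) $x_i^2\in I_\Delta+(\theta_1,\dots,\theta_{d+1})$ for every $i$; (U5) $\mathrm{HF}(t,R/J)\le\mathrm{HF}(t-1,R/J)$, where $J=I_\Delta+(x_1^2,\dots,x_n^2)$. $\Delta$ is balanced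 if there is a coloring $\rho:[n]\to[d+1]$ with $\rho(u)\ne\rho(v)$ whenever $\{u,v\}\in\Delta$, $u\ne v$; the colored sop with respect to $\rho$ is $\theta_i=\sum_{v\in\rho^{-1}(i)}x_v$, $i\in[d+1]$.
   Formalization: The elements of a 2-unexpected system of parameters are required to have positive degree; without this, taking θ_1 = 1 and θ_2 of large degree would satisfy (U1)–(U5) for every sphere, balanced or not. *)

theory Defs
  imports
    "HOL-Analysis.Analysis"
    "HOL-Library.Poly_Mapping"
    "HOL-Computational_Algebra.Polynomial_FPS"
begin

section \<open>The polynomial ring\<close>

text \<open>
  The variables are indexed by a finite type \<open>'n\<close>, which plays the role of \<open>[n]\<close>.  The whole type
  \<open>('n, 'k) mpoly\<close> is the ring \<open>R = K[x\<^sub>1, \<dots>, x\<^sub>n]\<close>: a polynomial maps exponent vectors to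
  coefficients, and multiplication is convolution.
\<close>

type_synonym ('n, 'k) mpoly = "('n \<Rightarrow>\<^sub>0 nat) \<Rightarrow>\<^sub>0 'k"

definition var :: "'n \<Rightarrow> ('n, 'k::field) mpoly" where
  "var i = Poly_Mapping.single (Poly_Mapping.single i 1) 1"

definition scal :: "'k::field \<Rightarrow> ('n, 'k) mpoly \<Rightarrow> ('n, 'k) mpoly" where
  "scal c p = Poly_Mapping.single 0 c * p"

lemma vector_space_scal:
  "vector_space (scal :: 'k::field \<Rightarrow> ('n, 'k) mpoly \<Rightarrow> ('n, 'k) mpoly)"
  by unfold_locales
    (simp_all add: scal_def distrib_left distrib_right single_add mult_single mult.assoc [symmetric])

lemma module_mult:
  "module ((*) :: 'a::comm_ring_1 \<Rightarrow> 'a \<Rightarrow> 'a)"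
  by unfold_locales (simp_all add: algebra_simps)

definition lin_span :: "('n, 'k::field) mpoly set \<Rightarrow> ('n, 'k) mpoly set" where
  "lin_span = module.span scal"

definition ideal_gen :: "('n, 'k::field) mpoly set \<Rightarrow> ('n, 'k) mpoly set" where
  "ideal_gen = module.span (*)"

definition mon_deg :: "('n::finite \<Rightarrow>\<^sub>0 nat) \<Rightarrow> nat" where
  "mon_deg m = (\<Sum>i\<in>UNIV. Poly_Mapping.lookup m i)"

text \<open>The total degree; the zero polynomial gets degree \<open>0\<close>.\<close>

definition tot_deg :: "('n::finite, 'k::field) mpoly \<Rightarrow> nat" where
  "tot_deg p = Max (insert 0 (mon_deg ` Poly_Mapping.keys p))"

text \<open>The graded piece \<open>R\<^sub>i\<close>, for any integer \<open>i\<close>; it is \<open>{0}\<close> for negative \<open>i\<close>.\<close>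

definition graded_piece :: "int \<Rightarrow> ('n::finite, 'k::field) mpoly set" where
  "graded_piece i = {p. \<forall>m\<in>Poly_Mapping.keys p. int (mon_deg m) = i}"

definition homogeneous :: "('n::finite, 'k::field) mpoly \<Rightarrow> bool" where
  "homogeneous p \<longleftrightarrow> (\<exists>i. p \<in> graded_piece i)"


section \<open>Quotients and Hilbert functions\<close>

text \<open>
  For linear subspaces \<open>U\<close> and \<open>W\<close> of \<open>R\<close>, the predicate \<open>basis_mod U W B\<close> says that the classes
  modulo \<open>W\<close> of the elements of \<open>B \<subseteq> U\<close> are pairwise distinct and form a basis of the image of
  \<open>U\<close> in \<open>R / W\<close>.
\<close>

definition basis_mod ::
  "('n, 'k::field) mpoly set \<Rightarrow> ('n, 'k) mpoly set \<Rightarrow> ('n, 'k) mpoly set \<Rightarrow> bool" where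
  "basis_mod U W B \<longleftrightarrow>
     B \<subseteq> U \<and>
     U \<subseteq> lin_span (B \<union> W) \<and>
     (\<forall>S c. finite S \<and> S \<subseteq> B \<and> (\<Sum>b\<in>S. scal (c b) b) \<in> W \<longrightarrow> (\<forall>b\<in>S. c b = 0))"

definition fin_dim_mod :: "('n, 'k::field) mpoly set \<Rightarrow> ('n, 'k) mpoly set \<Rightarrow> bool" where
  "fin_dim_mod U W \<longleftrightarrow> (\<exists>B. finite B \<and> basis_mod U W B)"

definition dim_mod :: "('n, 'k::field) mpoly set \<Rightarrow> ('n, 'k) mpoly set \<Rightarrow> nat" where
  "dim_mod U W = card (SOME B. basis_mod U W B)"

text \<open>\<open>HF i J\<close> is the dimension of \<open>(R/J)\<^sub>i\<close>, the image of \<open>R\<^sub>i\<close> in \<open>R/J\<close>, for a homogeneous ideal \<open>J\<close>.\<close>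

definition HF :: "int \<Rightarrow> ('n::finite, 'k::field) mpoly set \<Rightarrow> nat" where
  "HF i J = dim_mod (graded_piece i) J"

definition hilbert_series :: "('n::finite, 'k::field) mpoly set \<Rightarrow> int fps" where
  "hilbert_series J = Abs_fps (\<lambda>i. int (HF (int i) J))"


section \<open>Simplicial complexes and spheres\<close>

text \<open>Abstract simplicial complexes in which every element of the index type is a vertex.\<close>

definition complex_on_vertices :: "'n::finite set set \<Rightarrow> bool" where
  "complex_on_vertices \<Delta> \<longleftrightarrow>
     {} \<in> \<Delta> \<and> (\<forall>\<sigma>\<in>\<Delta>. \<forall>\<tau>. \<tau> \<subseteq> \<sigma> \<longrightarrow> \<tau> \<in> \<Delta>) \<and> (\<forall>v. {v} \<in> \<Delta>)"

definition complex_dim :: "'n::finite set set \<Rightarrow> nat" where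
  "complex_dim \<Delta> = Max (card ` \<Delta>) - 1"

definition realization :: "'n::finite set set \<Rightarrow> (real ^ 'n) set" where
  "realization \<Delta> = (\<Union>\<sigma>\<in>\<Delta>. convex hull ((\<lambda>v. axis v 1) ` \<sigma>))"

definition simplicial_sphere :: "nat \<Rightarrow> 'n::finite set set \<Rightarrow> bool" where
  "simplicial_sphere d \<Delta> \<longleftrightarrow>
     complex_on_vertices \<Delta> \<and> complex_dim \<Delta> = d \<and>
     top_of_set (realization \<Delta>) homeomorphic_space nsphere d"


section \<open>Stanley--Reisner rings\<close>

definition stanley_reisner :: "'n::finite set set \<Rightarrow> ('n, 'k::field) mpoly set" where
  "stanley_reisner \<Delta> = ideal_gen {\<Prod>i\<in>\<sigma>. var i | \<sigma>. \<sigma> \<notin> \<Delta>}"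

text \<open>
  The Hilbert series of \<open>R/I\<^sub>\<Delta>\<close> is \<open>h(x) / (1 - x)\<^bsup>d+1\<^esup>\<close> with \<open>d = dim \<Delta>\<close>.  The type argument
  names the coefficient field.
\<close>

definition h_polynomial :: "'k::field itself \<Rightarrow> 'n::finite set set \<Rightarrow> int poly" where
  "h_polynomial _ \<Delta> = (THE h.
     hilbert_series (stanley_reisner \<Delta> :: ('n, 'k) mpoly set) * (1 - fps_X) ^ (complex_dim \<Delta> + 1)
       = fps_of_poly h)"


section \<open>Unexpected systems of parameters and balanced complexes\<close>

text \<open>
  A sequence \<open>\<theta>\<^sub>1, \<dots>, \<theta>\<^sub>d\<^sub>+\<^sub>1\<close> is a function on \<open>nat\<close>, of which only the values on \<open>{1..d + 1}\<close>
  matter.  \<open>sop_ideal \<Delta> \<theta>\<close> is \<open>I\<^sub>\<Delta> + (\<theta>\<^sub>1, \<dots>, \<theta>\<^sub>d\<^sub>+\<^sub>1)\<close>.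
\<close>

definition sop_ideal ::
  "'n::finite set set \<Rightarrow> (nat \<Rightarrow> ('n, 'k::field) mpoly) \<Rightarrow> ('n, 'k) mpoly set" where
  "sop_ideal \<Delta> \<theta> = ideal_gen (stanley_reisner \<Delta> \<union> \<theta> ` {1..complex_dim \<Delta> + 1})"

text \<open>
  As always for systems of parameters of a graded ring, the \<open>\<theta>\<^sub>i\<close> have positive degree, i.e. lie in
  the irrelevant ideal.  Without this, \<open>\<theta>\<^sub>1 = 1\<close> would make all conditions on the quotient vacuous.
\<close>

definition unexpected_sop2 ::
  "'n::finite set set \<Rightarrow> int \<Rightarrow> (nat \<Rightarrow> ('n, 'k::field) mpoly) \<Rightarrow> bool" where
  "unexpected_sop2 \<Delta> t \<theta> \<longleftrightarrow>
     (let d = complex_dim \<Delta>;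
          h = h_polynomial TYPE('k) \<Delta>;
          A = sop_ideal \<Delta> \<theta>;
          J = ideal_gen (stanley_reisner \<Delta> \<union> range (\<lambda>i. (var i)\<^sup>2)) :: ('n, 'k) mpoly set
      in t \<ge> int (Polynomial.degree h) \<and>
         (\<forall>i\<in>{1..d + 1}. homogeneous (\<theta> i) \<and> 0 < tot_deg (\<theta> i)) \<and>
         fin_dim_mod UNIV A \<and>
         (\<Sum>i\<in>{1..d + 1}. int (tot_deg (\<theta> i))) + int (Polynomial.degree h) - int d - 1 = t \<and>
         (\<Sum>i\<in>UNIV. var i) \<in> A \<and>
         (\<forall>i. (var i)\<^sup>2 \<in> A) \<and>
         HF t J \<le> HF (t - 1) J)"

definition proper_coloring :: "'n::finite set set \<Rightarrow> ('n \<Rightarrow> nat) \<Rightarrow> bool" where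
  "proper_coloring \<Delta> \<rho> \<longleftrightarrow>
     (\<forall>v. \<rho> v \<in> {1..complex_dim \<Delta> + 1}) \<and>
     (\<forall>u v. {u, v} \<in> \<Delta> \<and> u \<noteq> v \<longrightarrow> \<rho> u \<noteq> \<rho> v)"

definition balanced :: "'n::finite set set \<Rightarrow> bool" where
  "balanced \<Delta> \<longleftrightarrow> (\<exists>\<rho>. proper_coloring \<Delta> \<rho>)"

definition colored_sop :: "('n::finite \<Rightarrow> nat) \<Rightarrow> nat \<Rightarrow> ('n, 'k::field) mpoly" where
  "colored_sop \<rho> i = (\<Sum>v\<in>{v. \<rho> v = i}. var v)"

end

theory Submission
  imports Defs "HOL-Homology.Homology"
begin

text \<open>
  The topology enters through singular homology.  Removing the barycenter of a face \<open>\<sigma>\<close> from the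
  sphere \<open>|\<Delta>|\<close> leaves a contractible space that retracts onto the complex of faces not containing
  \<open>\<sigma>\<close>.  Adding simplices one at a time computes relative homology and Euler characteristics, so
  \<open>\<Delta>\<close> is pure, every ridge lies in exactly two facets, the facets avoiding a vertex are strongly
  connected, and the reduced Euler characteristic is \<open>(-1)\<^sup>d\<close>.  The latter is, up to sign, the
  coefficient of \<open>x\<^sup>d\<^sup>+\<^sup>1\<close> in \<open>h\<^sub>\<Delta>\<close>, so \<open>t = d + 1\<close> works for the colored sop, and (U5) is the
  double count \<open>(d + 1) f\<^sub>d = 2 f\<^sub>d\<^sub>-\<^sub>1\<close>.

  Conversely, restrict \<open>x\<^sub>v\<^sup>2 \<in> I\<^sub>\<Delta> + (\<theta>)\<close> to the coordinate subspaces spanned by the facets.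
  Since \<open>x\<^sub>v\<^sup>2\<close> vanishes on facets avoiding \<open>v\<close>, all \<open>\<theta>\<^sub>i\<close> must be linear; let \<open>P\<^sub>w\<close> be the vector
  of the coefficients of \<open>x\<^sub>w\<close> in \<open>\<theta>\<^sub>1, \<dots>, \<theta>\<^sub>d\<^sub>+\<^sub>1\<close>.  The relations yield for each \<open>v\<close> a vector that is
  orthogonal to \<open>P\<^sub>w\<close> for all neighbours \<open>w\<close> of \<open>v\<close>, but not to \<open>P\<^sub>v\<close>.  With (U3) this gives
  \<open>P\<^sub>a = P\<^sub>b\<close> whenever \<open>a\<close> and \<open>b\<close> are the two vertices opposite to a ridge, so that \<open>w \<mapsto> P\<^sub>w\<close>
  takes only \<open>d + 1\<close> values and is a proper coloring.
\<close>


section \<open>Ranks of abelian groups\<close>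

text \<open>Links in a triangulated topological sphere need not be spheres, so there is no induction
  over links. All local information comes from one kind of space, the sphere minus a point. Integral
  homology is compared through ranks: adding a simplex inserts one infinite cyclic term into the
  long exact sequence, which moves the alternating sum of ranks by one. In the converse the obstacle
  is that the cofactors in a representation of \<open>x_v^2\<close> by the \<open>\<theta> i\<close>
  are not unique: Koszul relations change them by a skew-symmetric map. For a colored sop,
  \<open>x_v^2\<close> equals \<open>x_v\<close> times the form of the color of \<open>v\<close>
  modulo the Stanley-Reisner ideal. The aim is the same shape, \<open>x_v\<close> times a
  combination of the \<open>\<theta> i\<close> with constant coefficients \<open>n\<close>; this
  says that \<open>n\<close> is orthogonal to \<open>P w\<close> for all neighbours \<open>w\<close>
  of \<open>v\<close> and has product 1 with \<open>P v\<close>. A single skew map must be removed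
  on all facets avoiding \<open>v\<close> at once, which is why exactly those facets have to be
  strongly connected.\<close>

definition torsion_elt :: "('a, 'b) monoid_scheme \<Rightarrow> 'a \<Rightarrow> bool" where
  "torsion_elt G x \<longleftrightarrow> (\<exists>n::int. n \<noteq> 0 \<and> x [^]\<^bsub>G\<^esub> n = \<one>\<^bsub>G\<^esub>)"

definition rat_functional :: "('a, 'b) monoid_scheme \<Rightarrow> ('a \<Rightarrow> rat) \<Rightarrow> bool" where
  "rat_functional G f \<longleftrightarrow> (\<forall>x\<in>carrier G. \<forall>y\<in>carrier G. f (x \<otimes>\<^bsub>G\<^esub> y) = f x + f y)"

text \<open>
  The witnesses are a family of functionals and a dual family of elements; that the common kernel is
  torsion makes \<open>r\<close> the rank.
\<close>

definition has_rank :: "('a, 'b) monoid_scheme \<Rightarrow> nat \<Rightarrow> bool" where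
  "has_rank G r \<longleftrightarrow> (\<exists>(I :: nat set) \<phi> g. finite I \<and> card I = r \<and>
     (\<forall>i\<in>I. g i \<in> carrier G \<and> rat_functional G (\<phi> i)) \<and>
     (\<forall>i\<in>I. \<forall>j\<in>I. \<phi> i (g j) = (if i = j then 1 else 0)) \<and>
     (\<forall>x\<in>carrier G. (\<forall>i\<in>I. \<phi> i x = 0) \<longrightarrow> torsion_elt G x))"

context group
begin

lemma rat_functional_one: "rat_functional G f \<Longrightarrow> f \<one> = 0"
  unfolding rat_functional_def by (metis add_cancel_left_left one_closed r_one)

lemma rat_functional_inv:
  assumes "rat_functional G f" "x \<in> carrier G"
  shows "f (inv x) = - f x"
proof -
  have "f (x \<otimes> inv x) = f x + f (inv x)"
    using assms unfolding rat_functional_def by (meson inv_closed)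
  then show ?thesis
    using assms rat_functional_one[OF assms(1)] by (simp add: eq_neg_iff_add_eq_0 add.commute)
qed

lemma rat_functional_nat_pow:
  assumes "rat_functional G f" "x \<in> carrier G"
  shows "f (x [^] (n::nat)) = of_nat n * f x"
proof (induction n)
  case (Suc n)
  have "f (x [^] n \<otimes> x) = f (x [^] n) + f x"
    using assms unfolding rat_functional_def by auto
  then show ?case using Suc by (simp add: distrib_right)
qed (use assms rat_functional_one in auto)

lemma rat_functional_int_pow:
  assumes "rat_functional G f" "x \<in> carrier G"
  shows "f (x [^] (n::int)) = of_int n * f x"
proof (cases "n \<ge> 0")
  case True
  then obtain m where "n = int m" by (metis nonneg_int_cases)
  then show ?thesis using rat_functional_nat_pow[OF assms] by (simp add: int_pow_int)
next
  case False
  then obtain m where m: "n = - int m" by (metis int_cases2 nle_le of_nat_0_le_iff)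
  have "x [^] n = inv (x [^] m)" using assms m int_pow_neg int_pow_int by metis
  then show ?thesis using m assms rat_functional_inv rat_functional_nat_pow by simp
qed

lemma rat_functional_torsion:
  assumes "rat_functional G f" "x \<in> carrier G" "torsion_elt G x"
  shows "f x = 0"
  using assms rat_functional_int_pow[OF assms(1,2)] rat_functional_one[OF assms(1)]
  unfolding torsion_elt_def by (metis mult_eq_0_iff of_int_eq_0_iff)

lemma torsion_root:
  assumes "x \<in> carrier G" "torsion_elt G (x [^] (n::int))" "n \<noteq> 0"
  shows "torsion_elt G x"
  using assms unfolding torsion_elt_def by (metis int_pow_pow mult_eq_0_iff)

lemma torsion_one: "torsion_elt G \<one>"
  unfolding torsion_elt_def by (rule exI[of _ 1]) simp

lemma has_rank_trivial: "trivial_group G \<Longrightarrow> has_rank G 0"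
  unfolding has_rank_def
  by (rule exI[of _ "{}"]) (auto simp: trivial_group_def torsion_one)

text \<open>Uniqueness of the rank is established for the two groups where it is read off in the
  end, the trivial group and, in \<open>has_rank_integer_group\<close>, the integers.\<close>

lemma trivial_has_rank:
  assumes "trivial_group G" "has_rank G r"
  shows "r = 0"
proof (rule ccontr)
  assume "r \<noteq> 0"
  then obtain I and \<phi> :: "nat \<Rightarrow> 'a \<Rightarrow> rat" and g i where "i \<in> I" "g i \<in> carrier G"
      "rat_functional G (\<phi> i)" "\<phi> i (g i) = 1"
    using assms(2) unfolding has_rank_def by (metis all_not_in_conv card.empty)
  moreover have "g i = \<one>" using assms \<open>g i \<in> carrier G\<close> by (auto simp: trivial_group_def)
  ultimately show False using rat_functional_one by (metis zero_neq_one)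
qed

end

lemma has_rank_iso:
  assumes "group G" "group H" "h \<in> iso G H" "has_rank G r"
  shows "has_rank H r"
proof -
  interpret G: group G by fact
  interpret H: group H by fact
  interpret h: group_hom G H h
    using assms by (simp add: group_hom_def group_hom_axioms_def iso_def)
  define k where "k = inv_into (carrier G) h"
  have bij: "bij_betw h (carrier G) (carrier H)" using assms by (simp add: iso_def)
  have k: "k \<in> iso H G" unfolding k_def using assms(3) G.iso_set_sym by blast
  then interpret k: group_hom H G k
    by (simp add: group_hom_def group_hom_axioms_def iso_def)
  have kh: "k (h x) = x" if "x \<in> carrier G" for x
    using that bij by (simp add: k_def bij_betw_def)
  have hk: "h (k x) = x" if "x \<in> carrier H" for x
    using that bij by (simp add: k_def bij_betw_def f_inv_into_f)
  obtain I and \<phi> :: "nat \<Rightarrow> 'a \<Rightarrow> rat" and g where I: "finite I" "card I = r"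
      "\<And>i. i \<in> I \<Longrightarrow> g i \<in> carrier G" "\<And>i. i \<in> I \<Longrightarrow> rat_functional G (\<phi> i)"
      "\<And>i j. i \<in> I \<Longrightarrow> j \<in> I \<Longrightarrow> \<phi> i (g j) = (if i = j then 1 else 0)"
      "\<And>x. x \<in> carrier G \<Longrightarrow> (\<forall>i\<in>I. \<phi> i x = 0) \<Longrightarrow> torsion_elt G x"
    using assms(4) unfolding has_rank_def by blast
  have tors: "torsion_elt H x" if "x \<in> carrier H" "torsion_elt G (k x)" for x
    using that hk unfolding torsion_elt_def
    by (metis h.hom_one h.hom_int_pow k.hom_closed)
  show ?thesis
    unfolding has_rank_def
    apply (rule exI[of _ I], rule exI[of _ "\<lambda>i x. \<phi> i (k x)"], rule exI[of _ "\<lambda>i. h (g i)"])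
    using I tors by (auto simp: rat_functional_def kh)
qed

lemma has_rank_is_iso:
  assumes "G \<cong> H" "group G" "group H" "has_rank G r"
  shows "has_rank H r"
  using assms has_rank_iso unfolding is_iso_def by blast

text \<open>A functional on the integers is determined by its value at 1, so any two are
  proportional and cannot both belong to a dual family.\<close>

lemma has_rank_integer_group: 
  assumes "has_rank integer_group r"
  shows "r = 1"
proof -
  interpret group integer_group by simp
  obtain I and \<phi> :: "nat \<Rightarrow> int \<Rightarrow> rat" and g where I: "finite I" "card I = r"
      "\<And>i. i \<in> I \<Longrightarrow> rat_functional integer_group (\<phi> i)"
      "\<And>i j. i \<in> I \<Longrightarrow> j \<in> I \<Longrightarrow> \<phi> i (g j) = (if i = j then 1 else 0)"
      "\<And>x. x \<in> carrier integer_group \<Longrightarrow> (\<forall>i\<in>I. \<phi> i x = 0) \<Longrightarrow> torsion_elt integer_group x"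
    using assms unfolding has_rank_def by blast
  have lin: "\<phi> i n = of_int n * \<phi> i 1" if "i \<in> I" for i n
    using rat_functional_int_pow[OF I(3)[OF that], of 1 n] by simp
  have "\<not> torsion_elt integer_group 1" by (simp add: torsion_elt_def)
  then have "I \<noteq> {}" using I(5)[of 1] by auto
  then obtain i where i: "i \<in> I" by auto
  have "I = {i}"
  proof (rule ccontr)
    assume "I \<noteq> {i}"
    then obtain j where j: "j \<in> I" "j \<noteq> i" using i by blast
    have "of_int (g i) * \<phi> i 1 = 1" "of_int (g i) * \<phi> j 1 = 0" "of_int (g j) * \<phi> j 1 = 1"
      using lin I(4) i j by metis+
    then show False by auto
  qed
  then show ?thesis using I by auto
qed

text \<open>The element \<open>z\<close> need not generate \<open>B\<close> modulo the image of
  \<open>A\<close>. Still, \<open>p x\<close> lies in the kernel of \<open>\<beta>\<close>, and on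
  that kernel \<open>p\<close> is the power map with exponent \<open>\<beta> z\<close>; so
  \<open>p\<close> is a projection after division by \<open>\<beta> z\<close>. This extends the
  functionals of \<open>A\<close> to \<open>B\<close>, and \<open>\<beta>\<close> with
  \<open>z\<close> gives one more dual pair.\<close>

lemma has_rank_extension:
  assumes "comm_group A" "comm_group B" "\<iota> \<in> hom A B" "inj_on \<iota> (carrier A)"
    and \<beta>: "\<And>x y. x \<in> carrier B \<Longrightarrow> y \<in> carrier B \<Longrightarrow> \<beta> (x \<otimes>\<^bsub>B\<^esub> y) = (\<beta> x + \<beta> y :: int)"
    and ker: "\<And>x. x \<in> carrier B \<Longrightarrow> \<beta> x = 0 \<longleftrightarrow> x \<in> \<iota> ` carrier A"
    and z: "z \<in> carrier B" "\<beta> z \<noteq> 0"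
    and r: "has_rank A r"
  shows "has_rank B (Suc r)"
proof -
  interpret A: comm_group A by fact
  interpret B: comm_group B by fact
  interpret i: group_hom A B \<iota>
    using assms by (simp add: group_hom_def group_hom_axioms_def A.group_axioms B.group_axioms)
  obtain I and \<phi> :: "nat \<Rightarrow> 'a \<Rightarrow> rat" and g where I: "finite I" "card I = r"
      "\<And>i. i \<in> I \<Longrightarrow> g i \<in> carrier A" "\<And>i. i \<in> I \<Longrightarrow> rat_functional A (\<phi> i)"
      "\<And>i j. i \<in> I \<Longrightarrow> j \<in> I \<Longrightarrow> \<phi> i (g j) = (if i = j then 1 else 0)"
      "\<And>x. x \<in> carrier A \<Longrightarrow> (\<forall>i\<in>I. \<phi> i x = 0) \<Longrightarrow> torsion_elt A x"
    using r unfolding has_rank_def by blast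
  obtain k where k: "k \<notin> I" using I(1) ex_new_if_finite infinite_UNIV_nat by blast
  have rf: "rat_functional B (\<lambda>x. of_int (\<beta> x))"
    using \<beta> by (simp add: rat_functional_def)
  have bpow: "\<beta> (x [^]\<^bsub>B\<^esub> (n::int)) = n * \<beta> x" if "x \<in> carrier B" for x n
    using B.rat_functional_int_pow[OF rf that, of n]
    by (metis of_int_eq_iff of_int_mult)
  define p where "p x = x [^]\<^bsub>B\<^esub> \<beta> z \<otimes>\<^bsub>B\<^esub> z [^]\<^bsub>B\<^esub> (- \<beta> x)" for x
  define q where "q x = inv_into (carrier A) \<iota> (p x)" for x
  have pc: "p x \<in> carrier B" if "x \<in> carrier B" for x using that z by (simp add: p_def)
  have p0: "\<beta> (p x) = 0" if "x \<in> carrier B" for x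
    using that z by (simp add: p_def \<beta> bpow mult.commute del: B.int_pow_neg)
  have q: "q x \<in> carrier A" "\<iota> (q x) = p x" if "x \<in> carrier B" for x
    using p0[OF that] ker[OF pc[OF that]] unfolding q_def
    by (auto simp: inv_into_into f_inv_into_f)
  have pm: "p (x \<otimes>\<^bsub>B\<^esub> y) = p x \<otimes>\<^bsub>B\<^esub> p y" if "x \<in> carrier B" "y \<in> carrier B" for x y
    using that z unfolding p_def
    by (simp add: \<beta> B.int_pow_distrib B.int_pow_mult B.m_ac add.commute del: B.int_pow_neg)
      (simp add: B.m_ac flip: B.int_pow_mult del: B.int_pow_neg)
  have qm: "q (x \<otimes>\<^bsub>B\<^esub> y) = q x \<otimes>\<^bsub>A\<^esub> q y" if "x \<in> carrier B" "y \<in> carrier B" for x y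
  proof -
    have "\<iota> (q (x \<otimes>\<^bsub>B\<^esub> y)) = \<iota> (q x \<otimes>\<^bsub>A\<^esub> q y)"
      using that q pm by simp
    then show ?thesis using inj_onD[OF assms(4)] q(1) that by simp
  qed
  have qi: "q (\<iota> a) = a [^]\<^bsub>A\<^esub> \<beta> z" if "a \<in> carrier A" for a
  proof -
    have "\<beta> (\<iota> a) = 0" using ker[of "\<iota> a"] that by auto
    then have "\<iota> (q (\<iota> a)) = \<iota> (a [^]\<^bsub>A\<^esub> \<beta> z)"
      using q(2)[of "\<iota> a"] that by (simp add: p_def i.hom_int_pow)
    then show ?thesis using inj_onD[OF assms(4)] q(1)[of "\<iota> a"] that by simp
  qed
  have qz: "q z = \<one>\<^bsub>A\<^esub>"
  proof -
    have "p z = \<one>\<^bsub>B\<^esub>" using z by (simp add: p_def flip: B.int_pow_mult del: B.int_pow_neg)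
    then have "\<iota> (q z) = \<iota> \<one>\<^bsub>A\<^esub>" using q z by simp
    then show ?thesis using inj_onD[OF assms(4)] q(1)[OF z(1)] by simp
  qed
  define \<psi> where "\<psi> i x = (if i = k then of_int (\<beta> x) / of_int (\<beta> z) else \<phi> i (q x) / of_int (\<beta> z))" for i x
  define g' where "g' i = (if i = k then z else \<iota> (g i))" for i
  have bg: "\<beta> (\<iota> (g i)) = 0" if "i \<in> I" for i using ker[of "\<iota> (g i)"] I(3)[OF that] by auto
  have tors: "torsion_elt B x" if x: "x \<in> carrier B" and *: "\<forall>i\<in>insert k I. \<psi> i x = 0" for x
  proof -
    have "\<beta> x = 0" using * z by (simp add: \<psi>_def)
    then obtain a where a: "a \<in> carrier A" "x = \<iota> a" using ker x by auto
    have "\<phi> i (q x) = 0" if "i \<in> I" for i using * that k z by (auto simp: \<psi>_def split: if_splits)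
    then have "torsion_elt A (a [^]\<^bsub>A\<^esub> \<beta> z)" using I(6)[of "q x"] q x qi a by auto
    then have "torsion_elt A a" using A.torsion_root a z by blast
    then show ?thesis unfolding a torsion_elt_def using i.hom_int_pow[OF a(1)] i.hom_one by metis
  qed
  show ?thesis
    unfolding has_rank_def
  proof (intro exI conjI)
    show "finite (insert k I)" "card (insert k I) = Suc r" using I k by auto
    show "\<forall>i\<in>insert k I. g' i \<in> carrier B \<and> rat_functional B (\<psi> i)"
      using I(3,4) z k by (auto simp: g'_def \<psi>_def rat_functional_def \<beta> qm q add_divide_distrib)
    show "\<forall>i\<in>insert k I. \<forall>j\<in>insert k I. \<psi> i (g' j) = (if i = j then 1 else 0)"
    proof (intro ballI)
      fix i j assume ij: "i \<in> insert k I" "j \<in> insert k I"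
      have "\<phi> i (a [^]\<^bsub>A\<^esub> \<beta> z) = of_int (\<beta> z) * \<phi> i a" if "i \<in> I" "a \<in> carrier A" for i a
        using A.rat_functional_int_pow I(4) that by blast
      moreover have "\<phi> i \<one>\<^bsub>A\<^esub> = 0" if "i \<in> I" for i using A.rat_functional_one I(4) that by blast
      ultimately show "\<psi> i (g' j) = (if i = j then 1 else 0)"
        using ij k z bg I(3,5) by (auto simp: \<psi>_def g'_def qi qz)
    qed
    show "\<forall>x\<in>carrier B. (\<forall>i\<in>insert k I. \<psi> i x = 0) \<longrightarrow> torsion_elt B x" using tors by blast
  qed
qed

text \<open>If \<open>c\<close> is torsion, all functionals kill it and descend to \<open>D\<close>.
  Otherwise one functional that does not kill \<open>c\<close> is sacrificed, and multiples of it
  are subtracted from the others to make them kill \<open>c\<close>.\<close>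

lemma has_rank_cyclic_quotient:
  assumes "comm_group C" "comm_group D" "\<pi> \<in> hom C D" "\<pi> ` carrier C = carrier D"
    and c: "c \<in> carrier C"
    and ker: "\<And>x. x \<in> carrier C \<Longrightarrow> \<pi> x = \<one>\<^bsub>D\<^esub> \<longleftrightarrow> (\<exists>n::int. x = c [^]\<^bsub>C\<^esub> n)"
    and r: "has_rank C r"
  shows "if torsion_elt C c then has_rank D r else r > 0 \<and> has_rank D (r - 1)"
proof -
  interpret C: comm_group C by fact
  interpret D: comm_group D by fact
  interpret p: group_hom C D \<pi>
    using assms by (simp add: group_hom_def group_hom_axioms_def C.group_axioms D.group_axioms)
  obtain I and \<phi> :: "nat \<Rightarrow> 'a \<Rightarrow> rat" and g where I: "finite I" "card I = r"
      "\<And>i. i \<in> I \<Longrightarrow> g i \<in> carrier C" "\<And>i. i \<in> I \<Longrightarrow> rat_functional C (\<phi> i)"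
      "\<And>i j. i \<in> I \<Longrightarrow> j \<in> I \<Longrightarrow> \<phi> i (g j) = (if i = j then 1 else 0)"
      "\<And>x. x \<in> carrier C \<Longrightarrow> (\<forall>i\<in>I. \<phi> i x = 0) \<Longrightarrow> torsion_elt C x"
    using r unfolding has_rank_def by blast
  define s where "s = inv_into (carrier C) \<pi>"
  have s: "s y \<in> carrier C" "\<pi> (s y) = y" if "y \<in> carrier D" for y
    using that assms(4) unfolding s_def by (auto simp: inv_into_into f_inv_into_f)
  have tD: "torsion_elt D (\<pi> x)" if "x \<in> carrier C" "torsion_elt C x" for x
    using that unfolding torsion_elt_def using p.hom_int_pow p.hom_one by metis
  \<comment> \<open>A functional that kills \<open>c\<close> is constant on the fibres of
    \<open>\<pi>\<close>, so its composition with the arbitrary section \<open>s\<close> is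
    additive.\<close>
  have main: "has_rank D (card J)"
    if J: "J \<subseteq> I" and \<psi>: "\<And>i. i \<in> J \<Longrightarrow> rat_functional C (\<psi> i)" "\<And>i. i \<in> J \<Longrightarrow> \<psi> i c = 0"
      and d: "\<And>i j. i \<in> J \<Longrightarrow> j \<in> J \<Longrightarrow> \<psi> i (g j) = (if i = j then 1 else 0)"
      and t: "\<And>x. x \<in> carrier C \<Longrightarrow> (\<forall>i\<in>J. \<psi> i x = 0) \<Longrightarrow> torsion_elt D (\<pi> x)" for J \<psi>
  proof -
    have fac: "\<psi> i x = \<psi> i y" if "i \<in> J" "x \<in> carrier C" "y \<in> carrier C" "\<pi> x = \<pi> y" for i x y
    proof -
      have "\<pi> (x \<otimes>\<^bsub>C\<^esub> inv\<^bsub>C\<^esub> y) = \<one>\<^bsub>D\<^esub>" using that by simp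
      moreover have "x \<otimes>\<^bsub>C\<^esub> inv\<^bsub>C\<^esub> y \<in> carrier C" using that by simp
      ultimately obtain n :: int where n: "x \<otimes>\<^bsub>C\<^esub> inv\<^bsub>C\<^esub> y = c [^]\<^bsub>C\<^esub> n" using ker by blast
      have "\<psi> i (c [^]\<^bsub>C\<^esub> n) = 0"
        using C.rat_functional_int_pow[OF \<psi>(1) c] \<psi>(2) that(1) by simp
      moreover have "\<psi> i (x \<otimes>\<^bsub>C\<^esub> inv\<^bsub>C\<^esub> y) = \<psi> i x - \<psi> i y"
        using \<psi>(1)[OF that(1)] that C.rat_functional_inv[OF \<psi>(1)[OF that(1)]]
        by (auto simp: rat_functional_def)
      ultimately show ?thesis using n by simp
    qed
    have fs: "\<psi> i (s (\<pi> x)) = \<psi> i x" if "i \<in> J" "x \<in> carrier C" for i x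
      using that by (intro fac) (auto simp: s)
    show ?thesis
      unfolding has_rank_def
    proof (intro exI conjI)
      show "finite J" using J I finite_subset by blast
      show "card J = card J" ..
      show "\<forall>i\<in>J. \<pi> (g i) \<in> carrier D \<and> rat_functional D (\<lambda>y. \<psi> i (s y))"
      proof (intro ballI conjI)
        fix i assume i: "i \<in> J"
        show "\<pi> (g i) \<in> carrier D" using I(3)[of i] J i by auto
        have "\<psi> i (s (x \<otimes>\<^bsub>D\<^esub> y)) = \<psi> i (s x \<otimes>\<^bsub>C\<^esub> s y)" if "x \<in> carrier D" "y \<in> carrier D" for x y
          using that i by (intro fac) (auto simp: s)
        then show "rat_functional D (\<lambda>y. \<psi> i (s y))"
          using \<psi>(1)[OF i] s by (auto simp: rat_functional_def)
      qed
      show "\<forall>i\<in>J. \<forall>j\<in>J. \<psi> i (s (\<pi> (g j))) = (if i = j then 1 else 0)"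
      proof (intro ballI)
        fix i j assume "i \<in> J" "j \<in> J"
        then show "\<psi> i (s (\<pi> (g j))) = (if i = j then 1 else 0)"
          using fs[of i "g j"] d[of i j] I(3)[of j] J by auto
      qed
      show "\<forall>x\<in>carrier D. (\<forall>i\<in>J. \<psi> i (s x) = 0) \<longrightarrow> torsion_elt D x"
      proof (intro ballI impI)
        fix x assume "x \<in> carrier D" "\<forall>i\<in>J. \<psi> i (s x) = 0"
        then show "torsion_elt D x" using t[of "s x"] s[of x] by auto
      qed
    qed
  qed
  show ?thesis
  proof (cases "torsion_elt C c")
    case True
    have "has_rank D (card I)"
      by (rule main[of I \<phi>]) (use I True C.rat_functional_torsion c tD in auto)
    then show ?thesis using True I by simp
  next
    case False
    then obtain k where k: "k \<in> I" "\<phi> k c \<noteq> 0" using I(6) c by blast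
    define \<psi> where "\<psi> i x = \<phi> i x - (\<phi> i c / \<phi> k c) * \<phi> k x" for i x
    have "has_rank D (card (I - {k}))"
    proof (rule main[of _ \<psi>])
      show "rat_functional C (\<psi> i)" if "i \<in> I - {k}" for i
        using I(4)[OF k(1)] I(4)[of i] that by (auto simp: rat_functional_def \<psi>_def algebra_simps add_divide_distrib)
      show "\<psi> i c = 0" if "i \<in> I - {k}" for i using k by (simp add: \<psi>_def)
      show "\<psi> i (g j) = (if i = j then 1 else 0)" if "i \<in> I - {k}" "j \<in> I - {k}" for i j
        using that k I(5) by (auto simp: \<psi>_def)
      fix x assume x: "x \<in> carrier C" and *: "\<forall>i\<in>I - {k}. \<psi> i x = 0"
      \<comment> \<open>Clearing the denominator of this ratio gives integers for which the
        \<open>n\<close>-th power of \<open>x\<close> divided by the \<open>m\<close>-th power of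
        \<open>c\<close> is in the common kernel, hence torsion.\<close>
      obtain m n where mn: "quotient_of (\<phi> k x / \<phi> k c) = (m, n)" by fastforce
      then have n: "n > 0" "\<phi> k x / \<phi> k c = of_int m / of_int n"
        using quotient_of_denom_pos quotient_of_div by blast+
      have rel: "of_int n * \<phi> i x = of_int m * \<phi> i c" if "i \<in> I" for i
      proof -
        have "\<phi> i x = \<phi> i c * (\<phi> k x / \<phi> k c)"
        proof (cases "i = k")
          case False
          then have "\<psi> i x = 0" using * that by blast
          then show ?thesis by (simp add: \<psi>_def)
        qed (use k in simp)
        also have "\<dots> = \<phi> i c * (of_int m / of_int n)" using n by simp
        finally show ?thesis using n by (simp add: field_simps)
      qed
      define y where "y = x [^]\<^bsub>C\<^esub> n \<otimes>\<^bsub>C\<^esub> c [^]\<^bsub>C\<^esub> (- m)"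
      have y: "y \<in> carrier C" using x c by (simp add: y_def)
      have "\<phi> i y = 0" if "i \<in> I" for i
      proof -
        have "\<phi> i y = \<phi> i (x [^]\<^bsub>C\<^esub> n) + \<phi> i (c [^]\<^bsub>C\<^esub> (- m))"
          unfolding y_def using I(4)[OF that] x c by (simp add: rat_functional_def del: C.int_pow_neg)
        also have "\<dots> = of_int n * \<phi> i x + of_int (- m) * \<phi> i c"
          using C.rat_functional_int_pow[OF I(4)[OF that]] x c by metis
        finally show ?thesis using rel[OF that] by simp
      qed
      then have "torsion_elt D (\<pi> y)" using I(6) tD y by blast
      moreover have "\<pi> (c [^]\<^bsub>C\<^esub> (- m)) = \<one>\<^bsub>D\<^esub>" using ker[of "c [^]\<^bsub>C\<^esub> (- m)"] c by auto
      then have "\<pi> y = \<pi> x [^]\<^bsub>D\<^esub> n"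
        unfolding y_def using x c by (simp add: p.hom_int_pow del: C.int_pow_neg)
      ultimately show "torsion_elt D (\<pi> x)"
        using D.torsion_root[of "\<pi> x" n] n x by auto
    qed auto
    then show ?thesis using False k I by (auto simp: card_gt_0_iff)
  qed
qed

text \<open>Let \<open>e\<close> be the image in \<open>C\<close> of a generator of
  \<open>Z\<close>. If \<open>e\<close> is torsion, \<open>\<delta>\<close> has a nontrivial kernel,
  so \<open>B\<close> gains one over \<open>A\<close> while \<open>D\<close> keeps the rank of
  \<open>C\<close>. Otherwise \<open>\<beta>\<close> is trivial, \<open>B\<close> is isomorphic to
  \<open>A\<close>, and \<open>D\<close> loses one.\<close>

lemma has_rank_five_term:
  assumes "comm_group A" "comm_group B" "comm_group C" "comm_group D" "group Z"
    and hom: "\<iota> \<in> hom A B" "\<beta> \<in> hom B Z" "\<delta> \<in> hom Z C" "\<pi> \<in> hom C D"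
    and inj: "inj_on \<iota> (carrier A)" and surj: "\<pi> ` carrier C = carrier D"
    and ex: "\<iota> ` carrier A = kernel B Z \<beta>" "\<beta> ` carrier B = kernel Z C \<delta>" "\<delta> ` carrier Z = kernel C D \<pi>"
    and Z: "Z \<cong> integer_group"
    and r: "has_rank A a" "has_rank C c"
  shows "\<exists>a' c'. has_rank B a' \<and> has_rank D c' \<and> int a' - int c' = int a - int c + 1"
proof -
  interpret A: comm_group A by fact
  interpret B: comm_group B by fact
  interpret C: comm_group C by fact
  interpret D: comm_group D by fact
  interpret Z: group Z by fact
  interpret \<iota>: group_hom A B \<iota> using hom by unfold_locales
  interpret \<beta>: group_hom B Z \<beta> using hom by unfold_locales
  interpret \<delta>: group_hom Z C \<delta> using hom by unfold_locales
  interpret \<pi>: group_hom C D \<pi> using hom by unfold_locales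
  obtain h where h: "h \<in> iso Z integer_group" using Z unfolding is_iso_def by auto
  then interpret h: group_hom Z integer_group h by (simp add: group_hom_def group_hom_axioms_def iso_def)
  have bij: "bij_betw h (carrier Z) UNIV" using h by (simp add: iso_def)
  obtain u where u: "u \<in> carrier Z" "h u = 1" using bij by (metis UNIV_I bij_betw_iff_bijections)
  have hu: "h (u [^]\<^bsub>Z\<^esub> n) = n" for n :: int using u h.hom_int_pow by simp
  have zu: "x = u [^]\<^bsub>Z\<^esub> h x" if "x \<in> carrier Z" for x
    using bij hu[of "h x"] that u by (metis Z.int_pow_closed bij_betw_def inj_onD)
  have h0: "h x = 0 \<longleftrightarrow> x = \<one>\<^bsub>Z\<^esub>" if "x \<in> carrier Z" for x
    using zu[OF that] h.hom_one by auto
  define e where "e = \<delta> u"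
  have e: "e \<in> carrier C" using u by (simp add: e_def)
  have kerp: "\<pi> x = \<one>\<^bsub>D\<^esub> \<longleftrightarrow> (\<exists>n::int. x = e [^]\<^bsub>C\<^esub> n)" if "x \<in> carrier C" for x
  proof -
    have "\<pi> x = \<one>\<^bsub>D\<^esub> \<longleftrightarrow> x \<in> \<delta> ` carrier Z" using ex(3) that by (auto simp: kernel_def)
    also have "\<dots> \<longleftrightarrow> (\<exists>n::int. x = e [^]\<^bsub>C\<^esub> n)"
    proof
      assume "x \<in> \<delta> ` carrier Z"
      then obtain z where "z \<in> carrier Z" "x = \<delta> z" by auto
      then have "x = e [^]\<^bsub>C\<^esub> h z" using zu[of z] \<delta>.hom_int_pow[OF u(1), of "h z"] by (simp add: e_def)
      then show "\<exists>n::int. x = e [^]\<^bsub>C\<^esub> n" ..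
    next
      assume "\<exists>n::int. x = e [^]\<^bsub>C\<^esub> n"
      then obtain n :: int where "x = \<delta> (u [^]\<^bsub>Z\<^esub> n)" using \<delta>.hom_int_pow[OF u(1)] by (auto simp: e_def)
      then show "x \<in> \<delta> ` carrier Z" using u by blast
    qed
    finally show ?thesis .
  qed
  note quot = has_rank_cyclic_quotient[OF C.comm_group_axioms D.comm_group_axioms hom(4) surj e kerp r(2)]
  define b where "b x = h (\<beta> x)" for x
  have b: "b (x \<otimes>\<^bsub>B\<^esub> y) = b x + b y" if "x \<in> carrier B" "y \<in> carrier B" for x y
    using that by (simp add: b_def)
  have bker: "b x = 0 \<longleftrightarrow> x \<in> \<iota> ` carrier A" if "x \<in> carrier B" for x
    using that h0[of "\<beta> x"] ex(1) by (auto simp: b_def kernel_def)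
  show ?thesis
  proof (cases "torsion_elt C e")
    case True
    then obtain n :: int where n: "n \<noteq> 0" "e [^]\<^bsub>C\<^esub> n = \<one>\<^bsub>C\<^esub>" unfolding torsion_elt_def by auto
    then have "u [^]\<^bsub>Z\<^esub> n \<in> kernel Z C \<delta>" using u \<delta>.hom_int_pow[OF u(1)] by (simp add: kernel_def e_def)
    then have "u [^]\<^bsub>Z\<^esub> n \<in> \<beta> ` carrier B" using ex(2) by simp
    then obtain z where z: "z \<in> carrier B" "\<beta> z = u [^]\<^bsub>Z\<^esub> n" by (metis imageE)
    then have "b z \<noteq> 0" using hu n by (simp add: b_def)
    then have "has_rank B (Suc a)"
      using has_rank_extension[OF A.comm_group_axioms B.comm_group_axioms hom(1) inj b bker z(1) _ r(1)] by blast
    moreover have "has_rank D c" using quot True by simp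
    ultimately show ?thesis by (intro exI[of _ "Suc a"] exI[of _ c]) auto
  next
    case False
    have b0: "b x = 0" if "x \<in> carrier B" for x
    proof (rule ccontr)
      assume "b x \<noteq> 0"
      have "\<beta> x \<in> kernel Z C \<delta>" using ex(2) that by blast
      then have "\<delta> (u [^]\<^bsub>Z\<^esub> b x) = \<one>\<^bsub>C\<^esub>" using zu[of "\<beta> x"] that by (auto simp: b_def kernel_def)
      then have "e [^]\<^bsub>C\<^esub> b x = \<one>\<^bsub>C\<^esub>" using \<delta>.hom_int_pow[OF u(1)] by (simp add: e_def)
      then show False using False \<open>b x \<noteq> 0\<close> unfolding torsion_elt_def by blast
    qed
    have "\<iota> ` carrier A = carrier B"
    proof
      show "carrier B \<subseteq> \<iota> ` carrier A" using b0 bker by (intro subsetI) blast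
    qed auto
    then have "\<iota> \<in> iso A B" using inj hom by (auto simp: iso_def bij_betw_def)
    then have "has_rank B a" using has_rank_iso r A.group_axioms B.group_axioms by blast
    moreover have "c > 0" "has_rank D (c - 1)" using quot False by auto
    ultimately show ?thesis by (intro exI[of _ a] exI[of _ "c - 1"]) auto
  qed
qed

section \<open>Excision for subcomplexes\<close>

text \<open>In contrast to \<open>complex_on_vertices\<close>, elements of the type may fail to be
  vertices, as happens for subcomplexes.\<close>

definition cplx :: "'n set set \<Rightarrow> bool" where
  "cplx K \<longleftrightarrow> {} \<in> K \<and> (\<forall>\<sigma>\<in>K. \<forall>\<tau>. \<tau> \<subseteq> \<sigma> \<longrightarrow> \<tau> \<in> K)"

lemma cplxD: "cplx K \<Longrightarrow> {} \<in> K" "cplx K \<Longrightarrow> \<sigma> \<in> K \<Longrightarrow> \<tau> \<subseteq> \<sigma> \<Longrightarrow> \<tau> \<in> K"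
  by (auto simp: cplx_def)

lemma cplx_Int: "cplx K \<Longrightarrow> cplx L \<Longrightarrow> cplx (K \<inter> L)"
  and cplx_Un: "cplx K \<Longrightarrow> cplx L \<Longrightarrow> cplx (K \<union> L)"
  by (auto simp: cplx_def)

text \<open>Barycentric coordinates reduce unions and intersections of realizations to statements
  about supports.\<close>

lemma realization_iff:
  fixes K :: "'n::finite set set"
  assumes "cplx K"
  shows "x \<in> realization K \<longleftrightarrow> (\<forall>i. 0 \<le> x $ i) \<and> (\<Sum>i\<in>UNIV. x $ i) = 1 \<and> {i. x $ i \<noteq> 0} \<in> K"
proof
  assume "x \<in> realization K"
  then obtain \<sigma> where \<sigma>: "\<sigma> \<in> K" "x \<in> convex hull ((\<lambda>v. axis v 1) ` \<sigma>)"
    unfolding realization_def by auto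
  define C where "C = {y :: real^'n. (\<forall>i. 0 \<le> y $ i) \<and> (\<Sum>i\<in>UNIV. y $ i) = 1 \<and> (\<forall>i. i \<notin> \<sigma> \<longrightarrow> y $ i = 0)}"
  have "convex C"
    unfolding convex_def C_def by (auto simp: sum.distrib simp flip: sum_distrib_left)
  moreover have "(\<lambda>v. axis v 1) ` \<sigma> \<subseteq> C"
    by (auto simp: C_def axis_def)
  ultimately have "x \<in> C" using \<sigma>(2) hull_minimal by blast
  then show "(\<forall>i. 0 \<le> x $ i) \<and> (\<Sum>i\<in>UNIV. x $ i) = 1 \<and> {i. x $ i \<noteq> 0} \<in> K"
    using cplxD(2)[OF assms \<sigma>(1), of "{i. x $ i \<noteq> 0}"] by (auto simp: C_def)
next
  assume R: "(\<forall>i. 0 \<le> x $ i) \<and> (\<Sum>i\<in>UNIV. x $ i) = 1 \<and> {i. x $ i \<noteq> 0} \<in> K"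
  let ?\<sigma> = "{i. x $ i \<noteq> 0}"
  have "(\<Sum>i\<in>UNIV. x $ i) = (\<Sum>i\<in>?\<sigma>. x $ i)"
    by (rule sum.mono_neutral_right) auto
  then have "(\<Sum>i\<in>?\<sigma>. x $ i *\<^sub>R axis i 1) \<in> convex hull ((\<lambda>v. axis v (1::real)) ` ?\<sigma>)"
    using R by (intro convex_sum) (auto intro: hull_inc)
  moreover have "(\<Sum>i\<in>?\<sigma>. x $ i *\<^sub>R axis i 1) = x"
    by (simp add: vec_eq_iff axis_def if_distrib[where f="\<lambda>u. _ * u"] cong: if_cong)
  ultimately show "x \<in> realization K"
    unfolding realization_def using R by auto
qed

lemma realization_Int: "cplx K \<Longrightarrow> cplx L \<Longrightarrow> realization (K \<inter> L) = realization K \<inter> realization L"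
  by (auto simp: realization_iff cplx_Int)

lemma realization_Un: "cplx K \<Longrightarrow> cplx L \<Longrightarrow> realization (K \<union> L) = realization K \<union> realization L"
  by (auto simp: realization_iff cplx_Un)

lemma realization_mono: "K \<subseteq> L \<Longrightarrow> realization K \<subseteq> realization L"
  by (auto simp: realization_def)

lemma closed_realization: "closed (realization (K :: 'n::finite set set))"
  unfolding realization_def
  by (intro closed_UN finite) (simp add: finite_imp_compact_convex_hull compact_imp_closed)

section \<open>Retractions along segments\<close>

lemma closed_segmentE:
  fixes x y :: "'a::real_vector"
  assumes "z \<in> closed_segment x y"
  obtains s where "0 \<le> s" "s \<le> 1" "z = (1 - s) *\<^sub>R x + s *\<^sub>R y"
  using assms unfolding closed_segment_def by blast

lemma homotopic_straight_retraction:
  fixes r :: "'a::real_normed_vector \<Rightarrow> 'a"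
  assumes "continuous_on V r" "\<And>x. x \<in> V \<Longrightarrow> closed_segment (r x) x \<subseteq> V"
  shows "homotopic_with_canon (\<lambda>z. True) V V r id"
  by (rule homotopic_with_linear) (use assms in auto)

lemma trivial_relative_homology_straight_retraction:
  fixes r :: "'a::real_normed_vector \<Rightarrow> 'a"
  assumes r: "continuous_on V r" "r ` V \<subseteq> S" "\<And>x. x \<in> V \<Longrightarrow> closed_segment (r x) x \<subseteq> V"
    and S: "S \<subseteq> V" "\<And>x. x \<in> S \<Longrightarrow> r x = x"
  shows "trivial_group (relative_homology_group p (top_of_set V) S)"
proof (rule trivial_relative_homology_group_gen[where f = r])
  have eq: "subtopology (top_of_set V) S = top_of_set S"
    using S by (simp add: subtopology_subtopology Int_absorb1)
  show "continuous_map (top_of_set V) (subtopology (top_of_set V) S) r"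
    using r by (auto simp: eq)
  show "homotopic_with (\<lambda>h. True) (subtopology (top_of_set V) S) (subtopology (top_of_set V) S) r id"
    unfolding eq
    by (rule homotopic_straight_retraction) (use r S continuous_on_subset in auto)
  show "homotopic_with (\<lambda>k. True) (top_of_set V) (top_of_set V) r id"
    by (rule homotopic_straight_retraction) (use r in auto)
qed

lemma homotopy_equivalent_straight_retraction:
  fixes r :: "'a::real_normed_vector \<Rightarrow> 'a"
  assumes r: "continuous_on V r" "r ` V \<subseteq> S" "\<And>x. x \<in> V \<Longrightarrow> closed_segment (r x) x \<subseteq> V"
    and S: "S \<subseteq> V" "\<And>x. x \<in> S \<Longrightarrow> r x = x"
  shows "top_of_set V homotopy_equivalent_space top_of_set S"
  unfolding homotopy_equivalent_space_def
proof (intro exI conjI)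
  show "continuous_map (top_of_set V) (top_of_set S) r" using r by auto
  show "continuous_map (top_of_set S) (top_of_set V) id" using S by auto
  show "homotopic_with (\<lambda>h. True) (top_of_set V) (top_of_set V) (id \<circ> r) id"
    using homotopic_straight_retraction[OF r(1,3)] by simp
  show "homotopic_with (\<lambda>k. True) (top_of_set S) (top_of_set S) (r \<circ> id) id"
    by (rule homotopic_straight_retraction) (use r S continuous_on_subset in auto)
qed

lemma continuous_on_Max_finite:
  fixes f :: "'j \<Rightarrow> 'a::topological_space \<Rightarrow> real"
  assumes "finite J" "J \<noteq> {}" "\<And>j. j \<in> J \<Longrightarrow> continuous_on S (f j)"
  shows "continuous_on S (\<lambda>x. Max ((\<lambda>j. f j x) ` J))"
  using assms by (induction J rule: finite_ne_induct) (auto intro!: continuous_on_max)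

lemma continuous_on_Min_finite:
  fixes f :: "'j \<Rightarrow> 'a::topological_space \<Rightarrow> real"
  assumes "finite J" "J \<noteq> {}" "\<And>j. j \<in> J \<Longrightarrow> continuous_on S (f j)"
  shows "continuous_on S (\<lambda>x. Min ((\<lambda>j. f j x) ` J))"
  using assms by (induction J rule: finite_ne_induct) (auto intro!: continuous_on_min)

text \<open>
  For \<open>x\<close> in the simplex, \<open>level Y x\<close> is the least \<open>t \<ge> 0\<close> with \<open>{i. x\<^sub>i > t} \<in> Y\<close>.  Truncating
  the coordinates of \<open>x\<close> at this level and normalizing retracts the open neighbourhood \<open>nbhd Y\<close> onto
  \<open>|Y|\<close> along segments, inside every subcomplex that contains \<open>x\<close>.
\<close>

definition level :: "'n::finite set set \<Rightarrow> real ^ 'n \<Rightarrow> real" where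
  "level Y x = Max (insert 0 ((\<lambda>\<tau>. Min ((\<lambda>i. x $ i) ` \<tau>)) ` (- Y)))"

lemma continuous_on_level:
  assumes "cplx (Y :: 'n::finite set set)"
  shows "continuous_on S (level Y)"
proof -
  have "continuous_on S (\<lambda>x. Min ((\<lambda>i. x $ i) ` \<tau>))" if "\<tau> \<in> - Y" for \<tau>
    using that cplxD(1)[OF assms]
    by (intro continuous_on_Min_finite) (auto intro!: continuous_intros)
  then have c: "continuous_on S (\<lambda>x. Max ((\<lambda>\<tau>. Min ((\<lambda>i. x $ i) ` \<tau>)) ` (- Y)))" if "Y \<noteq> UNIV"
    using that by (intro continuous_on_Max_finite) auto
  have eq: "level Y = (\<lambda>x. max 0 (Max ((\<lambda>\<tau>. Min ((\<lambda>i. x $ i) ` \<tau>)) ` (- Y))))" if "Y \<noteq> UNIV"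
    using that unfolding level_def by (intro ext Max_insert) auto
  show ?thesis
  proof (cases "Y = UNIV")
    case True
    then have "level Y = (\<lambda>x. 0)" by (auto simp: level_def)
    then show ?thesis by simp
  next
    case False
    then show ?thesis unfolding eq[OF False] using c by (intro continuous_on_max continuous_on_const)
  qed
qed

lemma level_nonneg: "0 \<le> level (Y :: 'n::finite set set) x"
  unfolding level_def by (intro Max_ge) auto

lemma level_le_iff:
  assumes "cplx (Y :: 'n::finite set set)" "0 \<le> t"
  shows "level Y x \<le> t \<longleftrightarrow> {i. x $ i > t} \<in> Y"
proof
  assume *: "level Y x \<le> t"
  show "{i. x $ i > t} \<in> Y"
  proof (rule ccontr)
    let ?L = "{i. x $ i > t}"
    assume "?L \<notin> Y"
    then have "Min ((\<lambda>i. x $ i) ` ?L) \<le> level Y x"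
      unfolding level_def by (intro Max_ge) auto
    moreover have "?L \<noteq> {}" using \<open>?L \<notin> Y\<close> cplxD(1)[OF assms(1)] by metis
    then have "Min ((\<lambda>i. x $ i) ` ?L) > t" by (subst Min_gr_iff) auto
    ultimately show False using * by simp
  qed
next
  assume *: "{i. x $ i > t} \<in> Y"
  have "Min ((\<lambda>i. x $ i) ` \<tau>) \<le> t" if "\<tau> \<notin> Y" for \<tau>
  proof -
    have "\<not> \<tau> \<subseteq> {i. x $ i > t}" using cplxD(2)[OF assms(1) *] that by blast
    then obtain i where i: "i \<in> \<tau>" "\<not> x $ i > t" by blast
    then have "x $ i \<le> t" by simp
    with i show ?thesis by (meson Min_le finite finite_imageI imageI order_trans)
  qed
  then show "level Y x \<le> t" unfolding level_def using assms by (subst Max_le_iff) auto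
qed

definition excess :: "'n::finite set set \<Rightarrow> real ^ 'n \<Rightarrow> real" where
  "excess Y x = (\<Sum>i\<in>UNIV. max (x $ i - level Y x) 0)"

definition nbhd :: "'n::finite set set \<Rightarrow> (real ^ 'n) set" where
  "nbhd Y = {x. 0 < excess Y x}"

definition push :: "'n::finite set set \<Rightarrow> real ^ 'n \<Rightarrow> real ^ 'n" where
  "push Y x = (\<chi> i. max (x $ i - level Y x) 0 / excess Y x)"

lemma continuous_on_excess: "cplx Y \<Longrightarrow> continuous_on S (excess Y)"
  unfolding excess_def by (intro continuous_intros continuous_on_max continuous_on_level)

lemma open_nbhd: "cplx Y \<Longrightarrow> open (nbhd Y)"
  unfolding nbhd_def by (intro open_Collect_less continuous_on_const continuous_on_excess)

lemma nbhd_iff: "x \<in> nbhd Y \<longleftrightarrow> (\<exists>i. level Y x < x $ i)"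
proof -
  have "0 < excess Y x \<longleftrightarrow> excess Y x \<noteq> 0"
    unfolding excess_def by (simp add: less_le sum_nonneg)
  also have "\<dots> \<longleftrightarrow> \<not> (\<forall>i\<in>UNIV. max (x $ i - level Y x) 0 = 0)"
    unfolding excess_def by (subst sum_nonneg_eq_0_iff) auto
  finally show ?thesis by (auto simp: nbhd_def max_def not_le)
qed

lemma realization_subset_nbhd:
  fixes Y :: "'n::finite set set"
  assumes "cplx Y" "x \<in> realization Y"
  shows "level Y x = 0" "excess Y x = 1" "x \<in> nbhd Y" "push Y x = x"
proof -
  have x: "\<forall>i. 0 \<le> x $ i" "(\<Sum>i\<in>UNIV. x $ i) = 1" "{i. x $ i \<noteq> 0} \<in> Y"
    using assms by (auto simp: realization_iff)
  moreover have "{i. x $ i > 0} = {i. x $ i \<noteq> 0}" using x(1) by (auto simp: less_le)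
  ultimately have "{i. x $ i > 0} \<in> Y" by simp
  then show l: "level Y x = 0"
    using level_le_iff[OF assms(1), of 0 x] level_nonneg[of Y x] by simp
  have "max (x $ i) 0 = x $ i" for i using x by (simp add: max_absorb1)
  then show e: "excess Y x = 1" "push Y x = x" using x by (auto simp: excess_def push_def l vec_eq_iff)
  then show "x \<in> nbhd Y" by (simp add: nbhd_def)
qed

text \<open>At parameter \<open>s\<close>, the coordinates of \<open>y\<close> above
  \<open>s * level Y x\<close> are exactly those where \<open>x\<close> exceeds its level. So the
  level of \<open>y\<close> is at most that value, \<open>y\<close> still has a coordinate above it,
  and \<open>s = 0\<close> shows that \<open>push Y x\<close> has level 0.\<close>

lemma push_segment:
  fixes Y K :: "'n::finite set set"
  assumes "cplx Y" "cplx K" "x \<in> realization K" "x \<in> nbhd Y" "0 \<le> s" "s \<le> 1"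
  defines "y \<equiv> (1 - s) *\<^sub>R push Y x + s *\<^sub>R x"
  shows "y \<in> realization K" "y \<in> nbhd Y" "level Y y \<le> s * level Y x"
proof -
  let ?c = "level Y x" and ?N = "excess Y x"
  have x: "\<forall>i. 0 \<le> x $ i" "(\<Sum>i\<in>UNIV. x $ i) = 1" "{i. x $ i \<noteq> 0} \<in> K"
    using assms(2,3) by (auto simp: realization_iff)
  have N: "?N > 0" using assms(4) by (simp add: nbhd_def)
  have c: "?c \<ge> 0" by (rule level_nonneg)
  have yi: "y $ i = (1 - s) * (max (x $ i - ?c) 0 / ?N) + s * x $ i" for i
    by (simp add: y_def push_def)
  have "(\<Sum>i\<in>UNIV. y $ i) = (1 - s) * ((\<Sum>i\<in>UNIV. max (x $ i - ?c) 0) / ?N) + s * (\<Sum>i\<in>UNIV. x $ i)"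
    by (simp add: yi sum.distrib sum_distrib_left sum_divide_distrib)
  also have "(\<Sum>i\<in>UNIV. max (x $ i - ?c) 0) = ?N" by (simp add: excess_def)
  finally have "(\<Sum>i\<in>UNIV. y $ i) = 1" using N x by simp
  moreover have "\<forall>i. 0 \<le> y $ i" using x N assms(5,6) by (simp add: yi)
  moreover have "{i. y $ i \<noteq> 0} \<subseteq> {i. x $ i \<noteq> 0}" using c by (auto simp: yi max_def)
  then have "{i. y $ i \<noteq> 0} \<in> K" using x assms(2) cplxD(2) by blast
  ultimately show "y \<in> realization K" using assms(2) by (simp add: realization_iff)
  have gt: "y $ i > s * ?c" if "x $ i > ?c" for i
  proof (cases "s = 1")
    case False
    have "(1 - s) * (max (x $ i - ?c) 0 / ?N) > 0" using False assms that N by simp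
    moreover have "s * x $ i \<ge> s * ?c" using assms that by (simp add: mult_left_mono)
    ultimately show ?thesis by (simp add: yi)
  qed (use that yi in simp)
  have le: "y $ i \<le> s * ?c" if "x $ i \<le> ?c" for i
    using that assms(5) by (simp add: yi mult_left_mono)
  have "{i. y $ i > s * ?c} = {i. x $ i > ?c}" using gt le by (auto simp: not_less) (meson linorder_not_le)+
  moreover have "{i. x $ i > ?c} \<in> Y" using level_le_iff[OF assms(1) c, of x] by simp
  ultimately show l: "level Y y \<le> s * ?c" using level_le_iff[OF assms(1)] c assms by simp
  obtain i where "?c < x $ i" using assms(4) by (auto simp: nbhd_iff)
  then show "y \<in> nbhd Y" using gt[of i] l by (auto simp: nbhd_iff intro: le_less_trans)
qed

lemma continuous_on_push:
  fixes Y :: "'n::finite set set"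
  assumes "cplx Y"
  shows "continuous_on (nbhd Y) (push Y)"
  unfolding push_def
  by (intro continuous_on_vec_lambda continuous_on_divide continuous_on_max continuous_intros
      continuous_on_level continuous_on_excess assms) (auto simp: nbhd_def)

lemma push_in_realization:
  assumes "cplx Y" "cplx K" "x \<in> realization K" "x \<in> nbhd Y"
  shows "push Y x \<in> realization (K \<inter> Y)"
proof -
  have *: "push Y x \<in> realization K" "level Y (push Y x) \<le> 0"
    using push_segment[OF assms, of 0] by simp_all
  then have "\<forall>i. 0 \<le> push Y x $ i" "{i. push Y x $ i > 0} \<in> Y"
    using assms level_le_iff[OF assms(1), of 0] by (auto simp: realization_iff)
  moreover have "{i. push Y x $ i > 0} = {i. push Y x $ i \<noteq> 0}" using calculation(1) by (auto simp: less_le)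
  ultimately have "{i. push Y x $ i \<noteq> 0} \<in> Y" by simp
  then show ?thesis using * assms by (auto simp: realization_iff cplx_Int)
qed

lemma trivial_homology_nbhd:
  fixes Y K :: "'n::finite set set"
  assumes "cplx Y" "cplx K"
  shows "trivial_group (relative_homology_group p (top_of_set (realization K \<inter> nbhd Y)) (realization (K \<inter> Y)))"
proof (rule trivial_relative_homology_straight_retraction[where r = "push Y"])
  show "continuous_on (realization K \<inter> nbhd Y) (push Y)"
    using continuous_on_push[OF assms(1)] continuous_on_subset by blast
  show "push Y ` (realization K \<inter> nbhd Y) \<subseteq> realization (K \<inter> Y)"
    using push_in_realization[OF assms] by auto
  show "closed_segment (push Y x) x \<subseteq> realization K \<inter> nbhd Y" if "x \<in> realization K \<inter> nbhd Y" for x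
    using that push_segment(1,2)[OF assms] by (auto elim!: closed_segmentE)
  show "realization (K \<inter> Y) \<subseteq> realization K \<inter> nbhd Y" "\<And>x. x \<in> realization (K \<inter> Y) \<Longrightarrow> push Y x = x"
    using realization_subset_nbhd[OF assms(1)] by (auto simp: realization_Int assms)
qed

section \<open>Relative homology of subcomplexes\<close>

definition rel_hom :: "int \<Rightarrow> 'n::finite set set \<Rightarrow> 'n set set \<Rightarrow> (real ^ 'n) chain set monoid" where
  "rel_hom p K L = relative_homology_group p (top_of_set (realization K)) (realization L)"

lemma group_rel_hom [simp]: "group (rel_hom p K L)"
  by (simp add: rel_hom_def)

text \<open>Thickening \<open>K \<inter> Y\<close> to its neighbourhood does not change the relative
  homology, and from the thickened pair the closed set \<open>realization Y\<close> can be excised.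
  What remains depends on \<open>K\<close> only through the complement of
  \<open>realization Y\<close>, which is the same for \<open>K\<close> and
  \<open>K \<union> Y\<close>.\<close>

lemma rel_hom_iso_complement:
  fixes Y K :: "'n::finite set set"
  assumes "cplx Y" "cplx K"
  shows "relative_homology_group p (top_of_set (realization K - realization Y))
           ((realization K - realization Y) \<inter> nbhd Y) \<cong> rel_hom p K (K \<inter> Y)"
    (is "?A \<cong> _")
proof -
  let ?X = "top_of_set (realization K)" and ?V = "realization K \<inter> nbhd Y"
  have sub: "realization (K \<inter> Y) \<subseteq> ?V"
    using realization_subset_nbhd(3)[OF assms(1)] by (auto simp: realization_Int assms)
  have V: "subtopology ?X ?V = top_of_set ?V" by (simp add: subtopology_subtopology Int_absorb1)
  have "hom_induced p ?X (realization (K \<inter> Y)) ?X ?V id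
      \<in> iso (relative_homology_group p ?X (realization (K \<inter> Y))) (relative_homology_group p ?X ?V)"
  proof (rule very_short_exact_sequence)
    show "exact_seq
         ([relative_homology_group (p - 1) (subtopology ?X ?V) (realization (K \<inter> Y)), relative_homology_group p ?X ?V,
           relative_homology_group p ?X (realization (K \<inter> Y)), relative_homology_group p (subtopology ?X ?V) (realization (K \<inter> Y))],
          [hom_relboundary p ?X ?V (realization (K \<inter> Y)), hom_induced p ?X (realization (K \<inter> Y)) ?X ?V id,
           hom_induced p (subtopology ?X ?V) (realization (K \<inter> Y)) ?X (realization (K \<inter> Y)) id])"
      using homology_exactness_triple_1[OF sub] homology_exactness_triple_3[OF sub] by fastforce
    show "trivial_group (relative_homology_group p (subtopology ?X ?V) (realization (K \<inter> Y)))"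
      "trivial_group (relative_homology_group (p - 1) (subtopology ?X ?V) (realization (K \<inter> Y)))"
      unfolding V by (rule trivial_homology_nbhd[OF assms])+
  qed
  then have 1: "rel_hom p K (K \<inter> Y) \<cong> relative_homology_group p ?X ?V"
    unfolding rel_hom_def is_iso_def by blast
  have "hom_induced p (subtopology ?X (realization K - realization Y)) (?V - realization Y) (subtopology ?X (realization K)) ?V id
    \<in> iso (relative_homology_group p (subtopology ?X (realization K - realization Y)) (?V - realization Y))
          (relative_homology_group p (subtopology ?X (realization K)) ?V)"
  proof (rule homology_excision_axiom)
    have "?X closure_of realization Y \<subseteq> realization K \<inter> realization Y"
      using closed_realization[of K] closed_realization[of Y]
      by (metis Int_commute closed_subset closure_of_minimal closure_of_restrict closedin_closed_Int inf_le1 topspace_euclidean_subtopology)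
    moreover have "?V \<subseteq> ?X interior_of ?V"
      using open_nbhd[OF assms(1)] by (intro interior_of_maximal openin_open_Int) auto
    ultimately show "?X closure_of realization Y \<subseteq> ?X interior_of ?V"
      using sub by (auto simp: realization_Int assms)
  qed auto
  moreover have "subtopology ?X (realization K) = ?X" by (simp add: subtopology_subtopology)
  moreover have "subtopology ?X (realization K - realization Y) = top_of_set (realization K - realization Y)"
    by (simp add: subtopology_subtopology Int_absorb1)
  moreover have "?V - realization Y = (realization K - realization Y) \<inter> nbhd Y" by auto
  ultimately have 2: "?A \<cong> relative_homology_group p ?X ?V"
    unfolding is_iso_def by auto
  show ?thesis using 1 2 by (meson group.iso_sym group_rel_hom iso_trans)
qed

lemma rel_hom_excision:
  assumes "cplx (Y :: 'n::finite set set)" "cplx K"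
  shows "rel_hom p (K \<union> Y) Y \<cong> rel_hom p K (K \<inter> Y)"
proof -
  have eq: "realization (K \<union> Y) - realization Y = realization K - realization Y" "(K \<union> Y) \<inter> Y = Y"
    by (auto simp: realization_Un assms)
  show ?thesis
    using rel_hom_iso_complement[OF assms(1) cplx_Un[OF assms(2,1)], of p] rel_hom_iso_complement[OF assms, of p]
    unfolding eq by (meson group.iso_sym group_relative_homology_group iso_trans)
qed

section \<open>Homology and Euler characteristic of a complex\<close>

definition red_hom :: "int \<Rightarrow> 'n::finite set set \<Rightarrow> (real ^ 'n) chain set monoid" where
  "red_hom p K = reduced_homology_group p (top_of_set (realization K))"

lemma group_red_hom [simp]: "group (red_hom p K)"
  by (simp add: red_hom_def)

lemma comm_group_red_hom: "comm_group (red_hom p K)"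
  unfolding red_hom_def reduced_homology_group_def
  by (intro group.abelian_subgroup_generated abelian_homology_group) auto

lemma axis_in_realization:
  fixes K :: "'n::finite set set"
  assumes "cplx K" "\<sigma> \<in> K" "v \<in> \<sigma>"
  shows "axis v 1 \<in> realization K"
proof -
  have "{v} \<in> K" using assms cplxD(2) by blast
  then show ?thesis unfolding realization_def by (intro UN_I[of "{v}"]) auto
qed

lemma subtopology_realization:
  "L \<subseteq> K \<Longrightarrow> subtopology (top_of_set (realization K)) (realization L) = top_of_set (realization L)"
  using realization_mono[of L K] by (simp add: subtopology_subtopology Int_absorb1)

lemma exact_trivial_middle:
  assumes "exact_seq ([C, B, A], [g, f])" "trivial_group A" "trivial_group C"
  shows "trivial_group B"
proof -
  interpret f: group_hom A B f using assms(1) by simp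
  interpret g: group_hom B C g using assms(1) by (simp add: group_hom_def group_hom_axioms_def)
  have "f ` carrier A = kernel B C g" using assms(1) by simp
  then have "carrier B = {\<one>\<^bsub>B\<^esub>}"
    using f.image_from_trivial_group g.kernel_to_trivial_group assms by metis
  then show ?thesis using f.H.is_group by (simp add: trivial_group_def)
qed

lemma red_hom_exact_1:
  assumes "L \<subseteq> K" "realization L \<noteq> {}"
  shows "exact_seq ([red_hom (p - 1) L, rel_hom p K L, red_hom p K],
    [hom_boundary p (top_of_set (realization K)) (realization L),
     hom_induced p (top_of_set (realization K)) {} (top_of_set (realization K)) (realization L) id])"
  using homology_exactness_reduced_1[of "top_of_set (realization K)" "realization L" p] assms realization_mono[of L K]
  by (simp add: red_hom_def rel_hom_def subtopology_realization Int_absorb1 del: exact_seq_cons_iff)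

lemma red_hom_exact_2:
  assumes "L \<subseteq> K"
  shows "exact_seq ([red_hom (p - 1) K, red_hom (p - 1) L, rel_hom p K L],
    [hom_induced (p - 1) (top_of_set (realization L)) {} (top_of_set (realization K)) {} id,
     hom_boundary p (top_of_set (realization K)) (realization L)])"
  using homology_exactness_reduced_2[of p "top_of_set (realization K)" "realization L"] assms
  by (simp add: red_hom_def rel_hom_def subtopology_realization del: exact_seq_cons_iff)

lemma red_hom_exact_3:
  assumes "L \<subseteq> K"
  shows "exact_seq ([rel_hom p K L, red_hom p K, red_hom p L],
    [hom_induced p (top_of_set (realization K)) {} (top_of_set (realization K)) (realization L) id,
     hom_induced p (top_of_set (realization L)) {} (top_of_set (realization K)) {} id])"
  using homology_exactness_reduced_3[of p "top_of_set (realization K)" "realization L"] assms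
  by (simp add: red_hom_def rel_hom_def subtopology_realization del: exact_seq_cons_iff)

lemma red_hom_trivial_up:
  assumes "L \<subseteq> K" "trivial_group (red_hom p L)" "trivial_group (rel_hom p K L)"
  shows "trivial_group (red_hom p K)"
  using exact_trivial_middle[OF red_hom_exact_3[OF assms(1)]] assms by blast

lemma red_hom_trivial_down:
  assumes "L \<subseteq> K" "trivial_group (red_hom p K)" "trivial_group (rel_hom (p + 1) K L)"
  shows "trivial_group (red_hom p L)"
  using exact_trivial_middle[OF red_hom_exact_2[OF assms(1), of "p + 1"]] assms by simp

lemma rel_hom_trivial:
  assumes "L \<subseteq> K" "realization L \<noteq> {}" "trivial_group (red_hom p K)" "trivial_group (red_hom (p - 1) L)"
  shows "trivial_group (rel_hom p K L)"
  using exact_trivial_middle[OF red_hom_exact_1[OF assms(1,2)]] assms by blast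

lemma red_hom_iso_rel_hom:
  assumes "L \<subseteq> K" "realization L \<noteq> {}" "trivial_group (red_hom p L)" "trivial_group (red_hom (p - 1) L)"
  shows "red_hom p K \<cong> rel_hom p K L"
proof -
  have "exact_seq ([red_hom (p - 1) L, rel_hom p K L, red_hom p K, red_hom p L],
    [hom_boundary p (top_of_set (realization K)) (realization L),
     hom_induced p (top_of_set (realization K)) {} (top_of_set (realization K)) (realization L) id,
     hom_induced p (top_of_set (realization L)) {} (top_of_set (realization K)) {} id])"
    using red_hom_exact_1[OF assms(1,2)] red_hom_exact_3[OF assms(1)] by simp
  from very_short_exact_sequence[OF this assms(3,4)] show ?thesis unfolding is_iso_def by blast
qed

lemma contractible_imp_trivial_red_hom:
  "contractible (realization K) \<Longrightarrow> trivial_group (red_hom p K)"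
  by (simp add: red_hom_def trivial_reduced_homology_group_contractible_space)

text \<open>The realization is star-shaped about \<open>v\<close>, which is a vertex of
  \<open>K\<close> because it may be added to the empty face.\<close>

lemma contractible_cone:
  fixes K :: "'n::finite set set"
  assumes "cplx K" and v: "\<And>\<sigma>. \<sigma> \<in> K \<Longrightarrow> insert v \<sigma> \<in> K"
  shows "contractible (realization K)"
proof (rule starlike_imp_contractible)
  have v1: "axis v 1 \<in> realization K" using axis_in_realization[OF assms(1)] v[OF cplxD(1)[OF assms(1)]] by blast
  have "closed_segment (axis v 1) x \<subseteq> realization K" if "x \<in> realization K" for x
  proof
    fix y assume "y \<in> closed_segment (axis v 1) x"
    then obtain s where s: "0 \<le> s" "s \<le> 1" "y = (1 - s) *\<^sub>R axis v 1 + s *\<^sub>R x" by (rule closed_segmentE)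
    have x: "\<forall>i. 0 \<le> x $ i" "(\<Sum>i\<in>UNIV. x $ i) = 1" "{i. x $ i \<noteq> 0} \<in> K"
      using that assms(1) by (auto simp: realization_iff)
    have yi: "y $ i = (if i = v then 1 - s else 0) + s * x $ i" for i by (simp add: s axis_def)
    have "(\<Sum>i\<in>UNIV. y $ i) = (1 - s) + s * (\<Sum>i\<in>UNIV. x $ i)"
      by (simp add: yi sum.distrib flip: sum_distrib_left)
    moreover have "{i. y $ i \<noteq> 0} \<subseteq> insert v {i. x $ i \<noteq> 0}" by (auto simp: yi)
    then have "{i. y $ i \<noteq> 0} \<in> K" using v[OF x(3)] cplxD(2)[OF assms(1)] by blast
    moreover have "\<forall>i. 0 \<le> y $ i" using x(1) s(1,2) by (simp add: yi)
    ultimately show "y \<in> realization K" using x(2) by (simp add: realization_iff[OF assms(1)])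
  qed
  then show "starlike (realization K)" unfolding starlike_def using v1 by blast
qed

section \<open>Attaching one simplex\<close>

lemma cplx_Pow [simp]: "cplx (Pow \<sigma>)"
  and cplx_boundary: "\<sigma> \<noteq> {} \<Longrightarrow> cplx (Pow \<sigma> - {\<sigma>})"
  by (auto simp: cplx_def)

text \<open>Excision, since \<open>\<sigma>\<close> meets \<open>L\<close> in its whole
  boundary.\<close>

lemma rel_hom_insert:
  fixes L :: "'n::finite set set"
  assumes "cplx L" "cplx (insert \<sigma> L)" "\<sigma> \<notin> L"
  shows "rel_hom p (insert \<sigma> L) L \<cong> rel_hom p (Pow \<sigma>) (Pow \<sigma> - {\<sigma>})"
proof -
  have "Pow \<sigma> \<union> L = insert \<sigma> L" "Pow \<sigma> \<inter> L = Pow \<sigma> - {\<sigma>}"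
    using assms cplxD(2)[OF assms(2), of \<sigma>] by auto
  then show ?thesis using rel_hom_excision[OF assms(1) cplx_Pow[of \<sigma>], of p] by simp
qed

text \<open>
  Removing the face \<open>\<tau>\<close> opposite to \<open>v\<close> from the boundary of a simplex leaves a cone with apex \<open>v\<close>,
  so the homology of the simplex modulo its boundary is that of \<open>\<tau>\<close> modulo its boundary, shifted.
\<close>

lemma rel_hom_simplex:
  fixes \<sigma> :: "'n::finite set"
  assumes "\<sigma> \<noteq> {}"
  shows "if p = int (card \<sigma>) - 1 then rel_hom p (Pow \<sigma>) (Pow \<sigma> - {\<sigma>}) \<cong> integer_group
         else trivial_group (rel_hom p (Pow \<sigma>) (Pow \<sigma> - {\<sigma>}))"
  using finite[of \<sigma>] assms
proof (induction \<sigma> arbitrary: p rule: finite_ne_induct)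
  case (singleton v)
  \<comment> \<open>The boundary of a vertex is \<open>{{}}\<close>, with empty realization; so the
    pair is a point and the dimension axiom applies.\<close>
  have eq: "Pow {v} - {{v}} = {{}}" by auto
  have 1: "realization (Pow {v}) = {axis v 1}"
    by (simp add: realization_def Pow_insert)
  have 2: "realization {{}} = {}" by (simp add: realization_def)
  have "rel_hom p (Pow {v}) (Pow {v} - {{v}}) = homology_group p (top_of_set {axis v 1})"
    unfolding rel_hom_def eq 1 2 ..
  then show ?case
    using homology_coefficients[of "top_of_set {axis v (1::real)}" "axis v 1"]
      homology_dimension_axiom[of "top_of_set {axis v (1::real)}" "axis v 1" p] by auto
next
  case (insert v \<tau>)
  let ?\<sigma> = "insert v \<tau>"
  define B where "B = Pow ?\<sigma> - {?\<sigma>}"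
  define C where "C = B - {\<tau>}"
  have cB: "cplx B" unfolding B_def by (rule cplx_boundary) simp
  have cC: "cplx C" using insert.hyps unfolding C_def B_def cplx_def by auto
  have cone: "contractible (realization C)"
    using insert.hyps by (intro contractible_cone[OF cC, of v]) (auto simp: C_def B_def)
  have "{v} \<in> C" using insert.hyps by (auto simp: C_def B_def)
  then have neC: "realization C \<noteq> {}" using axis_in_realization[OF cC] by blast
  have neB: "realization B \<noteq> {}" using neC realization_mono[of C B] by (auto simp: C_def)
  have "contractible (realization (Pow ?\<sigma>))" by (rule contractible_cone[of _ v]) auto
  then have "rel_hom p (Pow ?\<sigma>) B \<cong> red_hom (p - 1) B"
    using isomorphic_group_relative_homology_of_contractible[of "top_of_set (realization (Pow ?\<sigma>))" "realization B" p]
      neB realization_mono[of B "Pow ?\<sigma>"]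
    by (simp add: rel_hom_def red_hom_def subtopology_realization B_def Int_absorb1)
  also have "red_hom (p - 1) B \<cong> rel_hom (p - 1) B C"
    by (rule red_hom_iso_rel_hom) (use neC cone contractible_imp_trivial_red_hom in \<open>auto simp: C_def\<close>)
  also have "rel_hom (p - 1) B C \<cong> rel_hom (p - 1) (Pow \<tau>) (Pow \<tau> - {\<tau>})"
  proof -
    have "B = insert \<tau> C" "\<tau> \<notin> C" using insert.hyps by (auto simp: C_def B_def)
    then show ?thesis using rel_hom_insert[OF cC] cB by metis
  qed
  finally have iso: "rel_hom p (Pow ?\<sigma>) B \<cong> rel_hom (p - 1) (Pow \<tau>) (Pow \<tau> - {\<tau>})" .
  have card: "int (card ?\<sigma>) - 1 = int (card \<tau>) - 1 + 1" using insert.hyps by simp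
  show ?case
  proof (cases "p = int (card ?\<sigma>) - 1")
    case True
    then show ?thesis using iso insert.IH[of "p - 1"] card unfolding B_def by (auto intro: iso_trans)
  next
    case False
    then have "trivial_group (rel_hom (p - 1) (Pow \<tau>) (Pow \<tau> - {\<tau>}))" using insert.IH[of "p - 1"] card by auto
    then show ?thesis
      using False isomorphic_group_triviality[OF iso] by (simp add: B_def)
  qed
qed

lemma rel_hom_insert_integer:
  fixes L :: "'n::finite set set"
  assumes "cplx L" "cplx (insert \<sigma> L)" "\<sigma> \<notin> L"
  shows "rel_hom (int (card \<sigma>) - 1) (insert \<sigma> L) L \<cong> integer_group"
proof -
  have "\<sigma> \<noteq> {}" using assms cplxD by blast
  then show ?thesis using rel_hom_insert[OF assms, of "int (card \<sigma>) - 1"] rel_hom_simplex[of \<sigma> "int (card \<sigma>) - 1"]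
    by (auto intro: iso_trans)
qed

lemma rel_hom_insert_trivial:
  fixes L :: "'n::finite set set"
  assumes "cplx L" "cplx (insert \<sigma> L)" "\<sigma> \<notin> L" "p \<noteq> int (card \<sigma>) - 1"
  shows "trivial_group (rel_hom p (insert \<sigma> L) L)"
proof -
  have "\<sigma> \<noteq> {}" using assms cplxD by blast
  then show ?thesis using isomorphic_group_triviality[OF rel_hom_insert[OF assms(1-3), of p]] rel_hom_simplex[of \<sigma> p] assms(4)
    by simp
qed

text \<open>A missing face of least cardinality has all its proper faces present, so it can be added
  next.\<close>

lemma cplx_extension_induct [consumes 3, case_names base step]:
  fixes L K :: "'n::finite set set"
  assumes "cplx L" "cplx K" "L \<subseteq> K"
    and base: "P L"
    and step: "\<And>M \<sigma>. cplx M \<Longrightarrow> L \<subseteq> M \<Longrightarrow> M \<subseteq> K \<Longrightarrow> \<sigma> \<in> K \<Longrightarrow> \<sigma> \<notin> M \<Longrightarrow> cplx (insert \<sigma> M) \<Longrightarrow> P M \<Longrightarrow> P (insert \<sigma> M)"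
  shows "P K"
proof -
  have "P K" if "cplx M" "L \<subseteq> M" "M \<subseteq> K" "P M" for M
    using that
  proof (induction "card (K - M)" arbitrary: M rule: less_induct)
    case less
    show ?case
    proof (cases "K - M = {}")
      case True
      then have "M = K" using less by auto
      then show ?thesis using less by simp
    next
      case False
      then obtain \<sigma> where \<sigma>: "\<sigma> \<in> K - M" "\<And>\<tau>. \<tau> \<in> K - M \<Longrightarrow> card \<sigma> \<le> card \<tau>"
        using ex_has_least_nat[of "\<lambda>\<tau>. \<tau> \<in> K - M" _ card] by auto
      have sub: "\<tau> \<in> insert \<sigma> M" if "\<tau> \<subseteq> \<sigma>" for \<tau>
      proof (cases "\<tau> = \<sigma>")
        case False
        then have "card \<tau> < card \<sigma>" using that by (intro psubset_card_mono) auto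
        moreover have "\<tau> \<in> K" using that \<sigma>(1) cplxD(2)[OF assms(2)] by blast
        ultimately show ?thesis using \<sigma>(2)[of \<tau>] by fastforce
      qed simp
      have c: "cplx (insert \<sigma> M)"
        unfolding cplx_def using sub cplxD[OF less.prems(1)] by blast
      have "card (K - insert \<sigma> M) < card (K - M)"
        using \<sigma>(1) by (intro psubset_card_mono) auto
      then show ?thesis
        using less \<sigma>(1) c step[of M \<sigma>] by (intro less.hyps[of "insert \<sigma> M"]) auto
    qed
  qed
  then show ?thesis using assms base by blast
qed

text \<open>Adding \<open>\<sigma>\<close> can create classes only in degree
  \<open>card \<sigma> - 1\<close>.\<close>

lemma red_hom_trivial_extension:
  fixes L K :: "'n::finite set set"
  assumes "cplx L" "cplx K" "L \<subseteq> K" "trivial_group (red_hom p L)"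
    and "\<And>\<sigma>. \<sigma> \<in> K - L \<Longrightarrow> int (card \<sigma>) \<noteq> p + 1"
  shows "trivial_group (red_hom p K)"
  using assms(1-3)
proof (induction rule: cplx_extension_induct)
  case (step M \<sigma>)
  then have "\<sigma> \<in> K - L" by blast
  then have "trivial_group (rel_hom p (insert \<sigma> M) M)"
    using assms(5)[of \<sigma>] step by (intro rel_hom_insert_trivial) auto
  then show ?case using step red_hom_trivial_up[of M "insert \<sigma> M"] by blast
qed (rule assms)

text \<open>Removing \<open>\<sigma>\<close> can create classes only in degree
  \<open>card \<sigma> - 2\<close>, that of its boundary.\<close>

lemma red_hom_trivial_restriction:
  fixes L K :: "'n::finite set set"
  assumes "cplx L" "cplx K" "L \<subseteq> K" "trivial_group (red_hom p K)"
    and "\<And>\<sigma>. \<sigma> \<in> K - L \<Longrightarrow> int (card \<sigma>) \<noteq> p + 2"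
  shows "trivial_group (red_hom p L)"
proof -
  have "trivial_group (red_hom p K) \<longrightarrow> trivial_group (red_hom p L)"
    using assms(1-3)
  proof (induction rule: cplx_extension_induct)
    case (step M \<sigma>)
    then have "\<sigma> \<in> K - L" by blast
    then have "trivial_group (rel_hom (p + 1) (insert \<sigma> M) M)"
      using assms(5)[of \<sigma>] step by (intro rel_hom_insert_trivial) auto
    then show ?case using step red_hom_trivial_down[of M "insert \<sigma> M"] by blast
  qed simp
  then show ?thesis using assms by blast
qed

text \<open>The reduced Euler characteristic: the exponent is the dimension shifted by 2, which
  stays natural for the empty face and gives it the sign -1.\<close>

definition euler :: "'n set set \<Rightarrow> int" where
  "euler K = (\<Sum>\<sigma>\<in>K. (- 1) ^ (card \<sigma> + 1))"

text \<open>The pair has homology only in degree \<open>card \<sigma> - 1\<close>, where it is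
  infinite cyclic. So the other degrees do not change, and the long exact sequence shrinks to the
  five terms of \<open>has_rank_five_term\<close>. Which of the two ranks changes depends on
  \<open>L\<close>; their difference does not.\<close>

lemma rank_insert:
  fixes L :: "'n::finite set set"
  assumes "cplx L" "cplx (insert \<sigma> L)" "\<sigma> \<notin> L" "realization L \<noteq> {}"
    and r: "\<And>p. has_rank (red_hom p L) (r p)"
  obtains a c where
    "has_rank (red_hom (int (card \<sigma>) - 1) (insert \<sigma> L)) a"
    "has_rank (red_hom (int (card \<sigma>) - 2) (insert \<sigma> L)) c"
    "int a - int c = int (r (int (card \<sigma>) - 1)) - int (r (int (card \<sigma>) - 2)) + 1"
    "\<And>p. p \<noteq> int (card \<sigma>) - 1 \<Longrightarrow> p \<noteq> int (card \<sigma>) - 2 \<Longrightarrow> has_rank (red_hom p (insert \<sigma> L)) (r p)"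
proof -
  let ?K = "insert \<sigma> L" and ?k = "int (card \<sigma>) - 1"
  have sub: "L \<subseteq> ?K" by auto
  have tr: "trivial_group (rel_hom p ?K L)" if "p \<noteq> ?k" for p
    using rel_hom_insert_trivial[OF assms(1-3) that] .
  let ?\<iota> = "\<lambda>p. hom_induced p (top_of_set (realization L)) {} (top_of_set (realization ?K)) {} id"
  let ?\<beta> = "\<lambda>p. hom_induced p (top_of_set (realization ?K)) {} (top_of_set (realization ?K)) (realization L) id"
  let ?\<delta> = "\<lambda>p. hom_boundary p (top_of_set (realization ?K)) (realization L)"
  have e1: "exact_seq ([red_hom (p - 1) L, rel_hom p ?K L, red_hom p ?K], [?\<delta> p, ?\<beta> p])" for p
    by (rule red_hom_exact_1[OF sub assms(4)])
  have e2: "exact_seq ([red_hom (p - 1) ?K, red_hom (p - 1) L, rel_hom p ?K L], [?\<iota> (p - 1), ?\<delta> p])" for p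
    by (rule red_hom_exact_2[OF sub])
  have e3: "exact_seq ([rel_hom p ?K L, red_hom p ?K, red_hom p L], [?\<beta> p, ?\<iota> p])" for p
    by (rule red_hom_exact_3[OF sub])
  have surj: "?\<iota> p ` carrier (red_hom p L) = carrier (red_hom p ?K)" if "p \<noteq> ?k" for p
  proof -
    interpret b: group_hom "red_hom p ?K" "rel_hom p ?K L" "?\<beta> p"
      using e3[of p] by (simp add: group_hom_def group_hom_axioms_def)
    show ?thesis using e3[of p] b.kernel_to_trivial_group[OF tr[OF that]] by simp
  qed
  have inj: "inj_on (?\<iota> p) (carrier (red_hom p L))" if "p + 1 \<noteq> ?k" for p
  proof -
    have e: "exact_seq ([red_hom p ?K, red_hom p L, rel_hom (p + 1) ?K L], [?\<iota> p, ?\<delta> (p + 1)])"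
      using e2[of "p + 1"] by simp
    interpret i: group_hom "red_hom p L" "red_hom p ?K" "?\<iota> p"
      using e by (simp add: group_hom_def group_hom_axioms_def)
    interpret d: group_hom "rel_hom (p + 1) ?K L" "red_hom p L" "?\<delta> (p + 1)"
      using e by (simp add: group_hom_def group_hom_axioms_def)
    have "kernel (red_hom p L) (red_hom p ?K) (?\<iota> p) = {\<one>\<^bsub>red_hom p L\<^esub>}"
      using e d.image_from_trivial_group[OF tr[OF that]] by simp
    then show ?thesis by (rule i.trivial_ker_imp_inj)
  qed
  have homi: "?\<iota> p \<in> hom (red_hom p L) (red_hom p ?K)" for p
    using e3[of p] by (simp add: group_hom_def group_hom_axioms_def)
  have ex: "\<exists>a' c'. has_rank (red_hom ?k ?K) a' \<and> has_rank (red_hom (?k - 1) ?K) c' \<and>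
     int a' - int c' = int (r ?k) - int (r (?k - 1)) + 1"
  proof (rule has_rank_five_term[where A = "red_hom ?k L" and B = "red_hom ?k ?K" and C = "red_hom (?k - 1) L"
        and D = "red_hom (?k - 1) ?K" and Z = "rel_hom ?k ?K L" and \<iota> = "?\<iota> ?k" and \<beta> = "?\<beta> ?k"
        and \<delta> = "?\<delta> ?k" and \<pi> = "?\<iota> (?k - 1)"])
    show "?\<iota> ?k \<in> hom (red_hom ?k L) (red_hom ?k ?K)" "?\<iota> (?k - 1) \<in> hom (red_hom (?k - 1) L) (red_hom (?k - 1) ?K)"
      by (rule homi)+
    show "?\<beta> ?k \<in> hom (red_hom ?k ?K) (rel_hom ?k ?K L)"
      using e3[of ?k] by (simp add: group_hom_def group_hom_axioms_def)
    show "?\<delta> ?k \<in> hom (rel_hom ?k ?K L) (red_hom (?k - 1) L)"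
      using e1[of ?k] by (simp add: group_hom_def group_hom_axioms_def)
    show "inj_on (?\<iota> ?k) (carrier (red_hom ?k L))" by (rule inj) simp
    show "?\<iota> (?k - 1) ` carrier (red_hom (?k - 1) L) = carrier (red_hom (?k - 1) ?K)" by (rule surj) simp
    show "?\<iota> ?k ` carrier (red_hom ?k L) = kernel (red_hom ?k ?K) (rel_hom ?k ?K L) (?\<beta> ?k)"
      using e3[of ?k] by simp
    show "?\<beta> ?k ` carrier (red_hom ?k ?K) = kernel (rel_hom ?k ?K L) (red_hom (?k - 1) L) (?\<delta> ?k)"
      using e1[of ?k] by simp
    show "?\<delta> ?k ` carrier (rel_hom ?k ?K L) = kernel (red_hom (?k - 1) L) (red_hom (?k - 1) ?K) (?\<iota> (?k - 1))"
      using e2[of ?k] by simp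
    show "rel_hom ?k ?K L \<cong> integer_group" by (rule rel_hom_insert_integer[OF assms(1-3)])
  qed (auto simp: comm_group_red_hom r)
  have oth: "has_rank (red_hom p ?K) (r p)" if "p \<noteq> ?k" "p \<noteq> ?k - 1" for p
  proof (rule has_rank_iso[OF _ _ _ r[of p]])
    show "?\<iota> p \<in> iso (red_hom p L) (red_hom p ?K)"
      using homi inj[of p] surj[of p] that by (auto simp: iso_def bij_betw_def)
  qed auto
  have eq: "?k - 1 = int (card \<sigma>) - 2" by simp
  obtain a c where "has_rank (red_hom ?k ?K) a" "has_rank (red_hom (?k - 1) ?K) c"
     "int a - int c = int (r ?k) - int (r (?k - 1)) + 1" using ex by blast
  moreover have "has_rank (red_hom p ?K) (r p)" if "p \<noteq> ?k" "p \<noteq> int (card \<sigma>) - 2" for p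
    using oth[of p] that by simp
  ultimately show thesis using that[of a c] unfolding eq by simp
qed

text \<open>The range of degrees only has to contain \<open>card \<sigma> - 1\<close> and
  \<open>card \<sigma> - 2\<close> for every nonempty face. The exponent \<open>nat (p + 1)\<close>
  together with the outer minus gives the sign of degree \<open>p\<close>, also for
  \<open>p = -1\<close>.\<close>

lemma euler_rank:
  fixes K :: "'n::finite set set"
  assumes "cplx K" "{v} \<in> K"
  shows "\<exists>r. (\<forall>p. has_rank (red_hom p K) (r p)) \<and>
    euler K = - (\<Sum>p\<in>{-1..int CARD('n)}. (- 1) ^ nat (p + 1) * int (r p))"
proof -
  \<comment> \<open>The induction starts from a vertex and not from \<open>{{}}\<close>, since
    \<open>rank_insert\<close> requires a nonempty realization.\<close>
  let ?L = "{{}, {v}}"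
  have "cplx ?L" unfolding cplx_def by (auto dest: subset_singletonD)
  have "?L \<subseteq> K" using assms cplxD(1) by simp
  from \<open>cplx ?L\<close> \<open>cplx K\<close> \<open>?L \<subseteq> K\<close> show ?thesis
  proof (induction rule: cplx_extension_induct)
    case base
    have "contractible (realization ?L)" by (rule contractible_cone[OF \<open>cplx ?L\<close>, of v]) auto
    then have "has_rank (red_hom p ?L) 0" for p
      by (intro group.has_rank_trivial contractible_imp_trivial_red_hom) auto
    then show ?case by (intro exI[of _ "\<lambda>_. 0"]) (simp add: euler_def)
  next
    case (step M \<sigma>)
    let ?k = "int (card \<sigma>) - 1" and ?A = "{-1..int CARD('n)}"
    obtain r where r: "\<And>p. has_rank (red_hom p M) (r p)"
        "euler M = - (\<Sum>p\<in>?A. (- 1) ^ nat (p + 1) * int (r p))" using step by blast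
    have "realization M \<noteq> {}" using axis_in_realization[OF step(1), of "{v}" v] step(2) by auto
    then obtain a c where ac: "has_rank (red_hom (int (card \<sigma>) - 1) (insert \<sigma> M)) a"
      "has_rank (red_hom (int (card \<sigma>) - 2) (insert \<sigma> M)) c"
      "int a - int c = int (r (int (card \<sigma>) - 1)) - int (r (int (card \<sigma>) - 2)) + 1"
      "\<And>p. p \<noteq> int (card \<sigma>) - 1 \<Longrightarrow> p \<noteq> int (card \<sigma>) - 2 \<Longrightarrow> has_rank (red_hom p (insert \<sigma> M)) (r p)"
      using rank_insert[OF step(1) step(6) step(5) _ r(1)] by blast
    define r' where "r' = r(?k := a, ?k - 1 := c)"
    have r': "has_rank (red_hom p (insert \<sigma> M)) (r' p)" for p
      using ac by (auto simp: r'_def)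
    have "\<sigma> \<noteq> {}" using step cplxD(1) by blast
    then have k: "card \<sigma> \<ge> 1" "card \<sigma> \<le> CARD('n)" by (auto simp: Suc_le_eq card_gt_0_iff card_mono)
    have "(\<Sum>p\<in>?A. (- 1) ^ nat (p + 1) * int (r' p)) - (\<Sum>p\<in>?A. (- 1) ^ nat (p + 1) * int (r p))
        = (\<Sum>p\<in>?A. (- 1) ^ nat (p + 1) * (int (r' p) - int (r p)))"
      by (simp add: sum_subtractf right_diff_distrib)
    also have "\<dots> = (\<Sum>p\<in>{?k, ?k - 1}. (- 1) ^ nat (p + 1) * (int (r' p) - int (r p)))"
      using k by (intro sum.mono_neutral_right) (auto simp: r'_def)
    also have "\<dots> = (- 1) ^ card \<sigma> * (int a - int (r ?k)) + (- 1) ^ (card \<sigma> - 1) * (int c - int (r (?k - 1)))"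
      using k by (auto simp: r'_def nat_diff_distrib)
    also have "(- 1 :: int) ^ (card \<sigma> - 1) = - ((- 1) ^ card \<sigma>)"
      using k by (cases "card \<sigma>") auto
    finally have "(\<Sum>p\<in>?A. (- 1) ^ nat (p + 1) * int (r' p)) - (\<Sum>p\<in>?A. (- 1) ^ nat (p + 1) * int (r p))
       = (- 1) ^ card \<sigma> * ((int a - int c) - (int (r ?k) - int (r (?k - 1))))"
      by (simp add: algebra_simps)
    also have "\<dots> = (- 1) ^ card \<sigma>" using ac(3) by (simp add: algebra_simps)
    finally have "euler (insert \<sigma> M) = - (\<Sum>p\<in>?A. (- 1) ^ nat (p + 1) * int (r' p))"
      using r(2) step by (simp add: euler_def)
    then show ?case using r' by blast
  qed
qed

lemma euler_acyclic:
  fixes K :: "'n::finite set set"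
  assumes "cplx K" "{v} \<in> K" "\<And>p. trivial_group (red_hom p K)"
  shows "euler K = 0"
proof -
  obtain r where r: "\<And>p. has_rank (red_hom p K) (r p)"
     "euler K = - (\<Sum>p\<in>{-1..int CARD('n)}. (- 1) ^ nat (p + 1) * int (r p))"
    using euler_rank[OF assms(1,2)] by blast
  have "r p = 0" for p using group.trivial_has_rank[OF _ assms(3) r(1)] by simp
  then show ?thesis using r(2) by simp
qed

lemma euler_sphere_homology:
  fixes K :: "'n::finite set set"
  assumes "cplx K" "{v} \<in> K" "\<And>p. p \<noteq> int d \<Longrightarrow> trivial_group (red_hom p K)"
    "red_hom (int d) K \<cong> integer_group" "d < CARD('n)"
  shows "euler K = (- 1) ^ d"
proof -
  obtain r where r: "\<And>p. has_rank (red_hom p K) (r p)"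
     "euler K = - (\<Sum>p\<in>{-1..int CARD('n)}. (- 1) ^ nat (p + 1) * int (r p))"
    using euler_rank[OF assms(1,2)] by blast
  have 0: "r p = 0" if "p \<noteq> int d" for p using group.trivial_has_rank[OF _ assms(3) r(1)] that by simp
  have "has_rank integer_group (r (int d))" by (rule has_rank_is_iso[OF assms(4) _ _ r(1)]) auto
  then have 1: "r (int d) = 1" by (rule has_rank_integer_group)
  have "(\<Sum>p\<in>{-1..int CARD('n)}. (- 1) ^ nat (p + 1) * int (r p)) = (\<Sum>p\<in>{int d}. (- 1) ^ nat (p + 1) * int (r p))"
    using assms(5) 0 by (intro sum.mono_neutral_right) auto
  then show ?thesis using r(2) 1 by (simp add: nat_add_distrib)
qed

section \<open>Triangulated spheres\<close>

text \<open>Contract to the antipode of \<open>a\<close> by normalizing the segments from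
  \<open>q\<close> to \<open>- a\<close>. Such a segment meets the closed ray from the origin
  through \<open>a\<close>, whose complement is \<open>?Z\<close>, only if \<open>q = a\<close>; so
  the normalization is defined and never hits \<open>a\<close>.\<close>

lemma contractible_nsphere_minus_point:
  assumes a: "a \<in> topspace (nsphere n)"
  shows "contractible_space (subtopology (nsphere n) (- {a}))"
proof -
  have a1: "(\<Sum>i\<le>n. (a i)\<^sup>2) = 1" "\<And>i. i > n \<Longrightarrow> a i = 0" using a by (auto simp: nsphere)
  let ?X = "subtopology (nsphere n) (- {a})"
  let ?g = "\<lambda>x i. x i / sqrt (\<Sum>j\<le>n. x j ^ 2)"
  let ?h = "\<lambda>(t, q) i. (1 - t) * q i - t * a i"
  let ?Z = "{x :: nat \<Rightarrow> real. \<not> (\<exists>c\<ge>0. \<forall>i. x i = c * a i)}"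
  let ?Y = "subtopology (Euclidean_space (Suc n)) ?Z"
  have nz: "x = a" if x: "(\<Sum>i\<le>n. (x i)\<^sup>2) = 1" and c: "c \<ge> 0" "\<And>i. (1 - t) * x i - t * a i = c * a i"
    and t: "0 \<le> t" "t \<le> 1" for x t c
  proof -
    have eq: "(1 - t) * x i = (c + t) * a i" for i using c(2)[of i] by (simp add: algebra_simps)
    have "(1 - t)\<^sup>2 * (\<Sum>i\<le>n. (x i)\<^sup>2) = (\<Sum>i\<le>n. ((1 - t) * x i)\<^sup>2)"
      by (simp add: sum_distrib_left power_mult_distrib)
    also have "\<dots> = (c + t)\<^sup>2 * (\<Sum>i\<le>n. (a i)\<^sup>2)"
      unfolding eq by (simp add: sum_distrib_left power_mult_distrib)
    finally have "(1 - t)\<^sup>2 = (c + t)\<^sup>2" using x a1 by simp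
    then have "1 - t = c + t" using c(1) t by (simp add: power2_eq_iff_nonneg)
    moreover from this have "1 - t \<noteq> 0" using c t by auto
    ultimately have "x i = a i" for i using eq[of i] by (metis mult_cancel_left)
    then show ?thesis by auto
  qed
  have nz': "\<exists>i. (1 - t) * x i - t * a i \<noteq> c * a i"
    if "(\<Sum>i\<le>n. (x i)\<^sup>2) = 1" "x \<noteq> a" "0 \<le> c" "0 \<le> t" "t \<le> 1" for x c t
    using nz[OF that(1,3) _ that(4,5)] that(2) by blast
  have "continuous_map (prod_topology (top_of_set {0..1}) ?X) ?X (?g \<circ> ?h)"
  proof (rule continuous_map_compose)
    show "continuous_map (prod_topology (top_of_set {0..1}) ?X) ?Y ?h"
      unfolding Euclidean_space_def subtopology_subtopology continuous_map_in_subtopology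
    proof (intro conjI)
      show "continuous_map (prod_topology (top_of_set {0..1}) ?X) (powertop_real UNIV) ?h"
        unfolding continuous_map_componentwise_UNIV case_prod_unfold nsphere subtopology_subtopology prod_topology_subtopology
        by (intro allI continuous_intros continuous_map_from_subtopology continuous_map_prod_snd) auto
      show "?h \<in> topspace (prod_topology (top_of_set {0..1}) ?X) \<rightarrow> {x. \<forall>i\<ge>Suc n. x i = 0} \<inter> ?Z"
        using nz' a1(2) by (auto simp: nsphere)
    qed
  next
    have pos: "(\<Sum>j\<le>n. (x j)\<^sup>2) \<noteq> 0" if "x \<in> ?Z" "\<forall>i\<ge>Suc n. x i = 0" for x :: "nat \<Rightarrow> real"
    proof
      assume "(\<Sum>j\<le>n. (x j)\<^sup>2) = 0"
      then have "\<forall>j\<le>n. x j = 0" by (simp add: sum_nonneg_eq_0_iff)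
      then have "\<forall>i. x i = 0 * a i" using that(2) by (metis mult_zero_left not_less_eq_eq)
      then show False using that(1) by blast
    qed
    show "continuous_map ?Y ?X ?g"
      unfolding Euclidean_space_def nsphere subtopology_subtopology continuous_map_in_subtopology
    proof (intro conjI)
      show "continuous_map (subtopology (powertop_real UNIV) ({x. \<forall>i\<ge>Suc n. x i = 0} \<inter> ?Z)) (powertop_real UNIV) ?g"
        unfolding continuous_map_componentwise_UNIV
        using pos by (intro continuous_intros conjI allI) auto
      show "?g \<in> topspace (subtopology (powertop_real UNIV) ({x. \<forall>i\<ge>Suc n. x i = 0} \<inter> ?Z)) \<rightarrow>
        {x. (\<Sum>i\<le>n. (x i)\<^sup>2) = 1 \<and> (\<forall>i>n. x i = 0)} \<inter> - {a}"
      proof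
        fix x assume "x \<in> topspace (subtopology (powertop_real UNIV) ({x. \<forall>i\<ge>Suc n. x i = 0} \<inter> ?Z))"
        then have x: "\<forall>i\<ge>Suc n. x i = 0" "x \<in> ?Z" by auto
        let ?N = "\<Sum>j\<le>n. (x j)\<^sup>2"
        have N: "?N > 0" using pos[OF x(2,1)] by (simp add: less_le sum_nonneg)
        have "(\<Sum>i\<le>n. (?g x i)\<^sup>2) = 1" using N by (simp add: power_divide flip: sum_divide_distrib)
        moreover have "?g x \<noteq> a"
        proof
          assume "?g x = a"
          then have "a i = x i / sqrt ?N" for i by (metis (no_types))
          then have "x i = sqrt ?N * a i" for i using N by simp
          moreover have "sqrt ?N \<ge> 0" using N by simp
          ultimately show False using x(2) by blast
        qed
        ultimately show "?g x \<in> {x. (\<Sum>i\<le>n. (x i)\<^sup>2) = 1 \<and> (\<forall>i>n. x i = 0)} \<inter> - {a}" using x(1) by auto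
      qed
    qed
  qed
  moreover have "(?g \<circ> ?h) (0, x) = x" if "x \<in> topspace ?X" for x
    using that by (simp add: nsphere)
  moreover have "(?g \<circ> ?h) (1, x) = (\<lambda>i. - a i)" if "x \<in> topspace ?X" for x
    using a1(1) by simp
  ultimately show ?thesis
    apply (simp add: contractible_space_def homotopic_with)
    apply (rule_tac x="\<lambda>i. - a i" in exI)
    apply (rule_tac x="?g \<circ> ?h" in exI, force)
    done
qed

section \<open>Deleting the open star of a face\<close>

definition star_del :: "'n set \<Rightarrow> 'n set set \<Rightarrow> 'n set set" where
  "star_del \<sigma> K = {\<tau> \<in> K. \<not> \<sigma> \<subseteq> \<tau>}"

lemma cplx_star_del: "cplx K \<Longrightarrow> \<sigma> \<noteq> {} \<Longrightarrow> cplx (star_del \<sigma> K)"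
  by (auto simp: cplx_def star_del_def)

definition bary :: "'n::finite set \<Rightarrow> real ^ 'n" where
  "bary \<sigma> = (\<chi> i. if i \<in> \<sigma> then 1 / card \<sigma> else 0)"

lemma bary_in_realization:
  fixes K :: "'n::finite set set"
  assumes "cplx K" "\<sigma> \<in> K" "\<sigma> \<noteq> {}"
  shows "bary \<sigma> \<in> realization K"
proof -
  have "{i. bary \<sigma> $ i \<noteq> 0} = \<sigma>" using assms(3) by (auto simp: bary_def)
  moreover have "(\<Sum>i\<in>UNIV. bary \<sigma> $ i) = (\<Sum>i\<in>\<sigma>. 1 / card \<sigma>)"
    unfolding bary_def by (simp add: sum.If_cases)
  ultimately show ?thesis using assms by (simp add: realization_iff bary_def)
qed

text \<open>The retraction \<open>r\<close> pushes away from the barycenter: it subtracts the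
  multiple of \<open>bary \<sigma>\<close> that brings the least coordinate \<open>m x\<close> on
  \<open>\<sigma>\<close> down to 0, and rescales. The factor \<open>1 - k * m x\<close> vanishes
  only at the barycenter, because the coordinates sum to 1.\<close>

lemma homotopy_equivalent_star_del:
  fixes K :: "'n::finite set set"
  assumes K: "cplx K" and \<sigma>: "\<sigma> \<in> K" "\<sigma> \<noteq> {}"
  shows "top_of_set (realization K - {bary \<sigma>}) homotopy_equivalent_space top_of_set (realization (star_del \<sigma> K))"
proof -
  define k where "k = real (card \<sigma>)"
  have k: "k > 0" using \<sigma> by (simp add: k_def card_gt_0_iff)
  define m where "m x = Min ((\<lambda>i. x $ i) ` \<sigma>)" for x :: "real ^ 'n"
  define r where "r x = inverse (1 - k * m x) *\<^sub>R (x - (k * m x) *\<^sub>R bary \<sigma>)" for x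
  have contm: "continuous_on S m" for S
    unfolding m_def using \<sigma> by (intro continuous_on_Min_finite) (auto intro!: continuous_intros)
  have m_le: "m x \<le> x $ i" if "i \<in> \<sigma>" for x i unfolding m_def using that by (intro Min_le) auto
  have m_ex: "\<exists>i\<in>\<sigma>. x $ i = m x" for x
  proof -
    have "m x \<in> (\<lambda>i. x $ i) ` \<sigma>" unfolding m_def using \<sigma> by (intro Min_in) auto
    then show ?thesis by auto
  qed
  have bi: "bary \<sigma> $ i = (if i \<in> \<sigma> then 1 / k else 0)" for i by (simp add: bary_def k_def)
  have m1: "k * m x < 1" if x: "x \<in> realization K - {bary \<sigma>}" for x
  proof (rule ccontr)
    assume "\<not> k * m x < 1"
    then have ge: "x $ i \<ge> 1 / k" if "i \<in> \<sigma>" for i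
      using m_le[OF that, of x] k by (simp add: field_simps)
        (metis linorder_not_less mult.commute mult_le_cancel_left_pos order_trans)
    have x': "\<forall>i. 0 \<le> x $ i" "(\<Sum>i\<in>UNIV. x $ i) = 1" using x K by (auto simp: realization_iff)
    have "(\<Sum>i\<in>UNIV. x $ i - bary \<sigma> $ i) = 0"
      using x' bary_in_realization[OF assms] K by (simp add: sum_subtractf realization_iff)
    moreover have "\<forall>i. 0 \<le> x $ i - bary \<sigma> $ i" using x' ge by (simp add: bi)
    ultimately have "\<forall>i. x $ i - bary \<sigma> $ i = 0" by (simp add: sum_nonneg_eq_0_iff)
    then have "x = bary \<sigma>" by (simp add: vec_eq_iff)
    then show False using x by simp
  qed
  have ri: "r x $ i = (if i \<in> \<sigma> then (x $ i - m x) / (1 - k * m x) else x $ i / (1 - k * m x))" for x i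
    using k by (simp add: r_def bi divide_inverse)
  have rK: "r x \<in> realization K" if x: "x \<in> realization K - {bary \<sigma>}" for x
  proof -
    have x': "\<forall>i. 0 \<le> x $ i" "(\<Sum>i\<in>UNIV. x $ i) = 1" "{i. x $ i \<noteq> 0} \<in> K" using x K by (auto simp: realization_iff)
    have "(\<Sum>i\<in>UNIV. r x $ i) = inverse (1 - k * m x) * ((\<Sum>i\<in>UNIV. x $ i) - k * m x * (\<Sum>i\<in>UNIV. bary \<sigma> $ i))"
      by (simp add: r_def sum_subtractf flip: sum_distrib_left)
    also have "\<dots> = 1" using x' bary_in_realization[OF assms] K m1[OF x] by (simp add: realization_iff)
    finally have 1: "(\<Sum>i\<in>UNIV. r x $ i) = 1" .
    have 2: "\<forall>i. 0 \<le> r x $ i" using x' m1[OF x] m_le by (simp add: ri)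
    have m0: "0 \<le> m x" using m_ex[of x] x' by metis
    have "{i. r x $ i \<noteq> 0} \<subseteq> {i. x $ i \<noteq> 0}"
      using m_le[of _ x] m0 x'(1) by (auto simp: ri split: if_splits) (metis order_antisym)
    then have "{i. r x $ i \<noteq> 0} \<in> K" using x'(3) K cplxD(2) by blast
    then show ?thesis using 1 2 by (simp add: realization_iff[OF K])
  qed
  have conv: "convex_seg \<in> realization K" if "x \<in> realization K - {bary \<sigma>}" "0 \<le> s" "s \<le> 1"
      "convex_seg = (1 - s) *\<^sub>R r x + s *\<^sub>R x" for x s convex_seg
  proof -
    have x': "\<forall>i. 0 \<le> x $ i" "(\<Sum>i\<in>UNIV. x $ i) = 1" "{i. x $ i \<noteq> 0} \<in> K" using that K by (auto simp: realization_iff)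
    have r': "\<forall>i. 0 \<le> r x $ i" "(\<Sum>i\<in>UNIV. r x $ i) = 1" using rK[OF that(1)] K by (auto simp: realization_iff)
    have m0: "0 \<le> m x" using m_ex[of x] x' by metis
    have z: "r x $ i = 0" if "x $ i = 0" for i
      using m_le[of i x] m0 that by (simp add: ri)
    then have "{i. convex_seg $ i \<noteq> 0} \<subseteq> {i. x $ i \<noteq> 0}" by (auto simp: that(4))
    then have "{i. convex_seg $ i \<noteq> 0} \<in> K" using x'(3) K cplxD(2) by blast
    moreover have "(\<Sum>i\<in>UNIV. convex_seg $ i) = 1"
      using r'(2) x'(2) by (simp add: that(4) sum.distrib flip: sum_distrib_left)
    moreover have "\<forall>i. 0 \<le> convex_seg $ i" using r'(1) x'(1) that by simp
    ultimately show ?thesis by (simp add: realization_iff[OF K])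
  qed
  have star_iff: "x \<in> realization (star_del \<sigma> K) \<longleftrightarrow> x \<in> realization K \<and> \<not> \<sigma> \<subseteq> {i. x $ i \<noteq> 0}" for x
    unfolding realization_iff[OF cplx_star_del[OF K \<sigma>(2)]] realization_iff[OF K] by (auto simp: star_del_def)
  show ?thesis
  proof (rule homotopy_equivalent_straight_retraction[where r = r])
    show "continuous_on (realization K - {bary \<sigma>}) r"
      unfolding r_def by (intro continuous_intros contm) (use m1 in fastforce)
    show "r ` (realization K - {bary \<sigma>}) \<subseteq> realization (star_del \<sigma> K)"
    proof (intro image_subsetI)
      fix x assume x: "x \<in> realization K - {bary \<sigma>}"
      obtain i where i: "i \<in> \<sigma>" "x $ i = m x" using m_ex by blast
      then have "r x $ i = 0" by (simp add: ri)
      then have "\<not> \<sigma> \<subseteq> {i. r x $ i \<noteq> 0}" using i by blast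
      then show "r x \<in> realization (star_del \<sigma> K)"
        using rK[OF x] unfolding star_iff by blast
    qed
    show "closed_segment (r x) x \<subseteq> realization K - {bary \<sigma>}" if x: "x \<in> realization K - {bary \<sigma>}" for x
    proof
      fix y assume "y \<in> closed_segment (r x) x"
      then obtain s where s: "0 \<le> s" "s \<le> 1" "y = (1 - s) *\<^sub>R r x + s *\<^sub>R x" by (rule closed_segmentE)
      obtain i where i: "i \<in> \<sigma>" "x $ i = m x" using m_ex by blast
      have m0: "0 \<le> m x" using m_ex[of x] x K by (metis DiffD1 realization_iff)
      \<comment> \<open>At the index of the least coordinate on \<open>\<sigma>\<close>, the segment
        stays below the value \<open>1 / k\<close> of the barycenter.\<close>
      have "y $ i = s * m x" using i by (simp add: s ri)
      also have "\<dots> \<le> m x" using s m0 by (simp add: mult_left_le_one_le)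
      also have "\<dots> < 1 / k" using m1[OF x] k by (simp add: field_simps)
      finally have "y \<noteq> bary \<sigma>" using i by (auto simp: bi)
      then show "y \<in> realization K - {bary \<sigma>}" using conv[OF x s] by blast
    qed
    show sub: "realization (star_del \<sigma> K) \<subseteq> realization K - {bary \<sigma>}"
    proof
      fix x assume x: "x \<in> realization (star_del \<sigma> K)"
      have "{i. bary \<sigma> $ i \<noteq> 0} = \<sigma>" using k by (auto simp: bi)
      then have "bary \<sigma> \<notin> realization (star_del \<sigma> K)" unfolding star_iff by blast
      then show "x \<in> realization K - {bary \<sigma>}"
        using x star_iff by auto
    qed
    show "r x = x" if x: "x \<in> realization (star_del \<sigma> K)" for x
    proof -
      have x': "\<forall>i. 0 \<le> x $ i" "\<not> \<sigma> \<subseteq> {i. x $ i \<noteq> 0}"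
        using x unfolding star_iff realization_iff[OF K] by auto
      then obtain i where "i \<in> \<sigma>" "x $ i = 0" by auto
      then have "m x = 0" using m_le[of i x] m_ex[of x] x'(1) by (metis order_antisym)
      then show ?thesis by (simp add: r_def)
    qed
  qed
qed

lemma cplx_Un_Pow:
  assumes "cplx S"
  shows "cplx (S \<union> (\<Union>F\<in>C. Pow F))"
proof -
  have "\<tau> \<in> S \<union> (\<Union>F\<in>C. Pow F)" if \<sigma>: "\<sigma> \<in> S \<union> (\<Union>F\<in>C. Pow F)" and \<tau>: "\<tau> \<subseteq> \<sigma>" for \<sigma> \<tau>
    using \<sigma>
  proof
    assume "\<sigma> \<in> S"
    then show ?thesis using \<tau> cplxD(2)[OF assms] by blast
  next
    assume "\<sigma> \<in> (\<Union>F\<in>C. Pow F)"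
    then show ?thesis using \<tau> by blast
  qed
  then show ?thesis using cplxD(1)[OF assms] unfolding cplx_def by blast
qed

locale sphere =
  fixes \<Delta> :: "'n::finite set set" and d :: nat
  assumes sphere: "simplicial_sphere d \<Delta>" and d_pos: "d > 0"
begin

lemma cplx [simp]: "cplx \<Delta>"
  using sphere by (simp add: simplicial_sphere_def complex_on_vertices_def cplx_def)

lemma vertex [simp]: "{v} \<in> \<Delta>"
  using sphere by (simp add: simplicial_sphere_def complex_on_vertices_def)

lemma complex_dim [simp]: "complex_dim \<Delta> = d"
  using sphere by (simp add: simplicial_sphere_def)

lemma card_le: "\<sigma> \<in> \<Delta> \<Longrightarrow> card \<sigma> \<le> d + 1"
proof -
  assume "\<sigma> \<in> \<Delta>"
  then have "card \<sigma> \<le> Max (card ` \<Delta>)" by (intro Max_ge) auto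
  then show ?thesis using complex_dim unfolding complex_dim_def by linarith
qed

lemma ex_facet: "\<exists>F\<in>\<Delta>. card F = d + 1"
proof -
  have "Max (card ` \<Delta>) \<in> card ` \<Delta>" using cplxD(1)[OF cplx] by (intro Max_in) auto
  moreover have "Max (card ` \<Delta>) = d + 1" using complex_dim d_pos unfolding complex_dim_def by linarith
  ultimately show ?thesis by auto
qed

lemma card_UNIV_gt: "d < CARD('n)"
proof -
  obtain F where "F \<in> \<Delta>" "card F = d + 1" using ex_facet by blast
  then show ?thesis using card_mono[of UNIV F] by simp
qed

lemma red_hom_sphere:
  "red_hom (int d) \<Delta> \<cong> integer_group" "p \<noteq> int d \<Longrightarrow> trivial_group (red_hom p \<Delta>)"
proof -
  have iso: "red_hom p \<Delta> \<cong> reduced_homology_group p (nsphere d)" for p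
    unfolding red_hom_def
    by (rule homeomorphic_space_imp_isomorphic_reduced_homology_groups) (use sphere in \<open>simp add: simplicial_sphere_def\<close>)
  show "red_hom (int d) \<Delta> \<cong> integer_group"
    using iso reduced_homology_group_nsphere(1) iso_trans by blast
  show "trivial_group (red_hom p \<Delta>)" if "p \<noteq> int d"
    using isomorphic_group_triviality[OF iso[of p]] reduced_homology_group_nsphere(2)[OF that] by simp
qed

lemma not_trivial_top: "\<not> trivial_group (red_hom (int d) \<Delta>)"
  using red_hom_sphere(1) isomorphic_group_triviality[OF red_hom_sphere(1)] by simp

lemma acyclic_star_del:
  assumes "\<sigma> \<in> \<Delta>" "\<sigma> \<noteq> {}"
  shows "trivial_group (red_hom p (star_del \<sigma> \<Delta>))"
proof -
  let ?X = "top_of_set (realization \<Delta>)"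
  obtain f where f: "homeomorphic_map ?X (nsphere d) f"
    using sphere unfolding simplicial_sphere_def homeomorphic_space by blast
  have b: "bary \<sigma> \<in> realization \<Delta>" using bary_in_realization assms cplx by blast
  have "f (bary \<sigma>) \<in> topspace (nsphere d)" using f b by (metis homeomorphic_imp_surjective_map imageI topspace_euclidean_subtopology)
  then have con: "contractible_space (subtopology (nsphere d) (- {f (bary \<sigma>)}))"
    by (rule contractible_nsphere_minus_point)
  have img: "f ` (realization \<Delta> - {bary \<sigma>}) = topspace (nsphere d) \<inter> - {f (bary \<sigma>)}"
    using homeomorphic_imp_surjective_map[OF f] homeomorphic_imp_injective_map[OF f] b
    by (auto simp: inj_on_def)
  have "subtopology ?X (realization \<Delta> - {bary \<sigma>}) homeomorphic_space subtopology (nsphere d) (- {f (bary \<sigma>)})"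
    using homeomorphic_map_subtopologies[OF f, of "realization \<Delta> - {bary \<sigma>}" "- {f (bary \<sigma>)}"] img
    by (auto simp: homeomorphic_map_imp_homeomorphic_space Int_absorb1)
  moreover have "subtopology ?X (realization \<Delta> - {bary \<sigma>}) = top_of_set (realization \<Delta> - {bary \<sigma>})"
    by (simp add: subtopology_subtopology Int_absorb1)
  ultimately have "contractible_space (top_of_set (realization \<Delta> - {bary \<sigma>}))"
    using con homeomorphic_space_contractibility by metis
  then have "contractible_space (top_of_set (realization (star_del \<sigma> \<Delta>)))"
    using homotopy_equivalent_star_del[OF cplx assms] homotopy_equivalent_space_contractibility by blast
  then show ?thesis by (simp add: red_hom_def trivial_reduced_homology_group_contractible_space)
qed

text \<open>
  Since the complement of \<open>\<sigma>\<close> is acyclic, the homology of the sphere is concentrated in the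
  dimension of \<open>\<sigma>\<close>.
\<close>

lemma maximal_face_card:
  assumes "\<sigma> \<in> \<Delta>" "\<sigma> \<noteq> {}" and max: "\<And>\<tau>. \<tau> \<in> \<Delta> \<Longrightarrow> \<sigma> \<subseteq> \<tau> \<Longrightarrow> \<tau> = \<sigma>"
  shows "card \<sigma> = d + 1"
proof -
  let ?L = "star_del \<sigma> \<Delta>" and ?p = "int (card \<sigma>) - 1"
  have L: "insert \<sigma> ?L = \<Delta>" "\<sigma> \<notin> ?L" "cplx ?L"
    using assms cplx_star_del[OF cplx assms(2)] by (auto simp: star_del_def)
  \<comment> \<open>A vertex that differs from \<open>\<sigma>\<close> keeps the realization of
    \<open>?L\<close> nonempty, as the exact sequence requires.\<close>
  have "\<exists>w. {w} \<noteq> \<sigma>"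
  proof (rule ccontr)
    assume "\<nexists>w. {w} \<noteq> \<sigma>"
    then have "(UNIV :: 'n set) = \<sigma>" "card \<sigma> = 1" by auto
    then show False using card_UNIV_gt d_pos by simp
  qed
  then obtain w where w: "{w} \<noteq> \<sigma>" by blast
  have "{w} \<in> ?L" using w assms(2) by (auto simp: star_del_def subset_singleton_iff)
  then have ne: "realization ?L \<noteq> {}" using axis_in_realization[OF L(3)] by blast
  have "red_hom ?p \<Delta> \<cong> rel_hom ?p \<Delta> ?L"
    by (rule red_hom_iso_rel_hom) (use ne acyclic_star_del assms in \<open>auto simp: star_del_def\<close>)
  moreover have "rel_hom ?p \<Delta> ?L \<cong> integer_group"
    using rel_hom_insert_integer[of ?L \<sigma>] L by simp
  ultimately have "red_hom ?p \<Delta> \<cong> integer_group" by (rule iso_trans)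
  then have "\<not> trivial_group (red_hom ?p \<Delta>)" using isomorphic_group_triviality by fastforce
  then have "?p = int d" using red_hom_sphere(2) by blast
  then show ?thesis by linarith
qed

definition facets :: "'n set set" where
  "facets = {F \<in> \<Delta>. card F = d + 1}"

lemma pure:
  assumes "\<sigma> \<in> \<Delta>"
  shows "\<exists>F\<in>facets. \<sigma> \<subseteq> F"
proof -
  obtain v :: 'n where True by blast
  \<comment> \<open>Replacing the empty face by a vertex makes sure that the maximal face above it
    is nonempty.\<close>
  define \<sigma>' where "\<sigma>' = (if \<sigma> = {} then {v} else \<sigma>)"
  have \<sigma>': "\<sigma>' \<in> \<Delta>" "\<sigma> \<subseteq> \<sigma>'" "\<sigma>' \<noteq> {}" using assms by (auto simp: \<sigma>'_def)
  obtain F where F: "F \<in> \<Delta>" "\<sigma>' \<subseteq> F" "\<And>\<tau>. \<tau> \<in> \<Delta> \<Longrightarrow> F \<subseteq> \<tau> \<Longrightarrow> F = \<tau>"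
    using finite_has_maximal2[of \<Delta> \<sigma>'] \<sigma>'(1) by auto
  then have "card F = d + 1" using \<sigma>'(3) by (intro maximal_face_card) auto
  then have "F \<in> facets" "\<sigma> \<subseteq> F" using F(1,2) \<sigma>'(2) by (auto simp: facets_def)
  then show ?thesis by blast
qed

lemma euler_sphere: "euler \<Delta> = (- 1) ^ d"
  by (rule euler_sphere_homology) (use red_hom_sphere card_UNIV_gt in auto)

text \<open>The sphere has Euler characteristic \<open>(- 1) ^ d\<close> and the acyclic complex
  \<open>star_del G \<Delta>\<close> has 0. They differ by \<open>G\<close> and the facets over it,
  which count with opposite signs; so the number of these facets minus 1 equals 1.\<close>

lemma ridge_facets:
  assumes "G \<in> \<Delta>" "card G = d"
  shows "card {F \<in> facets. G \<subseteq> F} = 2"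
proof -
  have G: "G \<noteq> {}" using assms d_pos by auto
  obtain w where "w \<notin> G" using assms card_UNIV_gt by (metis UNIV_eq_I less_irrefl)
  then have w: "{w} \<in> star_del G \<Delta>" using G by (auto simp: star_del_def)
  have 0: "euler (star_del G \<Delta>) = 0"
    by (rule euler_acyclic[OF cplx_star_del[OF cplx G] w]) (rule acyclic_star_del[OF assms(1) G])
  have sp: "\<Delta> = star_del G \<Delta> \<union> ({G} \<union> {F \<in> facets. G \<subseteq> F})"
  proof -
    have "card \<tau> = d + 1" if "\<tau> \<in> \<Delta>" "G \<subseteq> \<tau>" "\<tau> \<noteq> G" for \<tau>
    proof -
      have "card G < card \<tau>" using that by (intro psubset_card_mono) auto
      then show ?thesis using card_le[OF that(1)] assms(2) by linarith
    qed
    then show ?thesis using assms(1) by (auto simp: star_del_def facets_def)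
  qed
  have "euler \<Delta> = (\<Sum>\<sigma>\<in>star_del G \<Delta>. (- 1) ^ (card \<sigma> + 1)) + (\<Sum>\<sigma>\<in>{G} \<union> {F \<in> facets. G \<subseteq> F}. (- 1) ^ (card \<sigma> + 1))"
    unfolding euler_def by (subst sp, rule sum.union_disjoint) (auto simp: star_del_def)
  also have "(\<Sum>\<sigma>\<in>{G} \<union> {F \<in> facets. G \<subseteq> F}. (- 1 :: int) ^ (card \<sigma> + 1))
     = (- 1) ^ (d + 1) + (\<Sum>\<sigma>\<in>{F \<in> facets. G \<subseteq> F}. (- 1) ^ (card \<sigma> + 1))"
    using assms(2) by (subst sum.union_disjoint) (auto simp: facets_def)
  also have "(\<Sum>\<sigma>\<in>{F \<in> facets. G \<subseteq> F}. (- 1 :: int) ^ (card \<sigma> + 1)) = int (card {F \<in> facets. G \<subseteq> F}) * (- 1) ^ d"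
    by (simp add: facets_def)
  finally have "(- 1 :: int) ^ d * 1 = (- 1) ^ d * (int (card {F \<in> facets. G \<subseteq> F}) - 1)"
    using 0 euler_sphere by (simp add: euler_def algebra_simps)
  then have "int (card {F \<in> facets. G \<subseteq> F}) - 1 = 1" by simp
  then show ?thesis by linarith
qed

text \<open>
  Otherwise the sphere is the union of two proper subcomplexes, without top homology, whose
  intersection consists of the star of \<open>v\<close> and faces of codimension at least two; hence it has no
  homology in degree \<open>d - 1\<close>, and the sphere would have no top homology either.
\<close>

lemma antistar_connected:
  assumes C: "C \<subseteq> {F \<in> facets. v \<notin> F}" "C \<noteq> {}"
    and adj: "\<And>F F'. F \<in> C \<Longrightarrow> F' \<in> facets \<Longrightarrow> v \<notin> F' \<Longrightarrow> card (F \<inter> F') = d \<Longrightarrow> F' \<in> C"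
  shows "C = {F \<in> facets. v \<notin> F}"
proof (rule ccontr)
  assume ne: "C \<noteq> {F \<in> facets. v \<notin> F}"
  define D where "D = {F \<in> facets. v \<notin> F} - C"
  obtain F1 F2 where F12: "F1 \<in> C" "F2 \<in> D" using C ne by (auto simp: D_def)
  \<comment> \<open>The closed star of \<open>v\<close>. Facets containing \<open>v\<close> are in
    it and the others belong to \<open>C\<close> or \<open>D\<close>, so \<open>Y1\<close> and
    \<open>Y2\<close> cover the sphere.\<close>
  define S where "S = {\<sigma> \<in> \<Delta>. insert v \<sigma> \<in> \<Delta>}"
  define Y1 where "Y1 = S \<union> (\<Union>F\<in>C. Pow F)"
  define Y2 where "Y2 = S \<union> (\<Union>F\<in>D. Pow F)"
  have f\<Delta>: "F \<in> \<Delta>" "card F = d + 1" if "F \<in> facets" for F using that by (auto simp: facets_def)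
  have CD: "C \<subseteq> facets" "D \<subseteq> facets" "C \<inter> D = {}" using C by (auto simp: D_def)
  have cS: "cplx S" unfolding cplx_def S_def
    using cplxD[OF cplx] by auto (meson insert_mono)
  have v: "{v} \<in> S" by (simp add: S_def)
  have c1: "cplx Y1" and c2: "cplx Y2" unfolding Y1_def Y2_def using cS by (auto intro: cplx_Un_Pow)
  have "\<sigma> \<in> \<Delta>" if "F \<in> facets" "\<sigma> \<subseteq> F" for F \<sigma>
    using that f\<Delta>(1) cplxD(2)[OF cplx] by blast
  then have sub: "Y1 \<subseteq> \<Delta>" "Y2 \<subseteq> \<Delta>"
    using CD(1,2) unfolding Y1_def Y2_def S_def by blast+
  have un: "Y1 \<union> Y2 = \<Delta>"
  proof
    show "\<Delta> \<subseteq> Y1 \<union> Y2"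
    proof
      fix \<sigma> assume "\<sigma> \<in> \<Delta>"
      then obtain F where F: "F \<in> facets" "\<sigma> \<subseteq> F" using pure by blast
      show "\<sigma> \<in> Y1 \<union> Y2"
      proof (cases "v \<in> F")
        case True
        then have "insert v \<sigma> \<in> \<Delta>" using F f\<Delta> cplxD(2)[OF cplx] by (metis insert_subset)
        then show ?thesis using \<open>\<sigma> \<in> \<Delta>\<close> by (simp add: Y1_def S_def)
      next
        case False
        then show ?thesis using F by (auto simp: Y1_def Y2_def D_def)
      qed
    qed
  qed (use sub in auto)
  have facet_eq: "F = F'" if "F \<in> facets" "F' \<in> facets" "F \<subseteq> F'" for F F'
    using that f\<Delta> by (intro card_subset_eq) auto
  have notS: "F \<notin> S" if "F \<in> facets" "v \<notin> F" for F
    using that f\<Delta>[OF that(1)] card_le[of "insert v F"] by (auto simp: S_def)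
  have F2: "F2 \<notin> Y1" and F1: "F1 \<notin> Y2"
    using F12 notS facet_eq CD C by (auto simp: Y1_def Y2_def D_def)
  \<comment> \<open>A common face outside the star lies in a facet of \<open>C\<close> and in one of
    \<open>D\<close>, whose intersection is not a ridge by \<open>adj\<close>.\<close>
  have small: "card \<sigma> < d" if \<sigma>: "\<sigma> \<in> Y1 \<inter> Y2 - S" for \<sigma>
  proof -
    obtain F F' where F: "F \<in> C" "F' \<in> D" "\<sigma> \<subseteq> F" "\<sigma> \<subseteq> F'" using \<sigma> by (auto simp: Y1_def Y2_def)
    then have FF: "F \<in> facets" "F' \<in> facets" "v \<notin> F'" "F' \<notin> C" using C by (auto simp: D_def)
    have "F \<inter> F' \<noteq> F" using facet_eq FF F by blast
    then have "card (F \<inter> F') < d + 1" using f\<Delta>(2)[OF FF(1)] psubset_card_mono[of F "F \<inter> F'"] by auto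
    moreover have "card (F \<inter> F') \<noteq> d" using adj F FF by blast
    moreover have "card \<sigma> \<le> card (F \<inter> F')" using F by (intro card_mono) auto
    ultimately show ?thesis by linarith
  qed
  let ?Z = "Y1 \<inter> Y2"
  have cZ: "cplx ?Z" using c1 c2 by (rule cplx_Int)
  have SZ: "S \<subseteq> ?Z" by (auto simp: Y1_def Y2_def)
  have neZ: "realization ?Z \<noteq> {}" using axis_in_realization[OF cZ, of "{v}" v] SZ v by auto
  have "trivial_group (red_hom (int d - 1) S)"
    by (intro contractible_imp_trivial_red_hom contractible_cone[OF cS, of v]) (auto simp: S_def)
  then have Z: "trivial_group (red_hom (int d - 1) ?Z)"
    by (rule red_hom_trivial_extension[OF cS cZ SZ]) (use small in fastforce)
  \<comment> \<open>A subcomplex missing a facet \<open>F\<close> lies in the acyclic complex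
    \<open>star_del F \<Delta>\<close>, and without faces of cardinality \<open>d + 2\<close> the
    passage to it creates no class in degree \<open>d\<close>.\<close>
  have top: "trivial_group (red_hom (int d) Y)" if Y: "cplx Y" "Y \<subseteq> \<Delta>" "F \<in> facets" "F \<notin> Y" for Y F
  proof -
    have F: "F \<in> \<Delta>" "F \<noteq> {}" using f\<Delta>[OF Y(3)] by auto
    have "Y \<subseteq> star_del F \<Delta>" using Y cplxD(2)[OF Y(1)] by (auto simp: star_del_def)
    then show ?thesis
    proof (rule red_hom_trivial_restriction[OF Y(1) cplx_star_del[OF cplx F(2)] _ acyclic_star_del[OF F]])
      show "int (card \<sigma>) \<noteq> int d + 2" if "\<sigma> \<in> star_del F \<Delta> - Y" for \<sigma>
        using that card_le[of \<sigma>] by (auto simp: star_del_def)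
    qed
  qed
  \<comment> \<open>A Mayer-Vietoris argument in terms of pairs: excision identifies
    \<open>Y1\<close> modulo \<open>?Z\<close> with the sphere modulo \<open>Y2\<close>.\<close>
  have "trivial_group (rel_hom (int d) Y1 ?Z)"
    by (rule rel_hom_trivial[OF _ neZ _ Z]) (use top[OF c1 sub(1) _ F2] F12 CD in auto)
  then have "trivial_group (rel_hom (int d) \<Delta> Y2)"
    using isomorphic_group_triviality[OF rel_hom_excision[OF c2 c1, of "int d"]] un by simp
  then have "trivial_group (red_hom (int d) \<Delta>)"
    using red_hom_trivial_up[OF sub(2) top[OF c2 sub(2) _ F1]] F12 CD by auto
  then show False using not_trivial_top by simp
qed

section \<open>Crossing ridges\<close>

lemma facetsD: "F \<in> facets \<Longrightarrow> F \<in> \<Delta>" "F \<in> facets \<Longrightarrow> card F = d + 1"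
  by (auto simp: facets_def)

text \<open>The new facet is the second one over the ridge \<open>F - {v}\<close>.\<close>

lemma facet_swap:
  assumes "F \<in> facets" "v \<in> F"
  obtains b where "b \<notin> F" "insert b (F - {v}) \<in> facets" "card (F \<inter> insert b (F - {v})) = d"
proof -
  let ?G = "F - {v}"
  have G: "?G \<in> \<Delta>" "card ?G = d"
    using assms facetsD[OF assms(1)] cplxD(2)[OF cplx, of F ?G] by auto
  have "\<not> {F' \<in> facets. ?G \<subseteq> F'} \<subseteq> {F}"
  proof
    assume "{F' \<in> facets. ?G \<subseteq> F'} \<subseteq> {F}"
    then have "card {F' \<in> facets. ?G \<subseteq> F'} \<le> card {F}" by (intro card_mono) auto
    then show False using ridge_facets[OF G] by simp
  qed
  then obtain F' where F': "F' \<in> facets" "?G \<subseteq> F'" "F' \<noteq> F" by blast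
  have "card (F' - ?G) = 1" using F' G facetsD(2)[OF F'(1)] by (simp add: card_Diff_subset)
  then obtain b where b: "F' - ?G = {b}" by (auto simp: card_1_singleton_iff)
  then have eq: "F' = insert b ?G" using F'(2) by blast
  have "b \<noteq> v" using eq F'(3) assms(2) by blast
  then have "b \<notin> F" using b by blast
  then have "F \<inter> insert b ?G = ?G" by blast
  then show thesis using that[of b] F'(1) eq \<open>b \<notin> F\<close> G by simp
qed

lemma facet_avoiding:
  assumes "w \<noteq> v"
  obtains F where "F \<in> facets" "w \<in> F" "v \<notin> F"
proof -
  obtain F where F: "F \<in> facets" "w \<in> F" using pure[OF vertex[of w]] by auto
  show thesis
  proof (cases "v \<in> F")
    case True
    obtain b where "b \<notin> F" "insert b (F - {v}) \<in> facets" using facet_swap[OF F(1) True] by blast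
    then show thesis using that[of "insert b (F - {v})"] F True assms by auto
  qed (use F that in blast)
qed

text \<open>For \<open>v\<close> in \<open>F1\<close> but not in \<open>F2\<close>, crossing the
  ridge of \<open>F1\<close> opposite to \<open>v\<close> leads to a facet avoiding
  \<open>v\<close>, and from there \<open>antistar_connected\<close> reaches
  \<open>F2\<close>.\<close>

lemma facets_connected:
  assumes C: "C \<subseteq> facets" "C \<noteq> {}"
    and adj: "\<And>F F'. F \<in> C \<Longrightarrow> F' \<in> facets \<Longrightarrow> card (F \<inter> F') = d \<Longrightarrow> F' \<in> C"
  shows "C = facets"
proof
  obtain F1 where F1: "F1 \<in> C" using C by blast
  show "facets \<subseteq> C"
  proof
    fix F2 assume F2: "F2 \<in> facets"
    show "F2 \<in> C"
    proof (cases "F1 = F2")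
      case False
      then have "\<not> F1 \<subseteq> F2" using F1 F2 C facetsD(2) card_subset_eq[of F2 F1] by auto
      then obtain v where v: "v \<in> F1" "v \<notin> F2" by blast
      obtain b where b: "b \<notin> F1" "insert b (F1 - {v}) \<in> facets" "card (F1 \<inter> insert b (F1 - {v})) = d"
        using facet_swap v F1 C by blast
      then have "insert b (F1 - {v}) \<in> C" using adj F1 by blast
      then have "insert b (F1 - {v}) \<in> {F \<in> C. v \<notin> F}" using b v by auto
      then have "{F \<in> C. v \<notin> F} = {F \<in> facets. v \<notin> F}"
        using C adj by (intro antistar_connected) auto
      then show ?thesis using F2 v by blast
    qed (use F1 in simp)
  qed
qed (use C in simp)

lemma facets_ridges_count: "(d + 1) * card facets = 2 * card {G \<in> \<Delta>. card G = d}"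
proof -
  let ?R = "{G \<in> \<Delta>. card G = d}"
  have "(\<Sum>F\<in>facets. card {G \<in> ?R. G \<subseteq> F}) = (\<Sum>G\<in>?R. card {F \<in> facets. G \<subseteq> F})"
    by (rule sum_multicount_gen) auto
  also have "\<dots> = 2 * card ?R" using ridge_facets by simp
  also have "(\<Sum>F\<in>facets. card {G \<in> ?R. G \<subseteq> F}) = (\<Sum>F\<in>facets. d + 1)"
  proof (rule sum.cong[OF refl])
    fix F assume F: "F \<in> facets"
    have "{G \<in> ?R. G \<subseteq> F} = {G. G \<subseteq> F \<and> card G = d}"
      using facetsD(1)[OF F] cplxD(2)[OF cplx] by auto
    then show "card {G \<in> ?R. G \<subseteq> F} = d + 1" using n_subsets[of F d] facetsD(2)[OF F] by simp
  qed
  finally show ?thesis by (simp add: mult.commute)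
qed

end

section \<open>Polynomials and Hilbert functions\<close>

abbreviation lookup where "lookup \<equiv> Poly_Mapping.lookup"
abbreviation keys where "keys \<equiv> Poly_Mapping.keys"
abbreviation single where "single \<equiv> Poly_Mapping.single"

lemma mpoly_induct [case_names single add]:
  assumes s: "\<And>m c. P (single m c)" and a: "\<And>p q. P p \<Longrightarrow> P q \<Longrightarrow> P (p + q)"
  shows "P (p :: 'a \<Rightarrow>\<^sub>0 'b::comm_monoid_add)"
proof -
  have P0: "P 0" using s[of undefined 0] by simp
  have "P (\<Sum>m\<in>A. single m (lookup p m))" if "finite A" for A
    using that by (induction A) (auto simp: P0 s a)
  moreover have "p = (\<Sum>m\<in>keys p. single m (lookup p m))"
    by (rule poly_mapping_eqI) (auto simp: lookup_sum lookup_single when_def in_keys_iff)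
  ultimately show ?thesis by (metis finite_keys)
qed

lemma mon_deg_zero [simp]: "mon_deg 0 = 0"
  and mon_deg_add: "mon_deg (m + m') = mon_deg m + mon_deg m'"
  by (simp_all add: mon_deg_def lookup_add sum.distrib)

lemma mon_deg_single [simp]: "mon_deg (single i k) = k"
  by (simp add: mon_deg_def lookup_single when_def)

lemma mon_deg_eq_0_iff: "mon_deg m = 0 \<longleftrightarrow> m = 0"
proof
  assume "mon_deg m = 0"
  then have "\<forall>i. lookup m i = 0" by (simp add: mon_deg_def)
  then show "m = 0" by (intro poly_mapping_eqI) simp
qed simp

lemma keys_add_nat: "keys (m + m' :: 'n \<Rightarrow>\<^sub>0 nat) = keys m \<union> keys m'"
  by (auto simp: in_keys_iff lookup_add)

lemma diff_single_add:
  fixes m :: "'n \<Rightarrow>\<^sub>0 nat"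
  assumes "k \<le> lookup m i"
  shows "(m - single i k) + single i k = m"
  using assms by (intro poly_mapping_eqI) (auto simp: lookup_add lookup_minus lookup_single when_def)

lemma mon_deg_eq_1_iff: "mon_deg m = 1 \<longleftrightarrow> (\<exists>i. m = single i 1)"
proof
  assume *: "mon_deg m = 1"
  then have "m \<noteq> 0" by auto
  then obtain i where "lookup m i \<noteq> 0" by (metis poly_mapping_eqI lookup_zero)
  then have m: "(m - single i 1) + single i 1 = m" by (intro diff_single_add) auto
  then have "mon_deg (m - single i 1) = 0"
    using * mon_deg_add[of "m - single i 1" "single i 1"] by simp
  then show "\<exists>i. m = single i 1" using m by (auto simp: mon_deg_eq_0_iff)
qed auto

lemma lookup_scal: "lookup (scal c p) m = c * lookup p m"
  unfolding scal_def mult_map_scale_conv_mult[symmetric] by (simp add: Poly_Mapping.map.rep_eq when_def)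

interpretation mpoly: vector_space "scal :: 'k::field \<Rightarrow> ('n, 'k) mpoly \<Rightarrow> ('n, 'k) mpoly"
  by (rule vector_space_scal)

interpretation mpoly_ideal: Modules.module "(*) :: ('n, 'k::field) mpoly \<Rightarrow> ('n, 'k) mpoly \<Rightarrow> ('n, 'k) mpoly"
  by (rule Defs.module_mult)

lemma ideal_gen_superset: "f \<in> S \<Longrightarrow> f \<in> ideal_gen S"
  and ideal_gen_zero: "0 \<in> ideal_gen S"
  and ideal_gen_add: "f \<in> ideal_gen S \<Longrightarrow> g \<in> ideal_gen S \<Longrightarrow> f + g \<in> ideal_gen S"
  and ideal_gen_diff: "f \<in> ideal_gen S \<Longrightarrow> g \<in> ideal_gen S \<Longrightarrow> f - g \<in> ideal_gen S"
  and ideal_gen_mult: "f \<in> ideal_gen S \<Longrightarrow> a * f \<in> ideal_gen S"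
  and ideal_gen_sum: "(\<And>x. x \<in> X \<Longrightarrow> h x \<in> ideal_gen S) \<Longrightarrow> sum h X \<in> ideal_gen S"
  unfolding ideal_gen_def
  by (auto intro: mpoly_ideal.span_base mpoly_ideal.span_zero mpoly_ideal.span_add mpoly_ideal.span_diff
      mpoly_ideal.span_scale mpoly_ideal.span_sum)

lemma ideal_gen_induct [consumes 1, case_names zero add mult base]:
  assumes "f \<in> ideal_gen S" "P 0" "\<And>f g. P f \<Longrightarrow> P g \<Longrightarrow> P (f + g)" "\<And>a f. P f \<Longrightarrow> P (a * f)" "\<And>f. f \<in> S \<Longrightarrow> P f"
  shows "P f"
  using assms(1) unfolding ideal_gen_def
proof (rule mpoly_ideal.span_induct)
  show "mpoly_ideal.subspace (Collect P)"
    by (rule mpoly_ideal.subspaceI) (use assms in auto)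
qed (use assms in auto)

lemma ideal_gen_insert_family:
  assumes "f \<in> ideal_gen (ideal_gen S \<union> \<theta> ` I)" "finite I"
  shows "\<exists>g\<in>ideal_gen S. \<exists>a. f = g + (\<Sum>i\<in>I. a i * \<theta> i)"
  using assms(1)
proof (induction rule: ideal_gen_induct)
  case zero
  show ?case by (rule bexI[of _ 0], rule exI[of _ "\<lambda>_. 0"]) (auto simp: ideal_gen_zero)
next
  case (add f f')
  then obtain g a g' a' where "g \<in> ideal_gen S" "g' \<in> ideal_gen S" "f = g + (\<Sum>i\<in>I. a i * \<theta> i)"
     "f' = g' + (\<Sum>i\<in>I. a' i * \<theta> i)" by blast
  then show ?case
    by (intro bexI[of _ "g + g'"] exI[of _ "\<lambda>i. a i + a' i"]) (simp_all add: sum.distrib distrib_right add_ac ideal_gen_add)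
next
  case (mult b f)
  then obtain g a where g: "g \<in> ideal_gen S" and f: "f = g + (\<Sum>i\<in>I. a i * \<theta> i)" by blast
  have eq: "b * f = b * g + (\<Sum>i\<in>I. (b * a i) * \<theta> i)"
    unfolding f distrib_left sum_distrib_left mult.assoc ..
  show ?case
    by (rule bexI[OF _ ideal_gen_mult[OF g, of b]], rule exI[of _ "\<lambda>i. b * a i"], rule eq)
next
  case (base f)
  then show ?case
  proof
    assume "f \<in> ideal_gen S"
    then show ?thesis by (intro bexI[of _ f] exI[of _ "\<lambda>_. 0"]) auto
  next
    assume "f \<in> \<theta> ` I"
    then obtain j where j: "j \<in> I" "f = \<theta> j" by auto
    have "(\<Sum>i\<in>I. (if i = j then 1 else 0) * \<theta> i) = (\<Sum>i\<in>I. if i = j then \<theta> i else 0)"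
      by (rule sum.cong) auto
    also have "\<dots> = \<theta> j" using j assms(2) by simp
    finally show ?thesis using j
      by (intro bexI[of _ 0] exI[of _ "\<lambda>i. if i = j then 1 else 0"]) (auto simp: ideal_gen_zero)
  qed
qed

section \<open>Monomial ideals and their Hilbert functions\<close>

definition mon_ideal :: "('n \<Rightarrow>\<^sub>0 nat) set \<Rightarrow> ('n, 'k::field) mpoly set" where
  "mon_ideal M = {f. keys f \<subseteq> M}"

definition mon_closed :: "('n \<Rightarrow>\<^sub>0 nat) set \<Rightarrow> bool" where
  "mon_closed M \<longleftrightarrow> (\<forall>m\<in>M. \<forall>m'. m' + m \<in> M)"

lemma ideal_gen_subset_mon_ideal:
  assumes "mon_closed M" "\<And>f. f \<in> S \<Longrightarrow> f \<in> mon_ideal M"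
  shows "ideal_gen S \<subseteq> mon_ideal M"
proof
  fix f assume "f \<in> ideal_gen S"
  then show "f \<in> mon_ideal M"
  proof (induction rule: ideal_gen_induct)
    case (add f g)
    then show ?case using Poly_Mapping.keys_add[of f g] by (auto simp: mon_ideal_def)
  next
    case (mult a f)
    then show ?case using keys_mult[of a f] assms(1) by (auto simp: mon_ideal_def mon_closed_def)
  qed (use assms in \<open>auto simp: mon_ideal_def\<close>)
qed

lemma mon_ideal_subset_ideal_gen:
  fixes S :: "('n, 'k::field) mpoly set"
  assumes "\<And>m. m \<in> M \<Longrightarrow> single m 1 \<in> ideal_gen S"
  shows "mon_ideal M \<subseteq> ideal_gen S"
proof
  fix f :: "('n, 'k) mpoly" assume f: "f \<in> mon_ideal M"
  have "f = (\<Sum>m\<in>keys f. single m (lookup f m))"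
    by (rule poly_mapping_eqI) (auto simp: lookup_sum lookup_single when_def in_keys_iff)
  also have "\<dots> = (\<Sum>m\<in>keys f. single 0 (lookup f m) * single m 1)"
    by (simp add: mult_single)
  also have "\<dots> \<in> ideal_gen S"
    using f assms by (intro ideal_gen_sum ideal_gen_mult) (auto simp: mon_ideal_def)
  finally show "f \<in> ideal_gen S" .
qed

text \<open>The projection onto the monomials outside \<open>M\<close>, with kernel
  \<open>mon_ideal M\<close>. It turns bases modulo the ideal into bases of a span.\<close>

definition mon_restrict :: "('n \<Rightarrow>\<^sub>0 nat) set \<Rightarrow> ('n, 'k::field) mpoly \<Rightarrow> ('n, 'k) mpoly" where
  "mon_restrict M f = Poly_Mapping.mapp (\<lambda>m c. if m \<in> M then 0 else c) f"

lemma lookup_mon_restrict: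
  "lookup (mon_restrict M f) m = (if m \<in> M then 0 else lookup f m)"
  by (auto simp: mon_restrict_def lookup_mapp when_def in_keys_iff)

lemma mon_restrict_eq_0_iff: "mon_restrict M f = 0 \<longleftrightarrow> f \<in> mon_ideal M"
  by (auto simp: poly_mapping_eq_iff fun_eq_iff lookup_mon_restrict mon_ideal_def in_keys_iff)

lemma linear_mon_restrict: "Vector_Spaces.linear scal scal (mon_restrict M)"
  by unfold_locales
    (auto intro!: poly_mapping_eqI simp: lookup_mon_restrict lookup_add lookup_scal distrib_left distrib_right)

definition std_monomials :: "int \<Rightarrow> ('n::finite \<Rightarrow>\<^sub>0 nat) set \<Rightarrow> ('n \<Rightarrow>\<^sub>0 nat) set" where
  "std_monomials i M = {m. int (mon_deg m) = i \<and> m \<notin> M}"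

lemma independent_monomials:
  "mpoly.independent ((\<lambda>m. single m (1::'k::field)) ` A)"
proof -
  have "u v = 0" if t: "finite t" "t \<subseteq> (\<lambda>m. single m (1::'k)) ` A" and z: "(\<Sum>v\<in>t. scal (u v) v) = 0"
    and v: "v \<in> t" for t u v
  proof -
    obtain m where m: "v = single m 1" using t v by auto
    have "0 = lookup (\<Sum>v\<in>t. scal (u v) v) m" by (simp add: z)
    also have "\<dots> = (\<Sum>w\<in>t. u w * lookup w m)" by (simp add: lookup_sum lookup_scal)
    also have "\<dots> = (\<Sum>w\<in>t. if w = v then u w else 0)"
    proof (rule sum.cong[OF refl])
      fix w assume "w \<in> t"
      then obtain m' where m': "w = single m' 1" using t(2) by auto
      show "u w * lookup w m = (if w = v then u w else 0)"
      proof (cases "m = m'")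
        case False
        then have "lookup w m = 0" "lookup v m = 1"
          by (simp_all add: m m' lookup_single when_def)
        then show ?thesis by auto
      qed (simp add: m m')
    qed
    also have "\<dots> = u v" using t v by simp
    finally show ?thesis by simp
  qed
  then show ?thesis unfolding mpoly.dependent_explicit by blast
qed

lemma span_monomials:
  assumes "keys f \<subseteq> A"
  shows "f \<in> mpoly.span ((\<lambda>m. single m (1::'k::field)) ` A)"
proof -
  have "f = (\<Sum>m\<in>keys f. scal (lookup f m) (single m 1))"
    by (rule poly_mapping_eqI) (auto simp: lookup_sum lookup_scal lookup_single when_def in_keys_iff if_distrib cong: if_cong)
  also have "\<dots> \<in> mpoly.span ((\<lambda>m. single m (1::'k)) ` A)"
    using assms by (intro mpoly.span_sum mpoly.span_scale mpoly.span_base) auto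
  finally show ?thesis .
qed

text \<open>Since \<open>dim_mod\<close> chooses an arbitrary basis, every one must have this
  cardinality: \<open>mon_restrict M\<close> maps it injectively onto a basis of the span of the
  standard monomials.\<close>

lemma HF_mon_ideal:
  "HF i (mon_ideal M :: ('n::finite, 'k::field) mpoly set) = card (std_monomials i M)"
proof -
  let ?W = "mon_ideal M :: ('n, 'k) mpoly set" and ?U = "graded_piece i :: ('n, 'k) mpoly set"
  let ?s = "\<lambda>m :: 'n \<Rightarrow>\<^sub>0 nat. single m (1::'k)"
  let ?B0 = "?s ` std_monomials i M"
  let ?\<pi> = "mon_restrict M :: ('n, 'k) mpoly \<Rightarrow> _"
  interpret \<pi>: Vector_Spaces.linear scal scal ?\<pi> by (rule linear_mon_restrict)
  have \<pi>s: "?\<pi> (?s m) = ?s m" if "m \<in> std_monomials i M" for m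
    using that by (intro poly_mapping_eqI) (auto simp: lookup_mon_restrict lookup_single when_def std_monomials_def)
  have \<pi>W: "?\<pi> f = 0 \<longleftrightarrow> f \<in> ?W" for f by (rule mon_restrict_eq_0_iff)
  have \<pi>U: "?\<pi> f \<in> mpoly.span ?B0" if "f \<in> ?U" for f
  proof (rule span_monomials)
    show "keys (?\<pi> f) \<subseteq> std_monomials i M"
      using that by (auto simp: in_keys_iff lookup_mon_restrict std_monomials_def graded_piece_def split: if_splits)
  qed
  have B0: "basis_mod ?U ?W ?B0"
    unfolding basis_mod_def
  proof (intro conjI allI impI)
    show "?B0 \<subseteq> ?U" by (auto simp: graded_piece_def std_monomials_def)
    show "?U \<subseteq> lin_span (?B0 \<union> ?W)"
    proof
      fix f assume f: "f \<in> ?U"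
      have "?\<pi> (f - ?\<pi> f) = 0"
        by (rule poly_mapping_eqI) (simp add: lookup_mon_restrict lookup_minus)
      then have "f - ?\<pi> f \<in> mpoly.span (?B0 \<union> ?W)"
        unfolding \<pi>W by (intro mpoly.span_base) auto
      moreover have "?\<pi> f \<in> mpoly.span (?B0 \<union> ?W)" using \<pi>U[OF f] mpoly.span_mono[of ?B0 "?B0 \<union> ?W"] by auto
      ultimately have "(f - ?\<pi> f) + ?\<pi> f \<in> mpoly.span (?B0 \<union> ?W)" by (rule mpoly.span_add)
      then show "f \<in> lin_span (?B0 \<union> ?W)" by (simp add: lin_span_def)
    qed
    fix S c assume S: "finite S \<and> S \<subseteq> ?B0 \<and> (\<Sum>b\<in>S. scal (c b) b) \<in> ?W"
    have "0 = ?\<pi> (\<Sum>b\<in>S. scal (c b) b)" using S \<pi>W by simp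
    also have "\<dots> = (\<Sum>b\<in>S. scal (c b) b)"
      using S \<pi>s by (auto simp: \<pi>.sum \<pi>.scale intro!: sum.cong)
    finally have "(\<Sum>b\<in>S. scal (c b) b) = 0" by simp
    then show "\<forall>b\<in>S. c b = 0"
      using mpoly.independentD[OF independent_monomials, of S "std_monomials i M"] S by blast
  qed
  have "card B = card (std_monomials i M)" if B: "basis_mod ?U ?W B" for B
  proof -
    have BU: "B \<subseteq> ?U" and sp: "?U \<subseteq> mpoly.span (B \<union> ?W)"
      using B by (simp_all add: basis_mod_def lin_span_def)
    have ind: "\<forall>b\<in>S. c b = 0" if "finite S" "S \<subseteq> B" "(\<Sum>b\<in>S. scal (c b) b) \<in> ?W" for S c
      using B that by (simp add: basis_mod_def)
    have inj: "inj_on ?\<pi> B"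
    proof (rule inj_onI, rule ccontr)
      fix b b' assume b: "b \<in> B" "b' \<in> B" "?\<pi> b = ?\<pi> b'" "b \<noteq> b'"
      have "?\<pi> (b - b') = 0" using b by (simp add: \<pi>.diff)
      then have "(\<Sum>x\<in>{b, b'}. scal (if x = b then 1 else - 1) x) \<in> ?W"
        using b(4) unfolding \<pi>W by simp
      then show False using ind[of "{b, b'}" "\<lambda>x. if x = b then 1 else - 1"] b by auto
    qed
    have indep: "mpoly.independent (?\<pi> ` B)"
      unfolding mpoly.dependent_explicit
    proof safe
      fix t u v assume t: "finite t" "t \<subseteq> ?\<pi> ` B" "(\<Sum>v\<in>t. scal (u v) v) = 0" "v \<in> t" "u v \<noteq> 0"
      obtain S where S: "S \<subseteq> B" "t = ?\<pi> ` S" "finite S" using finite_subset_image[OF t(1,2)] by blast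
      have "(\<Sum>v\<in>t. scal (u v) v) = (\<Sum>b\<in>S. scal (u (?\<pi> b)) (?\<pi> b))"
        unfolding S(2) using inj S(1) by (subst sum.reindex) (auto intro: inj_on_subset)
      then have "?\<pi> (\<Sum>b\<in>S. scal (u (?\<pi> b)) b) = 0" using t(3) by (simp add: \<pi>.sum \<pi>.scale)
      then have "\<forall>b\<in>S. u (?\<pi> b) = 0"
        unfolding \<pi>W by (rule ind[OF S(3,1)])
      moreover obtain b where "b \<in> S" "v = ?\<pi> b" using t(4) unfolding S(2) by (rule imageE)
      ultimately show False using t(5) by simp
    qed
    have "mpoly.span (?\<pi> ` B) = mpoly.span ?B0"
    proof
      show "mpoly.span (?\<pi> ` B) \<subseteq> mpoly.span ?B0"
        using BU \<pi>U by (intro mpoly.span_minimal mpoly.subspace_span) auto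
      have "?s m \<in> mpoly.span (?\<pi> ` B)" if m: "m \<in> std_monomials i M" for m
      proof -
        have "?s m \<in> ?U" using m by (auto simp: graded_piece_def std_monomials_def)
        then have "?\<pi> (?s m) \<in> ?\<pi> ` mpoly.span (B \<union> ?W)" using sp by blast
        also have "\<dots> = mpoly.span (?\<pi> ` (B \<union> ?W))" by (rule \<pi>.span_image[symmetric])
        also have "\<dots> \<subseteq> mpoly.span (?\<pi> ` B)"
        proof (intro mpoly.span_minimal mpoly.subspace_span image_subsetI)
          fix x assume "x \<in> B \<union> ?W"
          then show "?\<pi> x \<in> mpoly.span (?\<pi> ` B)"
            using \<pi>W[of x] mpoly.span_zero by (auto intro: mpoly.span_base)
        qed
        finally show ?thesis using \<pi>s[OF m] by simp
      qed
      then show "mpoly.span ?B0 \<subseteq> mpoly.span (?\<pi> ` B)"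
        by (intro mpoly.span_minimal mpoly.subspace_span) auto
    qed
    then obtain f where "bij_betw f (?\<pi> ` B) ?B0"
      using mpoly.bij_if_span_eq_span_bases[OF indep independent_monomials] by blast
    then have "card (?\<pi> ` B) = card ?B0" by (rule bij_betw_same_card)
    moreover have "inj ?s"
    proof (rule injI)
      fix m m' :: "'n \<Rightarrow>\<^sub>0 nat" assume "?s m = ?s m'"
      then have "keys (?s m) = keys (?s m')" by simp
      then show "m = m'" by simp
    qed
    then have "card ?B0 = card (std_monomials i M)" by (intro card_image) (auto intro: inj_on_subset)
    ultimately show ?thesis using card_image[OF inj] by simp
  qed
  then show ?thesis unfolding HF_def dim_mod_def using someI[of "basis_mod ?U ?W", OF B0] by blast
qed

section \<open>The colored system of parameters\<close>

definition sqfree :: "'n::finite set \<Rightarrow> 'n \<Rightarrow>\<^sub>0 nat" where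
  "sqfree \<sigma> = (\<Sum>i\<in>\<sigma>. single i 1)"

lemma lookup_sqfree: "lookup (sqfree \<sigma>) i = (if i \<in> \<sigma> then 1 else 0)"
  by (simp add: sqfree_def lookup_sum lookup_single when_def)

lemma keys_sqfree [simp]: "keys (sqfree \<sigma>) = \<sigma>"
  by (auto simp: in_keys_iff lookup_sqfree split: if_splits)

lemma mon_deg_sqfree [simp]: "mon_deg (sqfree \<sigma>) = card \<sigma>"
  by (simp add: mon_deg_def lookup_sqfree sum.If_cases)

lemma prod_var: "(\<Prod>i\<in>\<sigma>. var i :: ('n::finite, 'k::field) mpoly) = single (sqfree \<sigma>) 1"
  using finite[of \<sigma>] by induction (auto simp: sqfree_def var_def mult_single)

lemma var_power2: "(var i :: ('n::finite, 'k::field) mpoly)\<^sup>2 = single (single i 2) 1"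
proof -
  have "single i (1::nat) + single i 1 = single i 2"
    by (simp flip: single_add add: numeral_2_eq_2)
  then show ?thesis by (simp add: power2_eq_square var_def mult_single)
qed

lemma single_one_factor:
  "single (m + m') (1::'k::field) = single m 1 * single m' 1"
  by (simp add: mult_single)

lemma stanley_reisner_eq:
  assumes "cplx (\<Delta> :: 'n::finite set set)"
  shows "stanley_reisner \<Delta> = (mon_ideal {m. keys m \<notin> \<Delta>} :: ('n, 'k::field) mpoly set)"
  unfolding stanley_reisner_def
proof
  let ?S = "{\<Prod>i\<in>\<sigma>. var i |\<sigma>. \<sigma> \<notin> \<Delta>} :: ('n, 'k) mpoly set"
  show "ideal_gen ?S \<subseteq> mon_ideal {m. keys m \<notin> \<Delta>}"
  proof (rule ideal_gen_subset_mon_ideal)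
    show "mon_closed {m. keys m \<notin> \<Delta>}"
      unfolding mon_closed_def using cplxD(2)[OF assms] by (auto simp: keys_add_nat)
  qed (auto simp: mon_ideal_def prod_var)
  show "mon_ideal {m. keys m \<notin> \<Delta>} \<subseteq> ideal_gen ?S"
  proof (rule mon_ideal_subset_ideal_gen)
    fix m :: "'n \<Rightarrow>\<^sub>0 nat" assume m: "m \<in> {m. keys m \<notin> \<Delta>}"
    let ?s = "sqfree (keys m)"
    have "m = (m - ?s) + ?s"
      by (rule poly_mapping_eqI) (auto simp: lookup_add lookup_minus lookup_sqfree in_keys_iff)
    then have "single m (1::'k) = single (m - ?s) 1 * single ?s 1"
      by (metis single_one_factor)
    also have "\<dots> \<in> ideal_gen ?S"
      using m by (intro ideal_gen_mult ideal_gen_superset) (auto simp flip: prod_var)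
    finally show "single m (1::'k) \<in> ideal_gen ?S" .
  qed
qed

lemma single_square_in_ideal:
  fixes S :: "('n::finite, 'k::field) mpoly set"
  assumes "\<And>i. (var i)\<^sup>2 \<in> ideal_gen S" "2 \<le> lookup m i"
  shows "single m 1 \<in> ideal_gen S"
proof -
  have "single m (1::'k) = single (m - single i 2) 1 * (var i)\<^sup>2"
    unfolding var_power2 single_one_factor[symmetric] using diff_single_add[OF assms(2)] by simp
  then show ?thesis using assms(1) ideal_gen_mult by metis
qed

lemma squares_ideal_eq:
  assumes "cplx (\<Delta> :: 'n::finite set set)"
  shows "ideal_gen (stanley_reisner \<Delta> \<union> range (\<lambda>i. (var i)\<^sup>2)) =
    (mon_ideal {m. keys m \<notin> \<Delta> \<or> (\<exists>i. 2 \<le> lookup m i)} :: ('n, 'k::field) mpoly set)"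
    (is "ideal_gen ?S = mon_ideal ?M")
proof
  show "ideal_gen ?S \<subseteq> mon_ideal ?M"
  proof (rule ideal_gen_subset_mon_ideal)
    show "mon_closed ?M"
      unfolding mon_closed_def using cplxD(2)[OF assms] by (auto simp: keys_add_nat lookup_add) (meson trans_le_add2)
    fix f assume "f \<in> ?S"
    moreover have "\<exists>j. 2 \<le> lookup (single i (2::nat)) j" for i :: 'n
      by (rule exI[of _ i]) simp
    ultimately show "f \<in> mon_ideal ?M"
      by (auto simp: stanley_reisner_eq[OF assms] mon_ideal_def var_power2)
  qed
  show "mon_ideal ?M \<subseteq> ideal_gen ?S"
  proof (rule mon_ideal_subset_ideal_gen)
    fix m assume "m \<in> ?M"
    then consider "keys m \<notin> \<Delta>" | i where "2 \<le> lookup m i" by auto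
    then show "single m 1 \<in> ideal_gen ?S"
    proof cases
      case 1
      then have "single m 1 \<in> (stanley_reisner \<Delta> :: ('n, 'k) mpoly set)"
        by (simp add: stanley_reisner_eq[OF assms] mon_ideal_def)
      then show ?thesis by (intro ideal_gen_superset) simp
    next
      case 2
      then show ?thesis by (intro single_square_in_ideal[of _ _ i] ideal_gen_superset) auto
    qed
  qed
qed

text \<open>The monomials that survive are squarefree with a face as support, so (U5) compares
  numbers of faces.\<close>

lemma HF_squares:
  assumes "cplx (\<Delta> :: 'n::finite set set)"
  shows "HF (int i) (ideal_gen (stanley_reisner \<Delta> \<union> range (\<lambda>i. (var i)\<^sup>2)) :: ('n, 'k::field) mpoly set)
    = card {\<sigma> \<in> \<Delta>. card \<sigma> = i}"
proof -
  have "std_monomials (int i) {m. keys m \<notin> \<Delta> \<or> (\<exists>i. 2 \<le> lookup m i)}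
     = sqfree ` {\<sigma> \<in> \<Delta>. card \<sigma> = i}"
  proof
    show "std_monomials (int i) {m. keys m \<notin> \<Delta> \<or> (\<exists>i. 2 \<le> lookup m i)}
       \<subseteq> sqfree ` {\<sigma> \<in> \<Delta>. card \<sigma> = i}"
    proof
      fix m :: "'n \<Rightarrow>\<^sub>0 nat"
      assume "m \<in> std_monomials (int i) {m. keys m \<notin> \<Delta> \<or> (\<exists>i. 2 \<le> lookup m i)}"
      then have m: "mon_deg m = i" "keys m \<in> \<Delta>" "\<And>j. lookup m j < 2"
        by (auto simp: std_monomials_def not_le)
      have "m = sqfree (keys m)"
      proof (rule poly_mapping_eqI)
        fix j show "lookup m j = lookup (sqfree (keys m)) j"
          using m(3)[of j] by (auto simp: lookup_sqfree in_keys_iff)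
      qed
      moreover from this have "card (keys m) = i" using m(1) mon_deg_sqfree by metis
      ultimately show "m \<in> sqfree ` {\<sigma> \<in> \<Delta>. card \<sigma> = i}" using m(2) by blast
    qed
  qed (auto simp: std_monomials_def lookup_sqfree not_le)
  moreover have "inj_on sqfree {\<sigma> \<in> \<Delta>. card \<sigma> = i}"
    by (rule inj_on_inverseI[where g = keys]) simp
  ultimately show ?thesis
    unfolding squares_ideal_eq[OF assms] HF_mon_ideal by (simp add: card_image)
qed

section \<open>Counting monomials by support\<close>

definition mons :: "'n::finite set \<Rightarrow> nat \<Rightarrow> ('n \<Rightarrow>\<^sub>0 nat) set" where
  "mons \<sigma> i = {m. keys m = \<sigma> \<and> mon_deg m = i}"

lemma mons_empty: "mons {} i = (if i = 0 then {0} else {})"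
  by (auto simp: mons_def)

lemma mons_0: "\<sigma> \<noteq> {} \<Longrightarrow> mons \<sigma> 0 = {}"
  by (auto simp: mons_def mon_deg_eq_0_iff)

text \<open>Dividing by the variable of \<open>v\<close> either leaves \<open>v\<close> in the
  support or removes it.\<close>

lemma mons_insert:
  assumes "v \<notin> \<sigma>"
  shows "mons (insert v \<sigma>) (Suc i) = (\<lambda>m. m + single v 1) ` (mons (insert v \<sigma>) i \<union> mons \<sigma> i)"
proof
  show "mons (insert v \<sigma>) (Suc i) \<subseteq> (\<lambda>m. m + single v 1) ` (mons (insert v \<sigma>) i \<union> mons \<sigma> i)"
  proof
    fix m assume "m \<in> mons (insert v \<sigma>) (Suc i)"
    then have m: "keys m = insert v \<sigma>" "mon_deg m = Suc i" by (auto simp: mons_def)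
    let ?m' = "m - single v 1"
    have "lookup m v \<noteq> 0" using m(1) by (metis in_keys_iff insertI1)
    then have eq: "?m' + single v 1 = m" by (intro diff_single_add) simp
    then have "mon_deg ?m' = i" using m(2) mon_deg_add[of ?m' "single v 1"] by simp
    moreover have "insert v (keys ?m') = insert v \<sigma>"
      using m(1) keys_add_nat[of ?m' "single v 1"] eq by simp
    then have "keys ?m' = insert v \<sigma> \<or> keys ?m' = \<sigma>"
      using assms by (metis insert_absorb insert_ident)
    ultimately show "m \<in> (\<lambda>m. m + single v 1) ` (mons (insert v \<sigma>) i \<union> mons \<sigma> i)"
      using eq unfolding mons_def by (intro image_eqI[of _ _ ?m']) auto
  qed
  show "(\<lambda>m. m + single v 1) ` (mons (insert v \<sigma>) i \<union> mons \<sigma> i) \<subseteq> mons (insert v \<sigma>) (Suc i)"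
  proof (intro image_subsetI)
    fix m assume "m \<in> mons (insert v \<sigma>) i \<union> mons \<sigma> i"
    then have "insert v (keys m) = insert v \<sigma>" "mon_deg m = i" by (auto simp: mons_def)
    then show "m + single v 1 \<in> mons (insert v \<sigma>) (Suc i)"
      by (simp add: mons_def keys_add_nat mon_deg_add)
  qed
qed

lemma finite_mons: "finite (mons \<sigma> i)"
  using finite[of \<sigma>]
proof (induction \<sigma> arbitrary: i)
  case (insert v \<sigma>)
  show ?case by (induction i) (use insert in \<open>auto simp: mons_insert mons_0\<close>)
qed (simp add: mons_empty)

lemma card_mons_insert:
  assumes "v \<notin> \<sigma>"
  shows "card (mons (insert v \<sigma>) (Suc i)) = card (mons (insert v \<sigma>) i) + card (mons \<sigma> i)"
proof -
  have "inj_on (\<lambda>m. m + single v 1) A" for A :: "('a \<Rightarrow>\<^sub>0 nat) set" by (rule inj_onI) simp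
  moreover have "mons (insert v \<sigma>) i \<inter> mons \<sigma> i = {}" using assms by (auto simp: mons_def)
  ultimately show ?thesis unfolding mons_insert[OF assms] by (simp add: card_image card_Un_disjoint finite_mons)
qed

definition mons_series :: "'n::finite set \<Rightarrow> int fps" where
  "mons_series \<sigma> = Abs_fps (\<lambda>i. int (card (mons \<sigma> i)))"

lemma mons_series_insert:
  assumes "v \<notin> \<sigma>"
  shows "mons_series (insert v \<sigma>) * (1 - fps_X) = fps_X * mons_series \<sigma>"
proof (rule fps_ext)
  fix n
  show "fps_nth (mons_series (insert v \<sigma>) * (1 - fps_X)) n = fps_nth (fps_X * mons_series \<sigma>) n"
    by (cases n) (simp_all add: mons_series_def right_diff_distrib card_mons_insert[OF assms] mons_0)
qed

lemma mons_series_eq: "mons_series \<sigma> * (1 - fps_X) ^ card \<sigma> = fps_X ^ card \<sigma>"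
  using finite[of \<sigma>]
proof induction
  case empty
  have "mons_series {} = 1" by (rule fps_ext) (simp add: mons_series_def mons_empty)
  then show ?case by simp
next
  case (insert v \<sigma>)
  have "mons_series (insert v \<sigma>) * (1 - fps_X) ^ card (insert v \<sigma>)
      = (mons_series (insert v \<sigma>) * (1 - fps_X)) * (1 - fps_X) ^ card \<sigma>"
    using insert by (simp add: mult.assoc)
  also have "\<dots> = fps_X * (mons_series \<sigma> * (1 - fps_X) ^ card \<sigma>)"
    by (simp add: mons_series_insert[OF insert(2)] mult.assoc)
  finally show ?case using insert by simp
qed

text \<open>The monomials outside the ideal are sorted by their support, which is a face.\<close>

lemma hilbert_series_stanley_reisner:
  assumes "cplx (\<Delta> :: 'n::finite set set)"
  shows "hilbert_series (stanley_reisner \<Delta> :: ('n, 'k::field) mpoly set) = (\<Sum>\<sigma>\<in>\<Delta>. mons_series \<sigma>)"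
proof (rule fps_ext)
  fix i
  have "std_monomials (int i) {m. keys m \<notin> \<Delta>} = (\<Union>\<sigma>\<in>\<Delta>. mons \<sigma> i)"
    by (auto simp: std_monomials_def mons_def)
  moreover have "card (\<Union>\<sigma>\<in>\<Delta>. mons \<sigma> i) = (\<Sum>\<sigma>\<in>\<Delta>. card (mons \<sigma> i))"
    by (intro card_UN_disjoint) (auto simp: finite_mons, auto simp: mons_def)
  ultimately show "fps_nth (hilbert_series (stanley_reisner \<Delta> :: ('n, 'k) mpoly set)) i = fps_nth (\<Sum>\<sigma>\<in>\<Delta>. mons_series \<sigma>) i"
    unfolding hilbert_series_def stanley_reisner_eq[OF assms] HF_mon_ideal
    by (simp add: fps_sum_nth mons_series_def)
qed

text \<open>The expression of the \<open>h\<close>-polynomial by face numbers, kept as a sum over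
  faces so that its top coefficient becomes an Euler characteristic.\<close>

definition h_poly :: "nat \<Rightarrow> 'n::finite set set \<Rightarrow> int poly" where
  "h_poly d \<Delta> = (\<Sum>\<sigma>\<in>\<Delta>. Polynomial.monom 1 (card \<sigma>) * [:1, - 1:] ^ (d + 1 - card \<sigma>))"

context sphere
begin

lemma h_polynomial_eq: "h_polynomial TYPE('k::field) \<Delta> = h_poly d \<Delta>"
proof -
  have X: "fps_of_poly [:1, - 1:] = (1 - fps_X :: int fps)"
    by (simp add: fps_of_poly_pCons fps_of_poly_const)
  have "hilbert_series (stanley_reisner \<Delta> :: ('n, 'k) mpoly set) * (1 - fps_X) ^ (d + 1)
      = (\<Sum>\<sigma>\<in>\<Delta>. mons_series \<sigma> * (1 - fps_X) ^ (d + 1))"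
    by (simp add: hilbert_series_stanley_reisner[OF cplx] sum_distrib_right)
  also have "\<dots> = (\<Sum>\<sigma>\<in>\<Delta>. fps_X ^ card \<sigma> * (1 - fps_X) ^ (d + 1 - card \<sigma>))"
  proof (rule sum.cong[OF refl])
    fix \<sigma> assume "\<sigma> \<in> \<Delta>"
    then have "d + 1 = card \<sigma> + (d + 1 - card \<sigma>)" using card_le by simp
    then have eq: "(1 - fps_X :: int fps) ^ (d + 1) = (1 - fps_X) ^ card \<sigma> * (1 - fps_X) ^ (d + 1 - card \<sigma>)"
      by (metis power_add)
    show "mons_series \<sigma> * (1 - fps_X) ^ (d + 1) = fps_X ^ card \<sigma> * (1 - fps_X) ^ (d + 1 - card \<sigma>)"
      unfolding eq mult.assoc[symmetric] mons_series_eq ..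
  qed
  also have "\<dots> = fps_of_poly (h_poly d \<Delta>)"
    by (simp add: h_poly_def fps_of_poly_sum fps_of_poly_mult fps_of_poly_power fps_of_poly_monom X)
  finally have eq: "hilbert_series (stanley_reisner \<Delta> :: ('n, 'k) mpoly set) * (1 - fps_X) ^ (d + 1) = fps_of_poly (h_poly d \<Delta>)" .
  show ?thesis
    unfolding h_polynomial_def complex_dim
  proof (rule the_equality)
    show "h = h_poly d \<Delta>"
      if "hilbert_series (stanley_reisner \<Delta> :: ('n, 'k) mpoly set) * (1 - fps_X) ^ (d + 1) = fps_of_poly h" for h
      using that eq by simp
  qed (rule eq)
qed

text \<open>Each summand of \<open>h_poly\<close> has degree exactly \<open>d + 1\<close>, so only
  cancellation could lower the degree; but the leading coefficients add up to
  \<open>(- 1) ^ d * euler \<Delta> = 1\<close>.\<close>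

lemma degree_h_polynomial: "Polynomial.degree (h_polynomial TYPE('k::field) \<Delta>) = d + 1"
proof -
  have deg: "Polynomial.degree (Polynomial.monom 1 (card \<sigma>) * [:1, - 1::int:] ^ (d + 1 - card \<sigma>)) = d + 1"
    and lc: "Polynomial.coeff (Polynomial.monom 1 (card \<sigma>) * [:1, - 1::int:] ^ (d + 1 - card \<sigma>)) (d + 1) = (- 1) ^ (d + 1 - card \<sigma>)"
    if "\<sigma> \<in> \<Delta>" for \<sigma>
  proof -
    show 1: "Polynomial.degree (Polynomial.monom 1 (card \<sigma>) * [:1, - 1::int:] ^ (d + 1 - card \<sigma>)) = d + 1"
      using card_le[OF that] by (simp add: degree_mult_eq degree_power_eq degree_monom_eq)
    have "Polynomial.lead_coeff (Polynomial.monom 1 (card \<sigma>) * [:1, - 1::int:] ^ (d + 1 - card \<sigma>)) = (- 1) ^ (d + 1 - card \<sigma>)"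
      unfolding lead_coeff_mult lead_coeff_power by (simp add: degree_monom_eq)
    then show "Polynomial.coeff (Polynomial.monom 1 (card \<sigma>) * [:1, - 1::int:] ^ (d + 1 - card \<sigma>)) (d + 1) = (- 1) ^ (d + 1 - card \<sigma>)"
      unfolding 1 .
  qed
  have "Polynomial.coeff (h_poly d \<Delta>) (d + 1) = (\<Sum>\<sigma>\<in>\<Delta>. (- 1) ^ (d + 1 - card \<sigma>))"
    unfolding h_poly_def coeff_sum by (rule sum.cong[OF refl lc])
  also have "\<dots> = (\<Sum>\<sigma>\<in>\<Delta>. (- 1) ^ d * (- 1) ^ (card \<sigma> + 1))"
  proof (rule sum.cong[OF refl])
    fix \<sigma> assume "\<sigma> \<in> \<Delta>"
    then have "(- 1 :: int) ^ (d + 1 - card \<sigma>) * (- 1) ^ card \<sigma> = (- 1) ^ (d + 1)"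
      using card_le by (metis le_add_diff_inverse2 power_add)
    then have "(- 1 :: int) ^ (d + 1 - card \<sigma>) * ((- 1) ^ card \<sigma> * (- 1) ^ card \<sigma>) = (- 1) ^ (d + 1) * (- 1) ^ card \<sigma>"
      by (simp only: mult.assoc[symmetric])
    moreover have "(- 1 :: int) ^ card \<sigma> * (- 1) ^ card \<sigma> = 1" by (simp flip: power_mult_distrib)
    ultimately show "(- 1 :: int) ^ (d + 1 - card \<sigma>) = (- 1) ^ d * (- 1) ^ (card \<sigma> + 1)" by simp
  qed
  also have "\<dots> = (- 1) ^ d * euler \<Delta>" by (simp add: euler_def sum_distrib_left)
  also have "\<dots> = 1" by (simp add: euler_sphere flip: power_mult_distrib)
  finally have "Polynomial.degree (h_poly d \<Delta>) \<ge> d + 1" by (intro le_degree) simp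
  moreover have "Polynomial.degree (h_poly d \<Delta>) \<le> d + 1"
    unfolding h_poly_def using deg by (intro degree_sum_le) auto
  ultimately show ?thesis by (simp add: h_polynomial_eq)
qed

lemma HF_squares_le:
  "HF (int (d + 1)) (ideal_gen (stanley_reisner \<Delta> \<union> range (\<lambda>i. (var i)\<^sup>2)) :: ('n, 'k::field) mpoly set)
   \<le> HF (int (d + 1) - 1) (ideal_gen (stanley_reisner \<Delta> \<union> range (\<lambda>i. (var i)\<^sup>2)) :: ('n, 'k) mpoly set)"
proof -
  have "2 * card facets \<le> (d + 1) * card facets" using d_pos by (intro mult_right_mono) auto
  then have "2 * card facets \<le> 2 * card {G \<in> \<Delta>. card G = d}" unfolding facets_ridges_count .
  then have "card facets \<le> card {G \<in> \<Delta>. card G = d}" by simp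
  moreover have eq: "int (d + 1) - 1 = int d" by simp
  ultimately show ?thesis unfolding eq HF_squares[OF cplx] facets_def by simp
qed

end

text \<open>The squarefree monomials span the quotient. For independence, take a finite spanning set
  of least cardinality: an element with nonzero coefficient in a relation could be dropped.\<close>

lemma fin_dim_mod_squares:
  fixes S :: "('n::finite, 'k::field) mpoly set"
  assumes "\<And>i. (var i)\<^sup>2 \<in> ideal_gen S"
  shows "fin_dim_mod UNIV (ideal_gen S)"
proof -
  let ?A = "ideal_gen S"
  let ?G = "(\<lambda>\<sigma>. single (sqfree \<sigma>) (1::'k)) ` UNIV"
  have "f \<in> mpoly.span (?G \<union> ?A)" for f
  proof (induction f rule: mpoly_induct)
    case (single m c)
    have "single m 1 \<in> mpoly.span (?G \<union> ?A)"
    proof (cases "\<exists>i. 2 \<le> lookup m i")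
      case True
      then show ?thesis using single_square_in_ideal[OF assms] by (intro mpoly.span_base) blast
    next
      case False
      have "m = sqfree (keys m)"
      proof (rule poly_mapping_eqI)
        fix j
        have "lookup m j < 2" using False by (simp add: not_le)
        then show "lookup m j = lookup (sqfree (keys m)) j"
          by (auto simp: lookup_sqfree in_keys_iff)
      qed
      then have "single m 1 \<in> ?G" by (metis rangeI)
      then show ?thesis by (intro mpoly.span_base) blast
    qed
    moreover have "single m c = scal c (single m 1)" by (simp add: scal_def mult_single)
    ultimately show ?case by (metis mpoly.span_scale)
  qed (rule mpoly.span_add)
  then have "finite ?G \<and> UNIV \<subseteq> mpoly.span (?G \<union> ?A)" by (intro conjI finite_imageI subsetI) auto
  then have "\<exists>B. (finite B \<and> UNIV \<subseteq> mpoly.span (B \<union> ?A)) \<and>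
      (\<forall>B'. finite B' \<and> UNIV \<subseteq> mpoly.span (B' \<union> ?A) \<longrightarrow> card B \<le> card B')"
    by (rule ex_has_least_nat)
  then obtain B where B: "finite B" "UNIV \<subseteq> mpoly.span (B \<union> ?A)"
    and min: "\<And>B'. finite B' \<Longrightarrow> UNIV \<subseteq> mpoly.span (B' \<union> ?A) \<Longrightarrow> card B \<le> card B'"
    by (elim exE conjE) simp
  have "basis_mod UNIV ?A B"
    unfolding basis_mod_def lin_span_def
  proof (intro conjI allI impI ballI)
    fix T c b assume T: "finite T \<and> T \<subseteq> B \<and> (\<Sum>b\<in>T. scal (c b) b) \<in> ?A" and b: "b \<in> T"
    show "c b = 0"
    proof (rule ccontr)
      assume c: "c b \<noteq> 0"
      let ?V = "mpoly.span ((B - {b}) \<union> ?A)"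
      have "scal (c b) b = (\<Sum>b\<in>T. scal (c b) b) - (\<Sum>b\<in>T - {b}. scal (c b) b)"
        using T b by (simp add: sum.remove)
      moreover have "(\<Sum>b\<in>T. scal (c b) b) \<in> ?V" using T by (intro mpoly.span_base) auto
      moreover have "(\<Sum>b\<in>T - {b}. scal (c b) b) \<in> ?V"
        using T by (intro mpoly.span_sum mpoly.span_scale mpoly.span_base) auto
      ultimately have "scal (c b) b \<in> ?V" by (simp only: mpoly.span_diff)
      then have "scal (inverse (c b)) (scal (c b) b) \<in> ?V" by (rule mpoly.span_scale)
      then have bV: "b \<in> ?V" using c by simp
      have "x \<in> ?V" if "x \<in> B \<union> ?A" for x
        using that bV by (cases "x = b") (auto intro: mpoly.span_base)
      then have "mpoly.span (B \<union> ?A) \<subseteq> ?V" by (intro mpoly.span_minimal mpoly.subspace_span) auto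
      then have "card B \<le> card (B - {b})" using B by (intro min) auto
      moreover have "b \<in> B" using T b by blast
      ultimately show False using B(1) by (metis card_Diff1_less not_less)
    qed
  qed (use B in auto)
  then show ?thesis unfolding fin_dim_mod_def using B(1) by blast
qed

lemma keys_sum_var: "keys (\<Sum>v\<in>V. var v :: ('n::finite, 'k::field) mpoly) = (\<lambda>v. single v 1) ` V"
proof -
  have "lookup (\<Sum>v\<in>V. var v :: ('n, 'k) mpoly) m = (if m \<in> (\<lambda>v. single v 1) ` V then 1 else 0)" for m
  proof -
    have "lookup (\<Sum>v\<in>V. var v :: ('n, 'k) mpoly) m = (\<Sum>v\<in>V. if single v 1 = m then 1 else 0)"
      by (simp add: lookup_sum var_def lookup_single when_def)
    also have "\<dots> = (if m \<in> (\<lambda>v. single v 1) ` V then 1 else 0)"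
    proof (cases "m \<in> (\<lambda>v. single v 1) ` V")
      case True
      then obtain w where w: "w \<in> V" "m = single w 1" by auto
      have inj: "single v (1::nat) = m \<longleftrightarrow> v = w" for v
      proof
        assume "single v (1::nat) = m"
        then have "keys (single v (1::nat)) = keys (single w (1::nat))" using w by simp
        then show "v = w" by simp
      qed (simp add: w)
      show ?thesis using True w(1) unfolding inj by simp
    next
      case False
      then have "(\<Sum>v\<in>V. if single v 1 = m then 1 else 0 :: 'k) = (\<Sum>v\<in>V. 0)"
        by (intro sum.cong) auto
      then show ?thesis using False by simp
    qed
    finally show ?thesis .
  qed
  note L = this
  show ?thesis by (rule Set.set_eqI) (simp add: in_keys_iff L del: One_nat_def)
qed

context sphere
begin

text \<open>As the \<open>h\<close>-polynomial has degree \<open>d + 1\<close>, condition (U2) says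
  that \<open>t\<close> is the sum of the degrees of the forms, which is \<open>d + 1\<close> for
  linear ones.\<close>

lemma colored_sop_unexpected:
  assumes \<rho>: "proper_coloring \<Delta> \<rho>"
  shows "unexpected_sop2 \<Delta> (int (d + 1)) (colored_sop \<rho> :: nat \<Rightarrow> ('n, 'k::field) mpoly)"
proof -
  let ?\<theta> = "colored_sop \<rho> :: nat \<Rightarrow> ('n, 'k) mpoly"
  let ?S = "stanley_reisner \<Delta> \<union> ?\<theta> ` {1..d + 1} :: ('n, 'k) mpoly set"
  have \<rho>1: "\<rho> v \<in> {1..d + 1}" for v using \<rho> by (simp add: proper_coloring_def)
  have \<rho>2: "\<rho> u \<noteq> \<rho> v" if "{u, v} \<in> \<Delta>" "u \<noteq> v" for u v using \<rho> that by (simp add: proper_coloring_def)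
  obtain F where F: "F \<in> \<Delta>" "card F = d + 1" using ex_facet by blast
  \<comment> \<open>A facet shows every color, so no form of the colored sop is zero and all of them
    have degree 1.\<close>
  have "inj_on \<rho> F"
  proof (rule inj_onI, rule ccontr)
    fix u v assume "u \<in> F" "v \<in> F" "\<rho> u = \<rho> v" "u \<noteq> v"
    then show False using \<rho>2[of u v] cplxD(2)[OF cplx F(1), of "{u, v}"] by auto
  qed
  then have "card (\<rho> ` F) = card {1..d + 1}" using F(2) by (simp add: card_image)
  then have surj: "\<rho> ` F = {1..d + 1}" using \<rho>1 by (intro card_subset_eq) auto
  have keys: "keys (?\<theta> i) = (\<lambda>v. single v 1) ` {v. \<rho> v = i}" for i
    unfolding colored_sop_def by (rule keys_sum_var)
  have hom: "homogeneous (?\<theta> i)" for i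
    unfolding homogeneous_def graded_piece_def mem_Collect_eq keys by (intro exI[of _ 1]) auto
  have deg: "tot_deg (?\<theta> i) = 1" if "i \<in> {1..d + 1}" for i
  proof -
    have "i \<in> \<rho> ` F" using surj that by simp
    then obtain v where "\<rho> v = i" by blast
    then have "mon_deg ` keys (?\<theta> i) = {1}" unfolding keys by (auto simp: image_image)
    then show ?thesis by (simp add: tot_deg_def)
  qed
  have "(\<Sum>i\<in>{1..d + 1}. \<Sum>v\<in>{v \<in> UNIV. \<rho> v = i}. var v :: ('n, 'k) mpoly) = (\<Sum>v\<in>UNIV. var v)"
    by (rule sum.group) (use \<rho>1 in auto)
  then have "(\<Sum>v\<in>UNIV. var v :: ('n, 'k) mpoly) = (\<Sum>i\<in>{1..d + 1}. ?\<theta> i)"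
    by (simp only: colored_sop_def UNIV_I simp_thms)
  moreover have "\<dots> \<in> ideal_gen ?S" by (intro ideal_gen_sum ideal_gen_superset) auto
  ultimately have U3: "(\<Sum>v\<in>UNIV. var v) \<in> ideal_gen ?S" by simp
  \<comment> \<open>Multiply the form of the color of \<open>v\<close> by the variable of
    \<open>v\<close>: all mixed products come from nonfaces, since vertices of one color are not
    adjacent.\<close>
  have U4: "(var v)\<^sup>2 \<in> ideal_gen ?S" for v
  proof -
    have *: "var v * var u \<in> ideal_gen ?S" if "u \<noteq> v" "\<rho> u = \<rho> v" for u
    proof -
      have "{v, u} \<notin> \<Delta>" using \<rho>2[of v u] that by auto
      then have "(\<Prod>i\<in>{v, u}. var i) \<in> (stanley_reisner \<Delta> :: ('n, 'k) mpoly set)"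
        unfolding stanley_reisner_def by (intro ideal_gen_superset) blast
      then show ?thesis using that(1) by (intro ideal_gen_superset) simp
    qed
    have "var v * ?\<theta> (\<rho> v) = (\<Sum>u\<in>{u. \<rho> u = \<rho> v}. var v * var u)"
      by (simp add: colored_sop_def sum_distrib_left)
    also have "\<dots> = (var v)\<^sup>2 + (\<Sum>u\<in>{u. \<rho> u = \<rho> v} - {v}. var v * var u)"
      by (subst sum.remove[of _ v]) (auto simp: power2_eq_square)
    finally have "(var v)\<^sup>2 = var v * ?\<theta> (\<rho> v) - (\<Sum>u\<in>{u. \<rho> u = \<rho> v} - {v}. var v * var u)" by simp
    also have "\<dots> \<in> ideal_gen ?S"
    proof (rule ideal_gen_diff)
      show "var v * ?\<theta> (\<rho> v) \<in> ideal_gen ?S"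
        using \<rho>1[of v] by (intro ideal_gen_mult ideal_gen_superset) auto
      show "(\<Sum>u\<in>{u. \<rho> u = \<rho> v} - {v}. var v * var u) \<in> ideal_gen ?S"
        using * by (intro ideal_gen_sum) auto
    qed
    finally show ?thesis .
  qed
  show ?thesis
    unfolding unexpected_sop2_def Let_def sop_ideal_def complex_dim degree_h_polynomial
    using hom deg U3 U4 fin_dim_mod_squares[OF U4] HF_squares_le by simp
qed

end

section \<open>Linear algebra and evaluation\<close>

text \<open>\<open>S\<close> consists of free coordinates, and \<open>e s\<close> is the solution
  with entry 1 at \<open>s\<close> and 0 at the other free coordinates. Each further equation costs
  at most one free coordinate. The unit shape on \<open>S\<close> later yields an identity matrix of
  squares.\<close>

lemma gaussian_elimination:
  fixes \<phi> :: "'i \<Rightarrow> 'w \<Rightarrow> 'k::field"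
  assumes "finite F" "finite L"
  shows "\<exists>S e. S \<subseteq> F \<and> card F \<le> card S + card L \<and>
    (\<forall>s\<in>S. (\<forall>i\<in>L. (\<Sum>w\<in>F. \<phi> i w * e s w) = 0) \<and> (\<forall>w. w \<notin> F \<longrightarrow> e s w = 0) \<and>
      (\<forall>s'\<in>S. e s s' = (if s = s' then 1 else 0)))"
  using assms(2)
proof induction
  case empty
  show ?case
    by (rule exI[of _ F], rule exI[of _ "\<lambda>s w. if w = s \<and> w \<in> F then 1 else 0"]) auto
next
  case (insert i L)
  then obtain S e where S: "S \<subseteq> F" "card F \<le> card S + card L"
    and e: "\<And>s j. s \<in> S \<Longrightarrow> j \<in> L \<Longrightarrow> (\<Sum>w\<in>F. \<phi> j w * e s w) = 0"
      "\<And>s w. s \<in> S \<Longrightarrow> w \<notin> F \<Longrightarrow> e s w = 0"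
      "\<And>s s'. s \<in> S \<Longrightarrow> s' \<in> S \<Longrightarrow> e s s' = (if s = s' then 1 else 0)"
    by blast
  define f where "f s = (\<Sum>w\<in>F. \<phi> i w * e s w)" for s
  show ?case
  proof (cases "\<forall>s\<in>S. f s = 0")
    case True
    then show ?thesis
      using S e insert.hyps by (intro exI[of _ S] exI[of _ e]) (auto simp: f_def)
  next
    case False
    then obtain s0 where s0: "s0 \<in> S" "f s0 \<noteq> 0" by blast
    define e' where "e' s w = e s w - f s / f s0 * e s0 w" for s w
    have lin: "(\<Sum>w\<in>F. \<phi> j w * e' s w) = (\<Sum>w\<in>F. \<phi> j w * e s w) - f s / f s0 * (\<Sum>w\<in>F. \<phi> j w * e s0 w)" for j s
      by (simp add: e'_def sum_subtractf sum_distrib_left algebra_simps)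
    have fin: "finite S" using S assms(1) finite_subset by blast
    show ?thesis
    proof (intro exI[of _ "S - {s0}"] exI[of _ e'] conjI ballI allI impI)
      show "S - {s0} \<subseteq> F" using S by auto
      have "card S = Suc (card (S - {s0}))" using fin s0 by (metis card.remove)
      then show "card F \<le> card (S - {s0}) + card (insert i L)" using S insert.hyps by simp
    next
      fix s j assume "s \<in> S - {s0}" "j \<in> insert i L"
      then show "(\<Sum>w\<in>F. \<phi> j w * e' s w) = 0"
        using e(1) s0 unfolding lin by (auto simp: f_def[symmetric])
    next
      fix s w assume "s \<in> S - {s0}" "w \<notin> F"
      then show "e' s w = 0" using e(2) s0 by (simp add: e'_def)
    next
      fix s s' assume "s \<in> S - {s0}" "s' \<in> S - {s0}"
      then show "e' s s' = (if s = s' then 1 else 0)" using e(3)[of s s'] e(3)[of s0 s'] s0 by (auto simp: e'_def)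
    qed
  qed
qed

lemma ex_nonzero_solution:
  fixes \<phi> :: "'i \<Rightarrow> 'w \<Rightarrow> 'k::field"
  assumes "finite F" "finite L" "card L < card F"
  shows "\<exists>x s. s \<in> F \<and> x s = 1 \<and> (\<forall>i\<in>L. (\<Sum>w\<in>F. \<phi> i w * x w) = 0)"
proof -
  obtain S e where S: "S \<subseteq> F" "card F \<le> card S + card L"
    and e: "\<And>s j. s \<in> S \<Longrightarrow> j \<in> L \<Longrightarrow> (\<Sum>w\<in>F. \<phi> j w * e s w) = 0"
      "\<And>s s'. s \<in> S \<Longrightarrow> s' \<in> S \<Longrightarrow> e s s' = (if s = s' then 1 else 0)"
    using gaussian_elimination[OF assms(1,2), of \<phi>] by blast
  have "S \<noteq> {}" using S(2) assms(3) by auto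
  then obtain s where "s \<in> S" by blast
  then show ?thesis using S e by (intro exI[of _ "e s"] exI[of _ s]) auto
qed

text \<open>If \<open>q i\<close> were nonzero, row \<open>i\<close> would be a combination of the
  other rows. These are fewer than the columns, so they have a common nonzero solution, which
  contradicts \<open>inj\<close>.\<close>

lemma square_left_kernel:
  fixes P :: "'i \<Rightarrow> 'w \<Rightarrow> 'k::field"
  assumes "finite F" "finite I" "card F = card I"
    and inj: "\<And>p. (\<And>i. i \<in> I \<Longrightarrow> (\<Sum>w\<in>F. P i w * p w) = 0) \<Longrightarrow> (\<forall>w\<in>F. p w = 0)"
    and q: "\<And>w. w \<in> F \<Longrightarrow> (\<Sum>i\<in>I. q i * P i w) = 0"
    and i: "i \<in> I"
  shows "q i = 0"
proof (rule ccontr)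
  assume qi: "q i \<noteq> 0"
  have "card (I - {i}) < card F" using assms(2,3) i by (metis card_Diff1_less)
  then obtain x s where x: "s \<in> F" "x s = 1" "\<And>j. j \<in> I - {i} \<Longrightarrow> (\<Sum>w\<in>F. P j w * x w) = 0"
    using ex_nonzero_solution[of F "I - {i}" P] assms by auto
  have "0 = (\<Sum>w\<in>F. (\<Sum>j\<in>I. q j * P j w) * x w)" using q by simp
  also have "\<dots> = (\<Sum>j\<in>I. q j * (\<Sum>w\<in>F. P j w * x w))"
    by (simp add: sum_distrib_left sum_distrib_right mult.assoc) (rule sum.swap)
  also have "\<dots> = q i * (\<Sum>w\<in>F. P i w * x w) + (\<Sum>j\<in>I - {i}. q j * (\<Sum>w\<in>F. P j w * x w))"
    using i assms by (simp add: sum.remove)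
  also have "(\<Sum>j\<in>I - {i}. q j * (\<Sum>w\<in>F. P j w * x w)) = 0" using x by simp
  finally have "(\<Sum>w\<in>F. P i w * x w) = 0" using qi by simp
  then have "(\<Sum>w\<in>F. P j w * x w) = 0" if "j \<in> I" for j using x(3) that by (cases "j = i") auto
  then have "x s = 0" using inj[of x] x(1) by blast
  then show False using x(2) by simp
qed

text \<open>A nonzero vector orthogonal to the columns other than \<open>w\<close> exists by
  counting; by \<open>square_left_kernel\<close> it is not orthogonal to column \<open>w\<close>, so
  it can be rescaled.\<close>

lemma square_dual_vector:
  fixes P :: "'i \<Rightarrow> 'w \<Rightarrow> 'k::field"
  assumes "finite F" "finite I" "card F = card I"
    and inj: "\<And>p. (\<And>i. i \<in> I \<Longrightarrow> (\<Sum>w\<in>F. P i w * p w) = 0) \<Longrightarrow> (\<forall>w\<in>F. p w = 0)"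
    and w: "w \<in> F"
  shows "\<exists>q. \<forall>w'\<in>F. (\<Sum>i\<in>I. q i * P i w') = (if w = w' then 1 else 0)"
proof -
  have "card (F - {w}) < card I" using assms by (metis card_Diff1_less)
  then obtain x s where x: "s \<in> I" "x s = 1" "\<And>w'. w' \<in> F - {w} \<Longrightarrow> (\<Sum>i\<in>I. P i w' * x i) = 0"
    using ex_nonzero_solution[of I "F - {w}" "\<lambda>w' i. P i w'"] assms by auto
  define c where "c = (\<Sum>i\<in>I. x i * P i w)"
  have "c \<noteq> 0"
  proof
    assume "c = 0"
    then have "(\<Sum>i\<in>I. x i * P i w') = 0" if "w' \<in> F" for w'
      using x(3)[of w'] that by (cases "w' = w") (auto simp: c_def mult.commute)
    then have "x s = 0" using square_left_kernel[OF assms(1-3) inj _ x(1)] by blast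
    then show False using x(2) by simp
  qed
  have "(\<Sum>i\<in>I. x i / c * P i w') = (\<Sum>i\<in>I. x i * P i w') / c" for w'
    by (simp add: sum_divide_distrib)
  then show ?thesis
    using \<open>c \<noteq> 0\<close> x(3) by (intro exI[of _ "\<lambda>i. x i / c"]) (auto simp: c_def mult.commute)
qed

text \<open>An identity matrix of size \<open>card S\<close> factors through a space of dimension at
  most \<open>card S\<close>, so both factors are invertible. Concretely, if \<open>c j\<close> is
  nonzero there is a nonzero \<open>x\<close> whose image \<open>y\<close> is a multiple of
  \<open>c\<close>; applying \<open>M\<close> to \<open>y\<close> gives back \<open>x\<close>, but
  \<open>M\<close> kills \<open>c\<close>.\<close>

lemma factored_identity_kernel:
  fixes M :: "'s \<Rightarrow> 'j \<Rightarrow> 'k::field"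
  assumes "finite S" "finite Q" "card Q \<le> card S"
    and id: "\<And>s s'. s \<in> S \<Longrightarrow> s' \<in> S \<Longrightarrow> (\<Sum>j\<in>Q. C s' j * M s j) = (if s = s' then 1 else 0)"
    and c: "\<And>s. s \<in> S \<Longrightarrow> (\<Sum>j\<in>Q. c j * M s j) = 0"
    and j: "j \<in> Q"
  shows "c j = 0"
proof (rule ccontr)
  assume cj: "c j \<noteq> 0"
  have "card (Q - {j}) < card S" using assms by (metis card_Diff1_less less_le_trans)
  then obtain x s where x: "s \<in> S" "x s = 1"
      "\<And>i. i \<in> Q - {j} \<Longrightarrow> (\<Sum>s'\<in>S. (C s' i - c i / c j * C s' j) * x s') = 0"
    using ex_nonzero_solution[of S "Q - {j}" "\<lambda>i s'. C s' i - c i / c j * C s' j"] assms by auto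
  define y where "y i = (\<Sum>s'\<in>S. C s' i * x s')" for i
  have y: "y i = c i / c j * y j" if "i \<in> Q" for i
  proof (cases "i = j")
    case False
    then have "(\<Sum>s'\<in>S. C s' i * x s' - c i / c j * (C s' j * x s')) = 0"
      using x(3)[of i] that by (simp add: algebra_simps)
    then show ?thesis by (simp add: y_def sum_subtractf sum_distrib_left)
  qed (use cj in simp)
  have "x s = (\<Sum>s'\<in>S. (\<Sum>i\<in>Q. C s' i * M s i) * x s')"
    using id x(1) assms(1) by (simp add: if_distrib[where f = "\<lambda>u. u * _"] cong: if_cong)
  also have "\<dots> = (\<Sum>i\<in>Q. y i * M s i)"
    unfolding y_def sum_distrib_right by (subst sum.swap) (simp add: mult_ac)
  also have "\<dots> = (\<Sum>i\<in>Q. y j / c j * (c i * M s i))"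
    by (rule sum.cong[OF refl]) (simp add: y)
  also have "\<dots> = y j / c j * (\<Sum>i\<in>Q. c i * M s i)" by (simp only: sum_distrib_left)
  also have "\<dots> = 0" using c[OF x(1)] by simp
  finally show False using x(2) by simp
qed

section \<open>Evaluation on lines through the origin\<close>

definition mon_val :: "('n::finite \<Rightarrow> 'k::field) \<Rightarrow> ('n \<Rightarrow>\<^sub>0 nat) \<Rightarrow> 'k" where
  "mon_val p m = (\<Prod>i\<in>UNIV. p i ^ lookup m i)"

text \<open>
  \<open>ev p f\<close> is the univariate polynomial \<open>s \<mapsto> f (s p)\<close>, so its coefficients are the values at \<open>p\<close> of the
  homogeneous components of \<open>f\<close>.
\<close>

definition ev :: "('n::finite \<Rightarrow> 'k::field) \<Rightarrow> ('n, 'k) mpoly \<Rightarrow> 'k poly" where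
  "ev p f = (\<Sum>m\<in>keys f. Polynomial.monom (lookup f m * mon_val p m) (mon_deg m))"

lemma ev_zero [simp]: "ev p 0 = 0"
  by (simp add: ev_def)

lemma ev_add: "ev p (f + g) = ev p f + ev p g"
  unfolding ev_def
  by (rule setsum_keys_plus_distrib) (simp_all add: distrib_right add_monom)

lemma ev_single: "ev p (single m c) = Polynomial.monom (c * mon_val p m) (mon_deg m)"
  by (cases "c = 0") (simp_all add: ev_def)

lemma mon_val_add: "mon_val p (m + m') = mon_val p m * mon_val p m'"
  by (simp add: mon_val_def lookup_add power_add prod.distrib)

lemma ev_mult: "ev p (f * g) = ev p f * ev p g"
proof (induction f rule: mpoly_induct)
  case (single m c)
  show ?case
  proof (induction g rule: mpoly_induct)
    case (single m' c')
    show ?case by (simp add: mult_single ev_single mon_val_add mon_deg_add mult_monom mult_ac)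
  qed (simp add: distrib_left ev_add)
qed (simp add: distrib_right ev_add)

lemma ev_sum: "ev p (\<Sum>x\<in>A. f x) = (\<Sum>x\<in>A. ev p (f x))"
  by (induction A rule: infinite_finite_induct) (simp_all add: ev_add)

lemma ev_var: "ev p (var i) = Polynomial.monom (p i) 1"
  by (simp add: var_def ev_single mon_val_def lookup_single when_def if_distrib cong: if_cong)

lemma ev_one: "ev p 1 = 1"
  using ev_single[of p 0 1] by (simp add: mon_val_def monom_0)

lemma ev_prod: "ev p (\<Prod>x\<in>A. f x) = (\<Prod>x\<in>A. ev p (f x))"
  by (induction A rule: infinite_finite_induct) (simp_all add: ev_mult ev_one)

lemma coeff_ev:
  "Polynomial.coeff (ev p f) k = (\<Sum>m\<in>{m \<in> keys f. mon_deg m = k}. lookup f m * mon_val p m)"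
  by (simp add: ev_def coeff_sum sum.If_cases Int_def)

lemma coeff_ev_0: "Polynomial.coeff (ev p f) 0 = lookup f 0"
proof -
  have "{m \<in> keys f. mon_deg m = 0} = (if lookup f 0 = 0 then {} else {0})"
    by (auto simp: mon_deg_eq_0_iff in_keys_iff)
  then show ?thesis by (simp add: coeff_ev mon_val_def)
qed

lemma coeff_ev_1: "Polynomial.coeff (ev p f) 1 = (\<Sum>w\<in>UNIV. lookup f (single w 1) * p w)"
proof -
  have "{m \<in> keys f. mon_deg m = 1}
      = (\<lambda>w. single w 1) ` {w. lookup f (single w 1) \<noteq> 0}"
    unfolding mon_deg_eq_1_iff by (auto simp: in_keys_iff)
  moreover have "inj_on (\<lambda>w. single w (1::nat)) A" for A
    by (rule inj_onI) (metis keys_single one_neq_zero singleton_inject)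
  moreover have "mon_val p (single w 1) = p w" for w
    by (simp add: mon_val_def lookup_single when_def if_distrib cong: if_cong)
  ultimately have "Polynomial.coeff (ev p f) 1
      = (\<Sum>w\<in>{w. lookup f (single w 1) \<noteq> 0}. lookup f (single w 1) * p w)"
    by (simp only: coeff_ev) (subst sum.reindex, auto)
  also have "\<dots> = (\<Sum>w\<in>UNIV. lookup f (single w 1) * p w)"
    by (rule sum.mono_neutral_left) auto
  finally show ?thesis .
qed

lemma ev_homogeneous:
  assumes "homogeneous f" "0 < tot_deg f"
  shows "ev p f = Polynomial.monom (Polynomial.coeff (ev p f) (tot_deg f)) (tot_deg f)"
proof -
  obtain i where i: "\<And>m. m \<in> keys f \<Longrightarrow> int (mon_deg m) = i"
    using assms(1) unfolding homogeneous_def graded_piece_def by blast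
  have "tot_deg f \<in> insert 0 (mon_deg ` keys f)" unfolding tot_deg_def by (intro Max_in) auto
  then obtain m where "m \<in> keys f" "mon_deg m = tot_deg f" using assms(2) by auto
  then have "mon_deg m' = tot_deg f" if "m' \<in> keys f" for m'
    using i[of m] i[OF that] by simp
  then have "Polynomial.coeff (ev p f) k = 0" if "k \<noteq> tot_deg f" for k
    using that unfolding coeff_ev by (intro sum.neutral) auto
  then show ?thesis by (intro poly_eqI) simp
qed

text \<open>A nonface has a vertex outside \<open>\<sigma>\<close>, where the coordinate of
  \<open>p\<close> is 0.\<close>

lemma ev_stanley_reisner:
  fixes p :: "'n::finite \<Rightarrow> 'k::field"
  assumes "cplx \<Delta>" "\<sigma> \<in> \<Delta>" "\<And>w. w \<notin> \<sigma> \<Longrightarrow> p w = 0" "f \<in> stanley_reisner \<Delta>"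
  shows "ev p f = 0"
  using assms(4) unfolding stanley_reisner_def
proof (induction rule: ideal_gen_induct)
  case (base f)
  then obtain \<tau> where \<tau>: "f = (\<Prod>i\<in>\<tau>. var i)" "\<tau> \<notin> \<Delta>" by blast
  then obtain i where "i \<in> \<tau>" "i \<notin> \<sigma>" using cplxD(2)[OF assms(1,2)] by blast
  then have "ev p (var i) = 0" using assms(3) by (simp add: ev_var)
  then show ?case using \<open>i \<in> \<tau>\<close> unfolding \<tau>(1) ev_prod by (intro prod_zero) auto
qed (auto simp: ev_add ev_mult)

section \<open>From systems of parameters to colorings\<close>

locale sphere_sop = sphere \<Delta> d for \<Delta> :: "'n::finite set set" and d :: nat +
  fixes \<theta> :: "nat \<Rightarrow> ('n, 'k::field_char_0) mpoly"
  assumes hom: "\<And>i. i \<in> {1..d + 1} \<Longrightarrow> homogeneous (\<theta> i) \<and> 0 < tot_deg (\<theta> i)"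
    and linear_form: "(\<Sum>i\<in>UNIV. var i) \<in> sop_ideal \<Delta> \<theta>"
    and squares: "\<And>i. (var i)\<^sup>2 \<in> sop_ideal \<Delta> \<theta>"
begin

definition I where "I = {1..d + 1}"
abbreviation Lin where "Lin \<equiv> {i \<in> I. tot_deg (\<theta> i) = 1}"
abbreviation Quad where "Quad \<equiv> {i \<in> I. tot_deg (\<theta> i) = 2}"
abbreviation \<theta>_val where "\<theta>_val p i \<equiv> Polynomial.coeff (ev p (\<theta> i)) (tot_deg (\<theta> i))"
definition P where "P w i = lookup (\<theta> i) (single w 1)"

lemma finite_I [simp]: "finite I" and card_I [simp]: "card I = d + 1"
  by (simp_all add: I_def)

lemma homI: "i \<in> I \<Longrightarrow> homogeneous (\<theta> i)" "i \<in> I \<Longrightarrow> 0 < tot_deg (\<theta> i)"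
  using hom by (auto simp: I_def)

text \<open>The cofactors \<open>a\<close> are chosen before the face and the point, so information
  from different facets can be compared.\<close>

lemma ev_sop_ideal:
  assumes "f \<in> sop_ideal \<Delta> \<theta>"
  shows "\<exists>a. \<forall>\<sigma>\<in>\<Delta>. \<forall>p. (\<forall>w. w \<notin> \<sigma> \<longrightarrow> p w = 0) \<longrightarrow>
    ev p f = (\<Sum>i\<in>I. Polynomial.monom (\<theta>_val p i) (tot_deg (\<theta> i)) * ev p (a i))"
proof -
  let ?G = "{\<Prod>i\<in>\<sigma>. var i |\<sigma>. \<sigma> \<notin> \<Delta>} :: ('n, 'k) mpoly set"
  have "f \<in> ideal_gen (ideal_gen ?G \<union> \<theta> ` I)"
    using assms unfolding sop_ideal_def stanley_reisner_def complex_dim I_def .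
  from ideal_gen_insert_family[OF this finite_I]
  obtain g a where g: "g \<in> stanley_reisner \<Delta>" and f: "f = g + (\<Sum>i\<in>I. a i * \<theta> i)"
    unfolding stanley_reisner_def by (elim bexE exE)
  have "ev p f = (\<Sum>i\<in>I. Polynomial.monom (\<theta>_val p i) (tot_deg (\<theta> i)) * ev p (a i))"
    if "\<sigma> \<in> \<Delta>" "\<forall>w. w \<notin> \<sigma> \<longrightarrow> p w = 0" for \<sigma> p
  proof -
    have "ev p f = (\<Sum>i\<in>I. ev p (\<theta> i) * ev p (a i))"
      using ev_stanley_reisner[OF cplx that(1) _ g, of p] that(2)
      unfolding f by (simp only: ev_add ev_sum ev_mult mult.commute) simp
    also have "\<dots> = (\<Sum>i\<in>I. Polynomial.monom (\<theta>_val p i) (tot_deg (\<theta> i)) * ev p (a i))"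
    proof (rule sum.cong[OF refl])
      fix i assume "i \<in> I"
      then have "ev p (\<theta> i) = Polynomial.monom (\<theta>_val p i) (tot_deg (\<theta> i))"
        by (intro ev_homogeneous homI)
      then show "ev p (\<theta> i) * ev p (a i) = Polynomial.monom (\<theta>_val p i) (tot_deg (\<theta> i)) * ev p (a i)"
        by (rule arg_cong)
    qed
    finally show ?thesis .
  qed
  then show ?thesis by blast
qed

text \<open>The degree 2 part of the relation: linear \<open>\<theta> i\<close> meet the linear part
  \<open>l\<close> of their cofactor, quadratic ones its constant term \<open>c\<close>, and those
  of higher degree do not contribute. The constants do not depend on the facet.\<close>

lemma square_coeffs:
  obtains l c where "\<And>v \<sigma> p. \<sigma> \<in> \<Delta> \<Longrightarrow> (\<And>w. w \<notin> \<sigma> \<Longrightarrow> p w = 0) \<Longrightarrow>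
    (p v)\<^sup>2 = (\<Sum>i\<in>Lin. \<theta>_val p i * (\<Sum>w\<in>UNIV. l v i w * p w)) + (\<Sum>j\<in>Quad. c v j * \<theta>_val p j)"
proof -
  have "\<forall>v. \<exists>a. \<forall>\<sigma>\<in>\<Delta>. \<forall>p. (\<forall>w. w \<notin> \<sigma> \<longrightarrow> p w = 0) \<longrightarrow>
    ev p ((var v)\<^sup>2) = (\<Sum>i\<in>I. Polynomial.monom (\<theta>_val p i) (tot_deg (\<theta> i)) * ev p (a i))"
    using ev_sop_ideal[OF squares] by (rule allI)
  from choice[OF this] obtain a where a: "\<forall>v. \<forall>\<sigma>\<in>\<Delta>. \<forall>p. (\<forall>w. w \<notin> \<sigma> \<longrightarrow> p w = 0) \<longrightarrow>
    ev p ((var v)\<^sup>2) = (\<Sum>i\<in>I. Polynomial.monom (\<theta>_val p i) (tot_deg (\<theta> i)) * ev p (a v i))"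
    by (rule exE)
  define l where "l v i w = lookup (a v i) (single w 1)" for v i w
  define c where "c v i = lookup (a v i) 0" for v i
  have "(p v)\<^sup>2 = (\<Sum>i\<in>Lin. \<theta>_val p i * (\<Sum>w\<in>UNIV. l v i w * p w)) + (\<Sum>j\<in>Quad. c v j * \<theta>_val p j)"
    if \<sigma>: "\<sigma> \<in> \<Delta>" "\<And>w. w \<notin> \<sigma> \<Longrightarrow> p w = 0" for v \<sigma> p
  proof -
    let ?g = "\<lambda>i. Polynomial.coeff (Polynomial.monom (\<theta>_val p i) (tot_deg (\<theta> i)) * ev p (a v i)) 2"
    have "(p v)\<^sup>2 = Polynomial.coeff (ev p ((var v)\<^sup>2)) 2"
      by (simp add: power2_eq_square ev_mult ev_var mult_monom numeral_2_eq_2)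
    also have "\<dots> = (\<Sum>i\<in>I. ?g i)"
      using a[rule_format, of \<sigma> p v] \<sigma> by (simp add: coeff_sum)
    also have "\<dots> = (\<Sum>i\<in>Lin \<union> Quad. ?g i)"
    proof (rule sum.mono_neutral_right)
      show "\<forall>i\<in>I - (Lin \<union> Quad). ?g i = 0"
      proof
        fix i assume "i \<in> I - (Lin \<union> Quad)"
        then have "tot_deg (\<theta> i) > 2" using homI(2)[of i] by auto
        then show "?g i = 0" by (simp add: coeff_monom_mult)
      qed
    qed auto
    also have "\<dots> = (\<Sum>i\<in>Lin. ?g i) + (\<Sum>i\<in>Quad. ?g i)"
      by (rule sum.union_disjoint) auto
    also have "(\<Sum>i\<in>Lin. ?g i) = (\<Sum>i\<in>Lin. \<theta>_val p i * (\<Sum>w\<in>UNIV. l v i w * p w))"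
    proof (rule sum.cong[OF refl])
      fix i assume "i \<in> Lin"
      then have "?g i = \<theta>_val p i * Polynomial.coeff (ev p (a v i)) 1"
        by (simp add: coeff_monom_mult)
      then show "?g i = \<theta>_val p i * (\<Sum>w\<in>UNIV. l v i w * p w)" by (simp only: coeff_ev_1 l_def)
    qed
    also have "(\<Sum>i\<in>Quad. ?g i) = (\<Sum>j\<in>Quad. c v j * \<theta>_val p j)"
      by (rule sum.cong[OF refl]) (simp add: coeff_monom_mult coeff_ev_0 c_def)
    finally show ?thesis .
  qed
  then show thesis by (rule that)
qed

lemma \<theta>_val_linear:
  assumes "i \<in> Lin" "\<And>w. w \<notin> \<sigma> \<Longrightarrow> p w = 0"
  shows "\<theta>_val p i = (\<Sum>w\<in>\<sigma>. P w i * p w)"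
proof -
  have "\<theta>_val p i = (\<Sum>w\<in>UNIV. P w i * p w)" using assms(1) coeff_ev_1[of p "\<theta> i"] by (simp add: P_def)
  also have "\<dots> = (\<Sum>w\<in>\<sigma>. P w i * p w)" by (rule sum.mono_neutral_right) (use assms(2) in auto)
  finally show ?thesis .
qed

text \<open>
  On each facet \<open>F\<close> the quadratic forms among the \<open>\<theta>\<^sub>j\<close> are linearly independent modulo the linear
  ones, because there are too few of them to represent the squares of coordinates otherwise.
  As \<open>x\<^sub>v\<^sup>2\<close> vanishes on the facets that avoid \<open>v\<close>, its representation involves linear \<open>\<theta>\<^sub>i\<close> only.
\<close>

lemma all_linear: "Lin = I"
  and linear_squares: "\<exists>l. \<forall>v \<sigma> p. \<sigma> \<in> \<Delta> \<longrightarrow> (\<forall>w. w \<notin> \<sigma> \<longrightarrow> p w = 0) \<longrightarrow>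
    (p v)\<^sup>2 = (\<Sum>i\<in>I. (\<Sum>w\<in>\<sigma>. P w i * p w) * (\<Sum>w\<in>\<sigma>. l v i w * p w))"
proof -
  obtain l c where sq: "\<And>v \<sigma> p. \<sigma> \<in> \<Delta> \<Longrightarrow> (\<And>w. w \<notin> \<sigma> \<Longrightarrow> p w = 0) \<Longrightarrow>
    (p v)\<^sup>2 = (\<Sum>i\<in>Lin. \<theta>_val p i * (\<Sum>w\<in>UNIV. l v i w * p w)) + (\<Sum>j\<in>Quad. c v j * \<theta>_val p j)"
    using square_coeffs by blast
  have fin: "finite Lin" "finite Quad" by auto
  have "Lin \<union> Quad \<subseteq> I" by auto
  then have "card (Lin \<union> Quad) \<le> d + 1" using card_mono[of I "Lin \<union> Quad"] by simp
  moreover have "card (Lin \<union> Quad) = card Lin + card Quad" by (rule card_Un_disjoint) auto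
  ultimately have cards: "card Lin + card Quad \<le> d + 1" by simp
  \<comment> \<open>Points in the coordinate subspace of \<open>F\<close> where the linear forms
    vanish, in the echelon form of \<open>gaussian_elimination\<close>; there the squares are
    combinations of the quadratic forms alone.\<close>
  have facet_pts: "\<exists>S e. S \<subseteq> F \<and> d + 1 \<le> card S + card Lin \<and>
      (\<forall>s\<in>S. (\<forall>w. w \<notin> F \<longrightarrow> e s w = 0) \<and> (\<forall>s'\<in>S. e s s' = (if s = s' then 1 else 0)) \<and>
        (\<forall>v. (e s v)\<^sup>2 = (\<Sum>j\<in>Quad. c v j * \<theta>_val (e s) j)))" if F: "F \<in> facets" for F
  proof -
    obtain S e where S: "S \<subseteq> F" "card F \<le> card S + card Lin"
      and e: "\<And>s i. s \<in> S \<Longrightarrow> i \<in> Lin \<Longrightarrow> (\<Sum>w\<in>F. P w i * e s w) = 0"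
        "\<And>s w. s \<in> S \<Longrightarrow> w \<notin> F \<Longrightarrow> e s w = 0"
        "\<And>s s'. s \<in> S \<Longrightarrow> s' \<in> S \<Longrightarrow> e s s' = (if s = s' then 1 else 0)"
      using gaussian_elimination[OF finite[of F] fin(1), of "\<lambda>i w. P w i"] by blast
    have "(e s v)\<^sup>2 = (\<Sum>j\<in>Quad. c v j * \<theta>_val (e s) j)" if s: "s \<in> S" for s v
    proof -
      have "\<theta>_val (e s) i = 0" if "i \<in> Lin" for i
        using \<theta>_val_linear[OF that, of F "e s"] e(1,2) s that by simp
      then show ?thesis using sq[OF facetsD(1)[OF F], of "e s" v] e(2)[OF s] by simp
    qed
    then show ?thesis using S e(2,3) facetsD(2)[OF F] by (intro exI[of _ S] exI[of _ e]) auto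
  qed
  \<comment> \<open>On the points \<open>e s\<close>, the squares of the free coordinates form an
    identity matrix that factors through \<open>Quad\<close>, and
    \<open>card Quad \<le> card S\<close>. As the coordinate of \<open>v\<close> is 0 there,
    \<open>c v\<close> lies in the kernel.\<close>
  have c0: "c v j = 0" if j: "j \<in> Quad" for v j
  proof -
    obtain w :: 'n where "w \<noteq> v"
      using card_UNIV_gt d_pos by (metis (full_types) UNIV_eq_I card_1_singleton_iff insertI1 One_nat_def singletonI
          less_one linorder_not_less Suc_leI card.empty card_insert_disjoint empty_iff finite.emptyI)
    then obtain F where F: "F \<in> facets" "v \<notin> F" using facet_avoiding by blast
    obtain S e where S: "S \<subseteq> F" "d + 1 \<le> card S + card Lin"
      and e: "\<And>s w. s \<in> S \<Longrightarrow> w \<notin> F \<Longrightarrow> e s w = 0"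
        "\<And>s s'. s \<in> S \<Longrightarrow> s' \<in> S \<Longrightarrow> e s s' = (if s = s' then 1 else 0)"
        "\<And>s u. s \<in> S \<Longrightarrow> (e s u)\<^sup>2 = (\<Sum>j\<in>Quad. c u j * \<theta>_val (e s) j)"
      using facet_pts[OF F(1)] by blast
    show ?thesis
    proof (rule factored_identity_kernel[of S Quad c "\<lambda>s. \<theta>_val (e s)" "c v"])
      show "finite S" using S(1) finite_subset by auto
      show "card Quad \<le> card S" using S(2) cards by simp
      show "(\<Sum>j\<in>Quad. c s' j * \<theta>_val (e s) j) = (if s = s' then 1 else 0)" if "s \<in> S" "s' \<in> S" for s s'
        using e(2)[OF that] e(3)[OF that(1), of s'] by (simp split: if_splits)
      show "(\<Sum>j\<in>Quad. c v j * \<theta>_val (e s) j) = 0" if "s \<in> S" for s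
        using e(3)[OF that, of v] e(1)[OF that F(2)] by simp
    qed (use j in auto)
  qed
  show L: "Lin = I"
  proof (rule ccontr)
    assume "Lin \<noteq> I"
    then have "card Lin < card I" by (intro psubset_card_mono) auto
    \<comment> \<open>With too few linear forms a free coordinate \<open>s\<close> remains on
      \<open>F\<close>; its square is 1, but by \<open>c0\<close> it is 0.\<close>
    obtain F where F: "F \<in> facets" using ex_facet by (auto simp: facets_def)
    obtain S e where S: "S \<subseteq> F" "d + 1 \<le> card S + card Lin"
      and e: "\<And>s s'. s \<in> S \<Longrightarrow> s' \<in> S \<Longrightarrow> e s s' = (if s = s' then 1 else 0)"
        "\<And>s u. s \<in> S \<Longrightarrow> (e s u)\<^sup>2 = (\<Sum>j\<in>Quad. c u j * \<theta>_val (e s) j)"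
      using facet_pts[OF F] by blast
    have "S \<noteq> {}" using S(2) \<open>card Lin < card I\<close> by auto
    then obtain s where s: "s \<in> S" by blast
    have "(e s s)\<^sup>2 = 0" unfolding e(2)[OF s] using c0 by (intro sum.neutral) auto
    then show False using e(1)[OF s s] by simp
  qed
  have "tot_deg (\<theta> i) = 1" if "i \<in> I" for i
  proof -
    have "i \<in> Lin" using that L by simp
    then show ?thesis by simp
  qed
  then have Q: "Quad = {}" by auto
  have "(p v)\<^sup>2 = (\<Sum>i\<in>I. (\<Sum>w\<in>\<sigma>. P w i * p w) * (\<Sum>w\<in>\<sigma>. l v i w * p w))"
    if \<sigma>: "\<sigma> \<in> \<Delta>" "\<forall>w. w \<notin> \<sigma> \<longrightarrow> p w = 0" for v \<sigma> p
  proof -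
    have "(p v)\<^sup>2 = (\<Sum>i\<in>Lin. \<theta>_val p i * (\<Sum>w\<in>UNIV. l v i w * p w))"
      using sq[OF \<sigma>(1), of p v] \<sigma>(2) unfolding Q by simp
    also have "\<dots> = (\<Sum>i\<in>Lin. (\<Sum>w\<in>\<sigma>. P w i * p w) * (\<Sum>w\<in>\<sigma>. l v i w * p w))"
    proof (rule sum.cong[OF refl])
      fix i assume i: "i \<in> Lin"
      have "(\<Sum>w\<in>UNIV. l v i w * p w) = (\<Sum>w\<in>\<sigma>. l v i w * p w)"
        by (rule sum.mono_neutral_right) (use \<sigma>(2) in auto)
      then show "\<theta>_val p i * (\<Sum>w\<in>UNIV. l v i w * p w) = (\<Sum>w\<in>\<sigma>. P w i * p w) * (\<Sum>w\<in>\<sigma>. l v i w * p w)"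
        using \<theta>_val_linear[OF i, of \<sigma> p] \<sigma>(2) by simp
    qed
    finally show ?thesis unfolding L .
  qed
  then show "\<exists>l. \<forall>v \<sigma> p. \<sigma> \<in> \<Delta> \<longrightarrow> (\<forall>w. w \<notin> \<sigma> \<longrightarrow> p w = 0) \<longrightarrow>
    (p v)\<^sup>2 = (\<Sum>i\<in>I. (\<Sum>w\<in>\<sigma>. P w i * p w) * (\<Sum>w\<in>\<sigma>. l v i w * p w))" by blast
qed

text \<open>At a common zero of the forms all squares vanish. So the vectors \<open>P w\<close> of a
  facet form an invertible matrix.\<close>

lemma facet_injective:
  assumes F: "F \<in> facets" and p: "\<And>i. i \<in> I \<Longrightarrow> (\<Sum>w\<in>F. P w i * p w) = 0"
  shows "\<forall>w\<in>F. p w = 0"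
proof
  obtain l where l: "\<And>v \<sigma> p. \<sigma> \<in> \<Delta> \<Longrightarrow> (\<forall>w. w \<notin> \<sigma> \<longrightarrow> p w = 0) \<Longrightarrow>
    (p v)\<^sup>2 = (\<Sum>i\<in>I. (\<Sum>w\<in>\<sigma>. P w i * p w) * (\<Sum>w\<in>\<sigma>. l v i w * p w))"
    using linear_squares by blast
  fix v assume v: "v \<in> F"
  let ?p = "\<lambda>w. if w \<in> F then p w else 0"
  have "(\<Sum>w\<in>F. P w i * ?p w) = 0" if "i \<in> I" for i using p[OF that] by simp
  then have "(?p v)\<^sup>2 = 0" using l[OF facetsD(1)[OF F], of ?p v] by simp
  then show "p v = 0" using v by simp
qed

section \<open>Normal vectors at the vertices\<close>

abbreviation dot where "dot x y \<equiv> \<Sum>i\<in>I. x i * y i"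

lemma facet_kernel:
  assumes "F \<in> facets" "\<And>w. w \<in> F \<Longrightarrow> dot q (P w) = 0" "i \<in> I"
  shows "q i = (0 :: 'k)"
  by (rule square_left_kernel[of F I "\<lambda>i w. P w i" q i]) (use assms facet_injective facetsD(2) in auto)

text \<open>Polarization: the relation for \<open>x_v^2\<close> is evaluated at unit vectors and at
  sums of two unit vectors along an edge. The vector \<open>l v w\<close> collects the coefficients
  at \<open>w\<close> of the linear cofactors.\<close>

lemma square_vectors:
  obtains l where "\<And>v. dot (P v) (l v v) = 1"
    "\<And>v w. w \<noteq> v \<Longrightarrow> dot (P w) (l v w) = 0"
    "\<And>v w w'. {w, w'} \<in> \<Delta> \<Longrightarrow> w \<noteq> w' \<Longrightarrow> dot (P w) (l v w') + dot (P w') (l v w) = 0"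
proof -
  obtain l where l: "\<And>v \<sigma> p. \<sigma> \<in> \<Delta> \<Longrightarrow> (\<forall>w. w \<notin> \<sigma> \<longrightarrow> p w = 0) \<Longrightarrow>
    (p v)\<^sup>2 = (\<Sum>i\<in>I. (\<Sum>w\<in>\<sigma>. P w i * p w) * (\<Sum>w\<in>\<sigma>. l v i w * p w))"
    using linear_squares by blast
  define m where "m v w i = l v i w" for v w i
  have sq01: "(if b then 1 else 0 :: 'k)\<^sup>2 = (if b then 1 else 0)" for b by simp
  have one: "(if v = w then 1 else 0) = dot (P w) (m v w)" for v w
    using l[of "{w}" "\<lambda>u. if u = w then 1 else 0" v] unfolding sq01 by (simp add: m_def)
  have two: "dot (P w) (m v w') + dot (P w') (m v w) = 0" if w: "{w, w'} \<in> \<Delta>" "w \<noteq> w'" for v w w'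
  proof -
    have "(if v = w \<or> v = w' then 1 else 0) = (\<Sum>i\<in>I. (P w i + P w' i) * (m v w i + m v w' i))"
      using l[OF w(1), of "\<lambda>u. if u = w \<or> u = w' then 1 else 0" v] w(2) unfolding sq01 by (simp add: m_def)
    also have "\<dots> = dot (P w) (m v w) + dot (P w') (m v w')
        + (dot (P w) (m v w') + dot (P w') (m v w))"
      by (simp add: algebra_simps sum.distrib)
    also have "dot (P w) (m v w) + dot (P w') (m v w') = (if v = w \<or> v = w' then 1 else 0)"
      using w(2) by (auto simp flip: one)
    finally show ?thesis by simp
  qed
  show thesis
  proof (rule that[of m])
    show "dot (P v) (m v v) = 1" for v using one[of v v] by simp
    show "dot (P w) (m v w) = 0" if "w \<noteq> v" for v w using one[of v w] that by simp
  qed (rule two)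
qed

lemma dot_commute: "dot x y = dot y (x :: nat \<Rightarrow> 'k)"
  by (simp add: mult.commute)

lemma dot_diff_right: "dot x (\<lambda>i. y i - z i) = dot x y - dot x (z :: nat \<Rightarrow> 'k)"
  by (simp add: right_diff_distrib sum_subtractf)

lemma facet_edge: "F \<in> facets \<Longrightarrow> w \<in> F \<Longrightarrow> w' \<in> F \<Longrightarrow> {w, w'} \<in> \<Delta>"
  by (rule cplxD(2)[OF cplx facetsD(1)]) auto

text \<open>
  The vectors \<open>l v w\<close> with \<open>w \<noteq> v\<close> are the images of the \<open>P w\<close> under a single skew-symmetric
  map: this holds on one facet that avoids \<open>v\<close> and propagates along ridges, since the facets avoiding
  \<open>v\<close> are strongly connected.  Subtracting this map turns \<open>l v v\<close> into the required vector.
\<close>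

lemma ex_normal_vector:
  obtains n where "dot n (P v) = 1" "\<And>w. {v, w} \<in> \<Delta> \<Longrightarrow> w \<noteq> v \<Longrightarrow> dot n (P w) = 0"
proof -
  obtain l where l1: "\<And>v. dot (P v) (l v v) = 1"
    and l0: "\<And>v w. w \<noteq> v \<Longrightarrow> dot (P w) (l v w) = 0"
    and la: "\<And>v w w'. {w, w'} \<in> \<Delta> \<Longrightarrow> w \<noteq> w' \<Longrightarrow> dot (P w) (l v w') + dot (P w') (l v w) = 0"
    using square_vectors by blast
  obtain u :: 'n where "u \<noteq> v"
  proof -
    have "\<not> (UNIV :: 'n set) \<subseteq> {v}"
    proof
      assume "(UNIV :: 'n set) \<subseteq> {v}"
      then have "CARD('n) \<le> card {v}" by (intro card_mono) auto
      then show False using card_UNIV_gt d_pos by simp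
    qed
    then show thesis using that by blast
  qed
  then obtain E where E: "E \<in> facets" "v \<notin> E" using facet_avoiding by blast
  have "\<exists>q. \<forall>w'\<in>E. dot q (P w') = (if w = w' then 1 else 0)" if "w \<in> E" for w
    by (rule square_dual_vector) (use that E facet_injective facetsD(2) in auto)
  then have "\<forall>w\<in>E. \<exists>q. \<forall>w'\<in>E. dot q (P w') = (if w = w' then 1 else 0)" by blast
  from bchoice[OF this] obtain q where q': "\<forall>w\<in>E. \<forall>w'\<in>E. dot (q w) (P w') = (if w = w' then 1 else 0)"
    by (rule exE)
  then have q: "dot (q w) (P w') = (if w = w' then 1 else 0)" if "w \<in> E" "w' \<in> E" for w w'
    using that by simp
  define b where "b w w' = dot (P w') (l v w)" for w w'
  have b: "b w w' + b w' w = 0" if "w \<in> E" "w' \<in> E" for w w'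
  proof (cases "w = w'")
    case True
    then have "b w w = 0" unfolding b_def using l0 that E by metis
    then show ?thesis using True by simp
  next
    case False
    then show ?thesis using la[OF facet_edge[OF E(1) that], of v] by (simp add: b_def add.commute)
  qed
  \<comment> \<open>The linear map whose bilinear form has the matrix \<open>b\<close> in the basis
    of the \<open>P w\<close> with \<open>w\<close> in \<open>E\<close>; the dual vectors
    \<open>q\<close> read off and supply the coordinates.\<close>
  define M where "M x i = (\<Sum>w\<in>E. \<Sum>w'\<in>E. dot (q w) x * b w w' * q w' i)" for x i
  have dM: "dot y (M x) = (\<Sum>w\<in>E. \<Sum>w'\<in>E. dot (q w) x * b w w' * dot (q w') y)" for x y
  proof -
    have "dot y (M x) = (\<Sum>i\<in>I. \<Sum>w\<in>E. \<Sum>w'\<in>E. dot (q w) x * b w w' * (q w' i * y i))"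
      unfolding M_def sum_distrib_left by (simp only: mult_ac)
    also have "\<dots> = (\<Sum>w\<in>E. \<Sum>w'\<in>E. \<Sum>i\<in>I. dot (q w) x * b w w' * (q w' i * y i))"
      by (subst sum.swap, rule sum.cong[OF refl], rule sum.swap)
    finally show ?thesis by (simp only: sum_distrib_left)
  qed
  have skew: "dot y (M x) + dot x (M y) = 0" for x y
  proof -
    have "dot x (M y) = (\<Sum>w\<in>E. \<Sum>w'\<in>E. dot (q w') y * b w' w * dot (q w) x)"
      unfolding dM by (rule sum.swap)
    then have "dot y (M x) + dot x (M y) = (\<Sum>w\<in>E. \<Sum>w'\<in>E. dot (q w) x * dot (q w') y * (b w w' + b w' w))"
      unfolding dM by (simp add: sum.distrib algebra_simps)
    also have "\<dots> = 0" using b by (intro sum.neutral ballI) simp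
    finally show ?thesis .
  qed
  \<comment> \<open>Since \<open>M\<close> is skew, \<open>m\<close> satisfies the same relations as
    \<open>l v\<close> in \<open>square_vectors\<close>; in addition it vanishes on
    \<open>E\<close>.\<close>
  define m where "m w i = l v w i - M (P w) i" for w i
  have dm: "dot x (m w) = dot x (l v w) - dot x (M (P w))" for x w
    unfolding m_def by (rule dot_diff_right)
  have "(A - a) + (B - b) = (A + B) - (b + a)" for A B a b :: 'k by simp
  then have ma: "dot (P w) (m w') + dot (P w') (m w) = 0" if "{w, w'} \<in> \<Delta>" "w \<noteq> w'" for w w'
    unfolding dm by (simp only: la[OF that, of v] skew[of "P w'" "P w"] diff_self)
  \<comment> \<open>Here 2 has to be invertible.\<close>
  have Mself: "dot x (M x) = 0" for x using skew[of x x] by simp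
  have m0: "dot (P w) (m w) = 0" if "w \<noteq> v" for w
    unfolding dm Mself using l0[OF that] by simp
  have m1: "dot (P v) (m v) = 1" unfolding dm Mself using l1 by simp
  have zero: "m w i = 0" if "F \<in> facets" "\<And>u. u \<in> F \<Longrightarrow> dot (P u) (m w) = 0" "i \<in> I" for F w i
    by (rule facet_kernel[OF that(1) _ that(3)]) (use that(2) dot_commute in metis)
  have mE: "m w i = 0" if w: "w \<in> E" "i \<in> I" for w i
  proof (rule zero[OF E(1) _ w(2)])
    fix u assume u: "u \<in> E"
    have "dot (P u) (M (P w)) = (\<Sum>x\<in>E. \<Sum>x'\<in>E. (if x = w then 1 else 0) * b x x' * (if x' = u then 1 else 0))"
      unfolding dM using q w u by (intro sum.cong refl) simp
    also have "\<dots> = (\<Sum>x\<in>E. \<Sum>x'\<in>E. if x = w then if x' = u then b x x' else 0 else 0)"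
      by (intro sum.cong refl) simp
    also have "\<dots> = (\<Sum>x\<in>E. if x = w then \<Sum>x'\<in>E. if x' = u then b x x' else 0 else 0)"
      by (intro sum.cong refl) simp
    also have "\<dots> = b w u" using w u by simp
    finally show "dot (P u) (m w) = 0" unfolding dm b_def by simp
  qed
  define C where "C = {F \<in> facets. v \<notin> F \<and> (\<forall>w\<in>F. \<forall>i\<in>I. m w i = 0)}"
  have "C = {F \<in> facets. v \<notin> F}"
  proof (rule antistar_connected)
    show "C \<noteq> {}" using E mE by (auto simp: C_def)
    show "F' \<in> C" if F: "F \<in> C" "F' \<in> facets" "v \<notin> F'" "card (F \<inter> F') = d" for F F'
    proof -
      have FF: "F \<in> facets" "\<And>w i. w \<in> F \<Longrightarrow> i \<in> I \<Longrightarrow> m w i = 0" using F(1) by (auto simp: C_def)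
      have "card (F' - F) = card F' - card (F' \<inter> F)" by (rule card_Diff_subset_Int) simp
      then have "card (F' - F) = 1" using F(4) facetsD(2)[OF F(2)] by (simp add: Int_commute)
      then obtain x where x: "F' - F = {x}" by (auto simp: card_1_singleton_iff)
      \<comment> \<open>The new vector \<open>m x\<close> is orthogonal to \<open>P x\<close> by
        \<open>m0\<close>, and to \<open>P u\<close> for the other vertices of \<open>F'\<close>
        because \<open>m u = 0\<close> in the relation \<open>ma\<close>; hence it is 0 by
        \<open>facet_kernel\<close>.\<close>
      have mx: "m x i = 0" if i: "i \<in> I" for i
      proof (rule zero[OF F(2) _ i])
        fix u assume u: "u \<in> F'"
        show "dot (P u) (m x) = 0"
        proof (cases "u = x")
          case True
          then show ?thesis using m0[of x] F(3) u by metis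
        next
          case False
          then have "u \<in> F" using u x by blast
          then have "dot (P x) (m u) = 0" using FF(2) by simp
          moreover have "{u, x} \<in> \<Delta>" using facet_edge[OF F(2) u] x by blast
          ultimately show ?thesis using ma[of u x] False by simp
        qed
      qed
      have "m w i = 0" if "w \<in> F'" "i \<in> I" for w i
      proof (cases "w \<in> F")
        case False
        then have "w = x" using x that(1) by blast
        then show ?thesis using mx that(2) by simp
      qed (use FF(2) that in simp)
      then show ?thesis using F by (simp add: C_def)
    qed
  qed (auto simp: C_def)
  note C_eq = this
  have mw: "m w i = 0" if wv: "w \<noteq> v" and i: "i \<in> I" for w i
  proof -
    obtain F where F: "F \<in> facets" "w \<in> F" "v \<notin> F" using facet_avoiding[OF wv] by blast
    then have "F \<in> C" unfolding C_eq by blast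
    then show ?thesis using F(2) i by (simp add: C_def)
  qed
  show thesis
  proof (rule that[of "m v"])
    show "dot (m v) (P v) = 1" using m1 dot_commute by metis
    show "dot (m v) (P w) = 0" if "{v, w} \<in> \<Delta>" "w \<noteq> v" for w
    proof -
      \<comment> \<open>Along an edge at \<open>v\<close>, the relation \<open>ma\<close> now has
        only the term with \<open>m v\<close> left.\<close>
      have "dot (P v) (m w) = 0" using mw[OF that(2)] by simp
      then have "dot (P w) (m v) = 0" using ma[of v w] that by simp
      then show ?thesis using dot_commute by metis
    qed
  qed
qed

text \<open>The degree 1 part of (U3), evaluated at the vertices: all forms are linear, so their
  cofactors enter by the constant terms, which constitute \<open>\<mu>\<close>.\<close>

lemma ex_affine_functional:
  obtains \<mu> where "\<And>w. dot \<mu> (P w) = 1"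
proof -
  obtain a where a: "\<And>\<sigma> p. \<sigma> \<in> \<Delta> \<Longrightarrow> (\<forall>w. w \<notin> \<sigma> \<longrightarrow> p w = 0) \<Longrightarrow>
    ev p (\<Sum>i\<in>UNIV. var i) = (\<Sum>i\<in>I. Polynomial.monom (\<theta>_val p i) (tot_deg (\<theta> i)) * ev p (a i))"
    using ev_sop_ideal[OF linear_form] by blast
  have "dot (\<lambda>i. lookup (a i) 0) (P w) = 1" for w
  proof -
    let ?p = "\<lambda>u. if u = w then 1 else 0 :: 'k"
    have "1 = Polynomial.coeff (ev ?p (\<Sum>i\<in>UNIV. var i)) 1"
      by (simp add: ev_sum ev_var coeff_sum)
    also have "\<dots> = (\<Sum>i\<in>I. Polynomial.coeff (Polynomial.monom (\<theta>_val ?p i) (tot_deg (\<theta> i)) * ev ?p (a i)) 1)"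
      using a[of "{w}" ?p] by (simp add: coeff_sum)
    also have "\<dots> = (\<Sum>i\<in>I. lookup (a i) 0 * P w i)"
    proof (rule sum.cong[OF refl])
      fix i assume "i \<in> I"
      then have i: "i \<in> Lin" using all_linear by blast
      then have "\<theta>_val ?p i = P w i" using \<theta>_val_linear[OF i, of "{w}" ?p] by simp
      then show "Polynomial.coeff (Polynomial.monom (\<theta>_val ?p i) (tot_deg (\<theta> i)) * ev ?p (a i)) 1 = lookup (a i) 0 * P w i"
        using i by (simp add: coeff_monom_mult coeff_ev_0)
    qed
    finally show ?thesis by simp
  qed
  then show thesis by (rule that)
qed

text \<open>The normal vectors of the vertices of \<open>F\<close> are dual to the vectors
  \<open>P w\<close> of \<open>F\<close>. Those at the ridge \<open>F - {v}\<close> annihilate both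
  \<open>P v\<close> and \<open>P x\<close>, so \<open>P x\<close> is a multiple \<open>c\<close> of
  \<open>P v\<close>; and \<open>\<mu>\<close> takes the value 1 on both, which forces
  \<open>c = 1\<close>.\<close>

lemma ridge_opposite_vertices:
  assumes F: "F \<in> facets" "v \<in> F" and F': "insert x (F - {v}) \<in> facets" "x \<notin> F" and i: "i \<in> I"
  shows "P x i = P v i"
proof -
  have "\<exists>n. dot n (P u) = 1 \<and> (\<forall>w. {u, w} \<in> \<Delta> \<longrightarrow> w \<noteq> u \<longrightarrow> dot n (P w) = 0)" for u
    by (rule ex_normal_vector[of u]) blast
  then have "\<forall>u. \<exists>n. dot n (P u) = 1 \<and> (\<forall>w. {u, w} \<in> \<Delta> \<longrightarrow> w \<noteq> u \<longrightarrow> dot n (P w) = 0)"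
    by (rule allI)
  from choice[OF this] obtain n where
    n': "\<forall>u. dot (n u) (P u) = 1 \<and> (\<forall>w. {u, w} \<in> \<Delta> \<longrightarrow> w \<noteq> u \<longrightarrow> dot (n u) (P w) = 0)"
    by (rule exE)
  have n: "dot (n u) (P u) = 1" "{u, w} \<in> \<Delta> \<Longrightarrow> w \<noteq> u \<Longrightarrow> dot (n u) (P w) = 0" for u w
    using n' by auto
  obtain \<mu> where \<mu>: "\<And>w. dot \<mu> (P w) = 1" using ex_affine_functional by blast
  have nd: "dot (n u) (P w) = (if u = w then 1 else 0)" if "u \<in> F" "w \<in> F" for u w
    using n(1)[of u] n(2)[of u w] facet_edge[OF F(1) that] by auto
  define c where "c = dot (n v) (P x)"
  define y where "y i = P x i - c * P v i" for i
  have dy: "dot z y = dot z (P x) - c * dot z (P v)" for z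
    by (simp add: y_def right_diff_distrib sum_subtractf sum_distrib_left mult_ac)
  have y0: "y i = 0" if i: "i \<in> I" for i
  proof (rule square_left_kernel[of F I "\<lambda>i w. n w i" y i])
    show "\<forall>w\<in>F. p w = 0" if p: "\<And>i. i \<in> I \<Longrightarrow> (\<Sum>w\<in>F. n w i * p w) = 0" for p
    proof
      fix w assume w: "w \<in> F"
      have "0 = (\<Sum>i\<in>I. (\<Sum>u\<in>F. n u i * p u) * P w i)" using p by simp
      also have "\<dots> = (\<Sum>u\<in>F. p u * dot (n u) (P w))"
        unfolding sum_distrib_right sum_distrib_left by (subst sum.swap) (simp only: mult_ac)
      also have "\<dots> = (\<Sum>u\<in>F. if u = w then p u else 0)" using nd w by (intro sum.cong refl) simp
      also have "\<dots> = p w" using w by simp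
      finally show "p w = 0" by simp
    qed
    fix w assume w: "w \<in> F"
    have "dot (n w) y = 0"
    proof (cases "w = v")
      case True
      then show ?thesis unfolding dy using n(1)[of v] by (simp add: c_def)
    next
      case False
      then have "{w, x} \<in> \<Delta>" using w by (intro facet_edge[OF F'(1)]) auto
      then have "dot (n w) (P x) = 0" using n(2) w F'(2) by metis
      then show ?thesis unfolding dy using nd[OF w F(2)] False by simp
    qed
    then show "(\<Sum>i\<in>I. y i * n w i) = 0" using dot_commute by metis
  qed (use i F facetsD(2) in auto)
  then have "dot \<mu> y = 0" by simp
  then have "c = 1" unfolding dy \<mu> by simp
  then show ?thesis using y0[OF i] by (simp add: y_def)
qed

lemma balanced: "balanced \<Delta>"
proof -
  \<comment> \<open>The functions \<open>P w\<close> are also defined off \<open>I\<close>;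
    restriction makes equality of keys the equality of vectors.\<close>
  define key where "key w = restrict (P w) I" for w
  have key: "key u = key w \<longleftrightarrow> (\<forall>i\<in>I. P u i = P w i)" for u w
    by (auto simp: key_def restrict_def fun_eq_iff)
  \<comment> \<open>Adjacent vertices are separated by the normal vector of one of them.\<close>
  have inj: "key u \<noteq> key w" if uw: "{u, w} \<in> \<Delta>" "u \<noteq> w" for u w
  proof
    assume k: "key u = key w"
    obtain n where n: "dot n (P u) = 1" "\<And>w. {u, w} \<in> \<Delta> \<Longrightarrow> w \<noteq> u \<Longrightarrow> dot n (P w) = 0"
      using ex_normal_vector[of u] by blast
    have "dot n (P u) = dot n (P w)"
      using k unfolding key by (intro sum.cong refl) simp
    then show False using n(1) n(2)[OF uw(1)] uw(2) by simp
  qed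
  obtain F0 where F0: "F0 \<in> facets" using ex_facet by (auto simp: facets_def)
  define C where "C = {F \<in> facets. key ` F = key ` F0}"
  have "C = facets"
  proof (rule facets_connected)
    \<comment> \<open>Crossing a ridge exchanges a vertex for one with the same key, so all facets
      carry the same set of keys.\<close>
    show "F' \<in> C" if F: "F \<in> C" "F' \<in> facets" "card (F \<inter> F') = d" for F F'
    proof -
      have Ff: "F \<in> facets" using F(1) by (simp add: C_def)
      have "card (F' - F) = card F' - card (F' \<inter> F)" "card (F - F') = card F - card (F \<inter> F')"
        by (rule card_Diff_subset_Int, simp)+
      then have "card (F' - F) = 1" "card (F - F') = 1"
        using F(3) facetsD(2)[OF F(2)] facetsD(2)[OF Ff] by (simp_all add: Int_commute)
      then obtain x v where xv: "F' - F = {x}" "F - F' = {v}" by (auto simp: card_1_singleton_iff)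
      then have F'eq: "F' = insert x (F - {v})" "x \<notin> F" "v \<in> F" by auto
      have "key x = key v"
        unfolding key using ridge_opposite_vertices[OF Ff F'eq(3) _ F'eq(2)] F(2) F'eq(1) by blast
      then have "key ` F' = key ` F" using F'eq by (metis image_insert insert_Diff)
      then show ?thesis using F by (simp add: C_def)
    qed
  qed (use F0 in \<open>auto simp: C_def\<close>)
  then have "F \<in> C" if "F \<in> facets" for F using that by simp
  then have img: "key ` F = key ` F0" if "F \<in> facets" for F using that unfolding C_def by blast
  have "inj_on key F0"
  proof (rule inj_onI, rule ccontr)
    fix u w assume uw: "u \<in> F0" "w \<in> F0" "key u = key w" "u \<noteq> w"
    then have "{u, w} \<in> \<Delta>" by (intro facet_edge[OF F0])
    then show False using inj uw by blast
  qed
  then have "card (key ` F0) = d + 1" using facetsD(2)[OF F0] by (simp add: card_image)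
  then obtain h where h: "bij_betw h (key ` F0) I"
    using finite_same_card_bij[of "key ` F0" I] by auto
  have kF0: "key w \<in> key ` F0" for w
    using pure[OF vertex[of w]] img by blast
  have "proper_coloring \<Delta> (\<lambda>w. h (key w))"
    unfolding proper_coloring_def complex_dim I_def[symmetric]
  proof (intro conjI allI impI)
    show "h (key w) \<in> I" for w using h kF0[of w] by (auto simp: bij_betw_def)
    show "h (key u) \<noteq> h (key w)" if "{u, w} \<in> \<Delta> \<and> u \<noteq> w" for u w
      using inj[of u w] that h kF0 unfolding bij_betw_def by (meson inj_on_eq_iff)
  qed
  then show ?thesis unfolding balanced_def by blast
qed

end

theorem theorem4p5:
  fixes \<Delta> :: "'n::finite set set" and d :: nat
  assumes "simplicial_sphere d \<Delta>" and "d > 0"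
  shows "((\<exists>t (\<theta> :: nat \<Rightarrow> ('n, 'k::field_char_0) mpoly). unexpected_sop2 \<Delta> t \<theta>) \<longleftrightarrow> balanced \<Delta>) \<and>
         (\<forall>\<rho>. proper_coloring \<Delta> \<rho> \<longrightarrow>
           (\<exists>t. unexpected_sop2 \<Delta> t (colored_sop \<rho> :: nat \<Rightarrow> ('n, 'k) mpoly)))"
proof -
  interpret sphere \<Delta> d using assms by unfold_locales
  have "balanced \<Delta>" if "unexpected_sop2 \<Delta> t \<theta>" for t and \<theta> :: "nat \<Rightarrow> ('n, 'k) mpoly"
  proof -
    interpret sphere_sop \<Delta> d \<theta>
      using that by unfold_locales (simp_all add: unexpected_sop2_def Let_def)
    show ?thesis by (rule balanced)
  qed
  then show ?thesis using colored_sop_unexpected unfolding balanced_def by blast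
qed

end
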